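(* Let $\mathsf{C}$ be a category of groups with operations and $\mathsf{TC}$ the corresponding category of topological groups with operations. Let $X$ be an object of $\mathsf{TC}$ such that the underlying topology of $X$ has a simply connected cover. Then the category $\mathsf{Cov}_{\mathsf{TC}}/X$ of covers of $X$ in $\mathsf{TC}$ and the category $\mathsf{Cov}_{\mathsf{Cat}(\mathsf{C})}/\pi(X)$ of covers of the fundamental groupoid $\pi(X)$ in the category $\mathsf{Cat}(\mathsf{C})$ of internal groupoids in $\mathsf{C}$ are equivalent.
   Context: Groupoids. A groupoid $G$ has a set of morphisms (called elements), also denoted $G$, a set of objects $G_0$, initial and final point maps $d_0,d_1\colon G\to G_0$, and an object inclusion $\epsilon\colon G_0\to G$. The composite $a\circ b$ is defined when $d_1(a)=d_0(b)$, and then $d_0(a\circ b)=d_0(a)$, $d_1(a\circ b)=d_1(b)$. $St_G x=\{a\in G: d_0(a)=x\}$ is the star of $x$. A morphism $p\colon\widetilde G\to G$ of groupoids is a covering morphism if for each $\tilde x\in\widetilde G_0$ the restriction $St_{\widetilde G}\tilde x\to St_G p(\tilde x)$ is bijective. Groups with operations. A category of groups with operations $\mathsf{C}$ is the category of groups equipped with a set of operations $\Omega$ satisfying a set of identities $\mathsf{E}$, where $\mathsf{E}$ includes the group laws and, with $\Omega_i$ the set of $i$-ary operations: (a) $\Omega=\Omega_0\cup\Omega_1\cup\Omega_2$; (b) the group operations, written additively (but not assumed commutative) $0,-,+$, are elements of $\Omega_0,\Omega_1,\Omega_2$ respectively; put $\Omega_2'=\Omega_2\setminus\{+\}$, $\Omega_1'=\Omega_1\setminus\{-\}$;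 if $\star\in\Omega_2'$ then $\star^\circ$, defined by $a\star^\circ b=b\star a$, is also in $\Omega_2'$; and $\Omega_0=\{0\}$; (c) for each $\star\in\Omega_2'$, $\mathsf{E}$ includes $a\star(b+c)=a\star b+a\star c$; (d) for each $\omega\in\Omega_1'$ and $\star\in\Omega_2'$, $\mathsf{E}$ includes $\omega(a+b)=\omega(a)+\omega(b)$ and $\omega(a)\star b=\omega(a\star b)$. Morphisms are group homomorphisms preserving the operations in $\Omega_1'$ and $\Omega_2'$. Topological groups with operations. $\mathsf{TC}$ is the category of topological groups with the set $\Omega$ of continuous operations satisfying the identities $\mathsf{E}$ (same $\Omega$, $\mathsf{E}$ as for $\mathsf{C}$); morphisms are continuous group homomorphisms preserving the operations in $\Omega_1'$ and $\Omega_2'$. A morphism $p\colon\widetilde X\to X$ in $\mathsf{TC}$ is a covering morphism if it is a covering map on underlying spaces. $\mathsf{Cov}_{\mathsf{TC}}/X$ has as objects the covering morphisms $p\colon\widetilde X\to X$ in $\mathsf{TC}$, and as morphisms from $p\colon\widetilde X\to X$ to $q\colon\widetilde Y\to X$ the morphisms $f\colon\widetilde X\to\widetilde Y$ in $\mathsf{TC}$ with $qf=p$. Internal groupoids. An internal groupoid (equivalently, internal category) $G$ in $\mathsf{C}$ is a category (automatically a groupoid) in which $G$ and $G_0$ are objects of $\mathsf{C}$ and $d_0,d_1\colon G\to G_0$, $\epsilon\colon G_0\to G$ and the partial composition $\circ\colon G_{d_1}\times_{d_0}G\to G$ are morphisms in $\mathsf{C}$. A morphism in $\mathsf{Cat}(\mathsf{C})$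 is a morphism of the underlying groupoids which is also a morphism in $\mathsf{C}$. A morphism of internal groupoids is a cover (covering morphism) if it is a covering morphism on the underlying groupoids. For an internal groupoid $G$ in $\mathsf{C}$, $\mathsf{Cov}_{\mathsf{Cat}(\mathsf{C})}/G$ has as objects the covering morphisms $p\colon\widetilde G\to G$ of internal groupoids, and as morphisms from $p\colon\widetilde G\to G$ to $q\colon\widetilde H\to G$ the morphisms $f\colon\widetilde G\to\widetilde H$ of internal groupoids which are also covering morphisms and satisfy $qf=p$. For $X$ an object of $\mathsf{TC}$, the fundamental groupoid $\pi(X)$ (objects the points of $X$, elements the homotopy classes rel endpoints of paths in $X$) is an internal groupoid in $\mathsf{C}$ with operations induced by those of $X$: $[a]\star[b]=[a\star b]$, $\omega[a]=[\omega(a)]$, computed pointwise on paths.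
   Formalization: The underlying space of X is additionally assumed locally path connected; without this the claim fails, e.g. for groups with X an irrational line in the 2-torus in the subspace topology. *)

theory Defs
  imports "HOL-Analysis.Analysis" "HOL-Algebra.Group"
begin

section \<open>Categories and equivalence of categories\<close>

text \<open>Hom-sets of different pairs of objects need not be disjoint (a function does not know its
  codomain), so composition takes the three objects involved as arguments:
  \<open>Cmp C A B D g f\<close> is \<open>g\<close> after \<open>f\<close> for \<open>f : A \<rightarrow> B\<close>, \<open>g : B \<rightarrow> D\<close>.\<close>

record ('o, 'm) cat =
  Ob :: "'o set"
  Hom :: "'o \<Rightarrow> 'o \<Rightarrow> 'm set"
  Idn :: "'o \<Rightarrow> 'm"
  Cmp :: "'o \<Rightarrow> 'o \<Rightarrow> 'o \<Rightarrow> 'm \<Rightarrow> 'm \<Rightarrow> 'm"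

definition is_category :: "('o, 'm) cat \<Rightarrow> bool" where
  "is_category C \<longleftrightarrow>
     (\<forall>A\<in>Ob C. Idn C A \<in> Hom C A A) \<and>
     (\<forall>A\<in>Ob C. \<forall>B\<in>Ob C. \<forall>D\<in>Ob C. \<forall>f\<in>Hom C A B. \<forall>g\<in>Hom C B D. Cmp C A B D g f \<in> Hom C A D) \<and>
     (\<forall>A\<in>Ob C. \<forall>B\<in>Ob C. \<forall>f\<in>Hom C A B.
        Cmp C A A B f (Idn C A) = f \<and> Cmp C A B B (Idn C B) f = f) \<and>
     (\<forall>A\<in>Ob C. \<forall>B\<in>Ob C. \<forall>D\<in>Ob C. \<forall>E\<in>Ob C. \<forall>f\<in>Hom C A B. \<forall>g\<in>Hom C B D. \<forall>h\<in>Hom C D E.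
        Cmp C A D E h (Cmp C A B D g f) = Cmp C A B E (Cmp C B D E h g) f)"

text \<open>A functor is given by its object map and its arrow maps \<open>Fm A B : Hom A B \<rightarrow> Hom (Fo A) (Fo B)\<close>.\<close>

definition is_functor ::
  "('o, 'm) cat \<Rightarrow> ('p, 'n) cat \<Rightarrow> ('o \<Rightarrow> 'p) \<Rightarrow> ('o \<Rightarrow> 'o \<Rightarrow> 'm \<Rightarrow> 'n) \<Rightarrow> bool" where
  "is_functor C D Fo Fm \<longleftrightarrow>
     (\<forall>A\<in>Ob C. Fo A \<in> Ob D) \<and>
     (\<forall>A\<in>Ob C. \<forall>B\<in>Ob C. \<forall>f\<in>Hom C A B. Fm A B f \<in> Hom D (Fo A) (Fo B)) \<and>
     (\<forall>A\<in>Ob C. Fm A A (Idn C A) = Idn D (Fo A)) \<and>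
     (\<forall>A\<in>Ob C. \<forall>B\<in>Ob C. \<forall>E\<in>Ob C. \<forall>f\<in>Hom C A B. \<forall>g\<in>Hom C B E.
        Fm A E (Cmp C A B E g f) = Cmp D (Fo A) (Fo B) (Fo E) (Fm B E g) (Fm A B f))"

definition is_iso :: "('o, 'm) cat \<Rightarrow> 'o \<Rightarrow> 'o \<Rightarrow> 'm \<Rightarrow> bool" where
  "is_iso C A B f \<longleftrightarrow> f \<in> Hom C A B \<and>
     (\<exists>g\<in>Hom C B A. Cmp C A B A g f = Idn C A \<and> Cmp C B A B f g = Idn C B)"

definition is_natural_iso ::
  "('o, 'm) cat \<Rightarrow> ('p, 'n) cat \<Rightarrow>
   ('o \<Rightarrow> 'p) \<Rightarrow> ('o \<Rightarrow> 'o \<Rightarrow> 'm \<Rightarrow> 'n) \<Rightarrow> ('o \<Rightarrow> 'p) \<Rightarrow> ('o \<Rightarrow> 'o \<Rightarrow> 'm \<Rightarrow> 'n) \<Rightarrow> ('o \<Rightarrow> 'n) \<Rightarrow> bool" where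
  "is_natural_iso C D Fo Fm Go Gm \<eta> \<longleftrightarrow>
     (\<forall>A\<in>Ob C. is_iso D (Fo A) (Go A) (\<eta> A)) \<and>
     (\<forall>A\<in>Ob C. \<forall>B\<in>Ob C. \<forall>f\<in>Hom C A B.
        Cmp D (Fo A) (Fo B) (Go B) (\<eta> B) (Fm A B f) = Cmp D (Fo A) (Go A) (Go B) (Gm A B f) (\<eta> A))"

definition equivalent_categories :: "('o, 'm) cat \<Rightarrow> ('p, 'n) cat \<Rightarrow> bool" where
  "equivalent_categories C D \<longleftrightarrow> is_category C \<and> is_category D \<and>
     (\<exists>Fo Fm Go Gm \<eta> \<epsilon>. is_functor C D Fo Fm \<and> is_functor D C Go Gm \<and>
        is_natural_iso C C (\<lambda>A. A) (\<lambda>A B f. f) (\<lambda>A. Go (Fo A)) (\<lambda>A B f. Gm (Fo A) (Fo B) (Fm A B f)) \<eta> \<and>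
        is_natural_iso D D (\<lambda>A. Fo (Go A)) (\<lambda>A B f. Fm (Go A) (Go B) (Gm A B f)) (\<lambda>A. A) (\<lambda>A B f. f) \<epsilon>)"


section \<open>Groups with operations\<close>

text \<open>\<open>'w\<close> and \<open>'b\<close> are types of names for unary and binary operations. A presentation consists of
  the sets \<open>\<Omega>\<^sub>1' = \<Omega>\<^sub>1 - {-}\<close> and \<open>\<Omega>\<^sub>2' = \<Omega>\<^sub>2 - {+}\<close> of names in use (either may be empty) and the
  set \<open>E\<close> of identities, i.e. pairs of terms.\<close>

datatype ('w, 'b) gterm =
    Var nat
  | Zero
  | Neg "('w, 'b) gterm"
  | Plus "('w, 'b) gterm" "('w, 'b) gterm"
  | UnOp 'w "('w, 'b) gterm"
  | BinOp 'b "('w, 'b) gterm" "('w, 'b) gterm"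

record ('w, 'b) op_presentation =
  Omega1' :: "'w set"
  Omega2' :: "'b set"
  Idents :: "(('w, 'b) gterm \<times> ('w, 'b) gterm) set"

abbreviation (input) "vx \<equiv> Var 0"
abbreviation (input) "vy \<equiv> Var 1"
abbreviation (input) "vz \<equiv> Var 2"

definition group_laws :: "(('w, 'b) gterm \<times> ('w, 'b) gterm) set" where
  "group_laws =
     {(Plus (Plus vx vy) vz, Plus vx (Plus vy vz)),
      (Plus Zero vx, vx), (Plus vx Zero, vx),
      (Plus (Neg vx) vx, Zero), (Plus vx (Neg vx), Zero)}"

text \<open>The identities may only mention operations of the presentation (\<open>set1_gterm\<close>, \<open>set2_gterm\<close>
  are the unary and binary names in a term).\<close>

definition groups_with_operations :: "('w, 'b) op_presentation \<Rightarrow> bool" where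
  "groups_with_operations \<Sigma> \<longleftrightarrow>
     (\<forall>(s, t)\<in>Idents \<Sigma>. set1_gterm s \<union> set1_gterm t \<subseteq> Omega1' \<Sigma> \<and>
                         set2_gterm s \<union> set2_gterm t \<subseteq> Omega2' \<Sigma>) \<and>
     group_laws \<subseteq> Idents \<Sigma> \<and>
     (\<forall>s\<in>Omega2' \<Sigma>. \<exists>s'\<in>Omega2' \<Sigma>. (BinOp s' vx vy, BinOp s vy vx) \<in> Idents \<Sigma>) \<and>
     (\<forall>s\<in>Omega2' \<Sigma>. (BinOp s vx (Plus vy vz), Plus (BinOp s vx vy) (BinOp s vx vz)) \<in> Idents \<Sigma>) \<and>
     (\<forall>w\<in>Omega1' \<Sigma>. (UnOp w (Plus vx vy), Plus (UnOp w vx) (UnOp w vy)) \<in> Idents \<Sigma>) \<and>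
     (\<forall>w\<in>Omega1' \<Sigma>. \<forall>s\<in>Omega2' \<Sigma>. (BinOp s (UnOp w vx) vy, UnOp w (BinOp s vx vy)) \<in> Idents \<Sigma>)"

text \<open>The group structure is the one of \<^theory>\<open>HOL-Algebra.Group\<close>, so \<open>+\<close>, \<open>0\<close>, \<open>-\<close> of the
  (not necessarily commutative) additive notation are \<open>\<otimes>\<close>, \<open>\<one>\<close>, \<open>inv\<close> here.\<close>

record ('a, 'w, 'b) gwo = "'a monoid" +
  uop :: "'w \<Rightarrow> 'a \<Rightarrow> 'a"
  bop :: "'b \<Rightarrow> 'a \<Rightarrow> 'a \<Rightarrow> 'a"

primrec eval_term :: "('a, 'w, 'b, 'z) gwo_scheme \<Rightarrow> (nat \<Rightarrow> 'a) \<Rightarrow> ('w, 'b) gterm \<Rightarrow> 'a" where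
  "eval_term A v (Var n) = v n"
| "eval_term A v Zero = \<one>\<^bsub>A\<^esub>"
| "eval_term A v (Neg t) = inv\<^bsub>A\<^esub> (eval_term A v t)"
| "eval_term A v (Plus s t) = eval_term A v s \<otimes>\<^bsub>A\<^esub> eval_term A v t"
| "eval_term A v (UnOp w t) = uop A w (eval_term A v t)"
| "eval_term A v (BinOp b s t) = bop A b (eval_term A v s) (eval_term A v t)"

definition C_object :: "('w, 'b) op_presentation \<Rightarrow> ('a, 'w, 'b, 'z) gwo_scheme \<Rightarrow> bool" where
  "C_object \<Sigma> A \<longleftrightarrow> group A \<and>
     (\<forall>w\<in>Omega1' \<Sigma>. \<forall>x\<in>carrier A. uop A w x \<in> carrier A) \<and>
     (\<forall>b\<in>Omega2' \<Sigma>. \<forall>x\<in>carrier A. \<forall>y\<in>carrier A. bop A b x y \<in> carrier A) \<and>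
     (\<forall>(s, t)\<in>Idents \<Sigma>. \<forall>v. range v \<subseteq> carrier A \<longrightarrow> eval_term A v s = eval_term A v t)"

definition C_hom ::
  "('w, 'b) op_presentation \<Rightarrow> ('a, 'w, 'b, 'y) gwo_scheme \<Rightarrow> ('c, 'w, 'b, 'z) gwo_scheme \<Rightarrow> ('a \<Rightarrow> 'c) set" where
  "C_hom \<Sigma> A B = {f \<in> hom A B.
     (\<forall>w\<in>Omega1' \<Sigma>. \<forall>x\<in>carrier A. f (uop A w x) = uop B w (f x)) \<and>
     (\<forall>b\<in>Omega2' \<Sigma>. \<forall>x\<in>carrier A. \<forall>y\<in>carrier A. f (bop A b x y) = bop B b (f x) (f y))}"


section \<open>Coverings of topological groups with operations\<close>

text \<open>\<^const>\<open>covering_space\<close>, for abstract topologies.\<close>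

definition covering_map :: "'a topology \<Rightarrow> 'b topology \<Rightarrow> ('a \<Rightarrow> 'b) \<Rightarrow> bool" where
  "covering_map S X p \<longleftrightarrow> continuous_map S X p \<and> p ` topspace S = topspace X \<and>
     (\<forall>x\<in>topspace X. \<exists>T. x \<in> T \<and> openin X T \<and>
        (\<exists>\<V>. \<Union>\<V> = topspace S \<inter> p -` T \<and> (\<forall>U\<in>\<V>. openin S U) \<and> pairwise disjnt \<V> \<and>
             (\<forall>U\<in>\<V>. homeomorphic_map (subtopology S U) (subtopology X T) p)))"

record ('a, 'w, 'b) tgwo = "('a, 'w, 'b) gwo" +
  topo :: "'a topology"

definition TC_object :: "('w, 'b) op_presentation \<Rightarrow> ('a, 'w, 'b) tgwo \<Rightarrow> bool" where
  "TC_object \<Sigma> X \<longleftrightarrow> C_object \<Sigma> X \<and> topspace (topo X) = carrier X \<and>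
     continuous_map (prod_topology (topo X) (topo X)) (topo X) (\<lambda>(x, y). x \<otimes>\<^bsub>X\<^esub> y) \<and>
     continuous_map (topo X) (topo X) (\<lambda>x. inv\<^bsub>X\<^esub> x) \<and>
     (\<forall>w\<in>Omega1' \<Sigma>. continuous_map (topo X) (topo X) (uop X w)) \<and>
     (\<forall>b\<in>Omega2' \<Sigma>. continuous_map (prod_topology (topo X) (topo X)) (topo X) (\<lambda>(x, y). bop X b x y))"

text \<open>Morphisms are required to be \<^const>\<open>extensional\<close>, so that equality of morphisms is equality
  of maps on the carrier; composition is accordingly \<^const>\<open>compose\<close>.\<close>

definition TC_mor :: "('w, 'b) op_presentation \<Rightarrow> ('a, 'w, 'b) tgwo \<Rightarrow> ('c, 'w, 'b) tgwo \<Rightarrow> ('a \<Rightarrow> 'c) set" where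
  "TC_mor \<Sigma> X Y = {f \<in> C_hom \<Sigma> X Y. continuous_map (topo X) (topo Y) f \<and> f \<in> extensional (carrier X)}"

definition Cov_TC ::
  "('w, 'b) op_presentation \<Rightarrow> ('a, 'w, 'b) tgwo \<Rightarrow> (('u, 'w, 'b) tgwo \<times> ('u \<Rightarrow> 'a), 'u \<Rightarrow> 'u) cat" where
  "Cov_TC \<Sigma> X =
     \<lparr>Ob = {(Y, p). TC_object \<Sigma> Y \<and> p \<in> TC_mor \<Sigma> Y X \<and> covering_map (topo Y) (topo X) p},
      Hom = (\<lambda>(Y, p) (Z, q). {f \<in> TC_mor \<Sigma> Y Z. \<forall>y\<in>carrier Y. q (f y) = p y}),
      Idn = (\<lambda>(Y, p). \<lambda>y\<in>carrier Y. y),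
      Cmp = (\<lambda>(Y, p) _ _ g f. compose (carrier Y) g f)\<rparr>"


section \<open>Internal groupoids and their coverings\<close>

text \<open>\<open>gcomp G a b\<close> is \<open>a \<circ> b\<close> in diagrammatic order: it is relevant when \<open>d1 a = d0 b\<close>, and goes
  from \<open>d0 a\<close> to \<open>d1 b\<close>.\<close>

record ('e, 'o, 'w, 'b) igpd =
  elts :: "('e, 'w, 'b) gwo"
  objs :: "('o, 'w, 'b) gwo"
  d0 :: "'e \<Rightarrow> 'o"
  d1 :: "'e \<Rightarrow> 'o"
  eps :: "'o \<Rightarrow> 'e"
  gcomp :: "'e \<Rightarrow> 'e \<Rightarrow> 'e"

definition is_groupoid :: "('e, 'o, 'w, 'b) igpd \<Rightarrow> bool" where
  "is_groupoid G \<longleftrightarrow>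
     d0 G \<in> carrier (elts G) \<rightarrow> carrier (objs G) \<and>
     d1 G \<in> carrier (elts G) \<rightarrow> carrier (objs G) \<and>
     eps G \<in> carrier (objs G) \<rightarrow> carrier (elts G) \<and>
     (\<forall>x\<in>carrier (objs G). d0 G (eps G x) = x \<and> d1 G (eps G x) = x) \<and>
     (\<forall>a\<in>carrier (elts G). \<forall>b\<in>carrier (elts G). d1 G a = d0 G b \<longrightarrow>
        gcomp G a b \<in> carrier (elts G) \<and> d0 G (gcomp G a b) = d0 G a \<and> d1 G (gcomp G a b) = d1 G b) \<and>
     (\<forall>a\<in>carrier (elts G). gcomp G (eps G (d0 G a)) a = a \<and> gcomp G a (eps G (d1 G a)) = a) \<and>
     (\<forall>a\<in>carrier (elts G). \<forall>b\<in>carrier (elts G). \<forall>c\<in>carrier (elts G).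
        d1 G a = d0 G b \<longrightarrow> d1 G b = d0 G c \<longrightarrow> gcomp G (gcomp G a b) c = gcomp G a (gcomp G b c)) \<and>
     (\<forall>a\<in>carrier (elts G). \<exists>b\<in>carrier (elts G). d0 G b = d1 G a \<and> d1 G b = d0 G a \<and>
        gcomp G a b = eps G (d0 G a) \<and> gcomp G b a = eps G (d1 G a))"

text \<open>The pullback of \<open>d1\<close> and \<open>d0\<close>, with componentwise operations.\<close>

definition composable_pairs :: "('e, 'o, 'w, 'b) igpd \<Rightarrow> ('e \<times> 'e, 'w, 'b) gwo" where
  "composable_pairs G =
     \<lparr>carrier = {(a, b). a \<in> carrier (elts G) \<and> b \<in> carrier (elts G) \<and> d1 G a = d0 G b},
      mult = (\<lambda>(a, b) (c, d). (a \<otimes>\<^bsub>elts G\<^esub> c, b \<otimes>\<^bsub>elts G\<^esub> d)),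
      one = (\<one>\<^bsub>elts G\<^esub>, \<one>\<^bsub>elts G\<^esub>),
      uop = (\<lambda>w (a, b). (uop (elts G) w a, uop (elts G) w b)),
      bop = (\<lambda>s (a, b) (c, d). (bop (elts G) s a c, bop (elts G) s b d))\<rparr>"

definition internal_groupoid :: "('w, 'b) op_presentation \<Rightarrow> ('e, 'o, 'w, 'b) igpd \<Rightarrow> bool" where
  "internal_groupoid \<Sigma> G \<longleftrightarrow> is_groupoid G \<and> C_object \<Sigma> (elts G) \<and> C_object \<Sigma> (objs G) \<and>
     d0 G \<in> C_hom \<Sigma> (elts G) (objs G) \<and>
     d1 G \<in> C_hom \<Sigma> (elts G) (objs G) \<and>
     eps G \<in> C_hom \<Sigma> (objs G) (elts G) \<and>
     (\<lambda>(a, b). gcomp G a b) \<in> C_hom \<Sigma> (composable_pairs G) (elts G)"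

text \<open>A morphism is the pair of its object map and its element map.\<close>

definition internal_groupoid_mor ::
  "('w, 'b) op_presentation \<Rightarrow> ('e, 'o, 'w, 'b) igpd \<Rightarrow> ('f, 'p, 'w, 'b) igpd \<Rightarrow> (('o \<Rightarrow> 'p) \<times> ('e \<Rightarrow> 'f)) set" where
  "internal_groupoid_mor \<Sigma> G H = {(f0, f1).
     f0 \<in> C_hom \<Sigma> (objs G) (objs H) \<and> f0 \<in> extensional (carrier (objs G)) \<and>
     f1 \<in> C_hom \<Sigma> (elts G) (elts H) \<and> f1 \<in> extensional (carrier (elts G)) \<and>
     (\<forall>a\<in>carrier (elts G). d0 H (f1 a) = f0 (d0 G a) \<and> d1 H (f1 a) = f0 (d1 G a)) \<and>
     (\<forall>x\<in>carrier (objs G). f1 (eps G x) = eps H (f0 x)) \<and>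
     (\<forall>a\<in>carrier (elts G). \<forall>b\<in>carrier (elts G). d1 G a = d0 G b \<longrightarrow>
        f1 (gcomp G a b) = gcomp H (f1 a) (f1 b))}"

definition gstar :: "('e, 'o, 'w, 'b) igpd \<Rightarrow> 'o \<Rightarrow> 'e set" where
  "gstar G x = {a \<in> carrier (elts G). d0 G a = x}"

definition covering_mor ::
  "('w, 'b) op_presentation \<Rightarrow> ('e, 'o, 'w, 'b) igpd \<Rightarrow> ('f, 'p, 'w, 'b) igpd \<Rightarrow> (('o \<Rightarrow> 'p) \<times> ('e \<Rightarrow> 'f)) set" where
  "covering_mor \<Sigma> G H = {(f0, f1) \<in> internal_groupoid_mor \<Sigma> G H.
     \<forall>x\<in>carrier (objs G). bij_betw f1 (gstar G x) (gstar H (f0 x))}"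

text \<open>In \<open>Cov_TC\<close> and \<open>Cov_Cat\<close> the types of the covering structures (\<open>'u\<close>, \<open>'e\<close>, \<open>'o\<close>) are
  independent of those of the base; they bound the size of the covers and play the role of a universe.
  For covers of a space with points in an arbitrary type \<open>'u\<close>, the matching bounds for covers of the
  fundamental groupoid are \<open>'u\<close> for the objects and the type \<open>(real \<Rightarrow> 'u) set\<close> of path classes
  for the elements.\<close>

definition Cov_Cat ::
  "('w, 'b) op_presentation \<Rightarrow> ('f, 'p, 'w, 'b) igpd \<Rightarrow>
   (('e, 'o, 'w, 'b) igpd \<times> (('o \<Rightarrow> 'p) \<times> ('e \<Rightarrow> 'f)), ('o \<Rightarrow> 'o) \<times> ('e \<Rightarrow> 'e)) cat" where
  "Cov_Cat \<Sigma> G =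
     \<lparr>Ob = {(H, p). internal_groupoid \<Sigma> H \<and> internal_groupoid \<Sigma> G \<and> p \<in> covering_mor \<Sigma> H G},
      Hom = (\<lambda>(H, (p0, p1)) (K, (q0, q1)). {(f0, f1) \<in> covering_mor \<Sigma> H K.
               (\<forall>x\<in>carrier (objs H). q0 (f0 x) = p0 x) \<and> (\<forall>a\<in>carrier (elts H). q1 (f1 a) = p1 a)}),
      Idn = (\<lambda>(H, p). (\<lambda>x\<in>carrier (objs H). x, \<lambda>a\<in>carrier (elts H). a)),
      Cmp = (\<lambda>(H, p) _ _ (g0, g1) (f0, f1).
               (compose (carrier (objs H)) g0 f0, compose (carrier (elts H)) g1 f1))\<rparr>"


section \<open>The fundamental groupoid\<close>

text \<open>\<^const>\<open>homotopic_paths\<close>, for abstract topologies.\<close>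

definition homotopic_paths_in :: "'a topology \<Rightarrow> (real \<Rightarrow> 'a) \<Rightarrow> (real \<Rightarrow> 'a) \<Rightarrow> bool" where
  "homotopic_paths_in X p q \<longleftrightarrow>
     homotopic_with (\<lambda>r. r 0 = p 0 \<and> r 1 = p 1) (top_of_set {0..1}) X p q"

definition simply_connected_space :: "'a topology \<Rightarrow> bool" where
  "simply_connected_space X \<longleftrightarrow> path_connected_space X \<and>
     (\<forall>p. pathin X p \<and> p 0 = p 1 \<longrightarrow> homotopic_paths_in X p (\<lambda>t. p 0))"

text \<open>\<^const>\<open>joinpaths\<close>, which is restricted to types of class \<^class>\<open>topological_space\<close>.\<close>

definition join_paths :: "(real \<Rightarrow> 'a) \<Rightarrow> (real \<Rightarrow> 'a) \<Rightarrow> real \<Rightarrow> 'a" where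
  "join_paths p q = (\<lambda>t. if t \<le> 1/2 then p (2 * t) else q (2 * t - 1))"

definition path_class :: "'a topology \<Rightarrow> (real \<Rightarrow> 'a) \<Rightarrow> (real \<Rightarrow> 'a) set" where
  "path_class X p = {q. homotopic_paths_in X p q}"

text \<open>Operations on homotopy classes are induced by operations on representatives; the unions below
  are over all choices of representatives.\<close>

definition path_algebra :: "('a, 'w, 'b) tgwo \<Rightarrow> ((real \<Rightarrow> 'a) set, 'w, 'b) gwo" where
  "path_algebra X =
     \<lparr>carrier = {path_class (topo X) p |p. pathin (topo X) p},
      mult = (\<lambda>c d. \<Union>p\<in>c. \<Union>q\<in>d. path_class (topo X) (\<lambda>t. p t \<otimes>\<^bsub>X\<^esub> q t)),
      one = path_class (topo X) (\<lambda>t. \<one>\<^bsub>X\<^esub>),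
      uop = (\<lambda>w c. \<Union>p\<in>c. path_class (topo X) (\<lambda>t. uop X w (p t))),
      bop = (\<lambda>s c d. \<Union>p\<in>c. \<Union>q\<in>d. path_class (topo X) (\<lambda>t. bop X s (p t) (q t)))\<rparr>"

definition fundamental_groupoid :: "('a, 'w, 'b) tgwo \<Rightarrow> ((real \<Rightarrow> 'a) set, 'a, 'w, 'b) igpd" where
  "fundamental_groupoid X =
     \<lparr>elts = path_algebra X,
      objs = gwo.truncate X,
      d0 = (\<lambda>c. the_elem ((\<lambda>p. p 0) ` c)),
      d1 = (\<lambda>c. the_elem ((\<lambda>p. p 1) ` c)),
      eps = (\<lambda>x. path_class (topo X) (\<lambda>t. x)),
      gcomp = (\<lambda>c d. \<Union>p\<in>c. \<Union>q\<in>d. path_class (topo X) (join_paths p q))\<rparr>"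

end

theory Submission
  imports Defs
begin

text \<open>
  The equivalence sends a covering \<open>p : Y \<rightarrow> X\<close> to the covering of fundamental groupoids
  \<open>\<pi>(Y) \<rightarrow> \<pi>(X)\<close> that it induces; unique lifting of paths and homotopies makes this bijective on stars
  (\<open>covering_mor_path_class_map\<close>). All operations on path classes are pointwise, so identities and
  the compatibility with composition are inherited from \<open>X\<close>.

  The link back is a topology on the objects of any groupoid covering \<open>H\<close> of \<open>\<pi>(X)\<close>, the transport
  topology: a set is open if, starting from any of its points, lifts of sufficiently small paths of
  \<open>X\<close> end in it. Three facts about it carry the proof.

  \<^item> If \<open>H\<close> comes from a topological covering \<open>Y\<close>, it is the topology of \<open>Y\<close>, as \<open>X\<close> is locally path
    connected (\<open>topo_eq_transport_topology\<close>).
  \<^item> Morphisms of coverings of \<open>\<pi>(X)\<close> are continuous for it (\<open>continuous_map_transport\<close>).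
  \<^item> With it the objects of \<open>H\<close> form a topological group with operations that covers \<open>X\<close>
    (\<open>TC_object_total_space\<close>, \<open>covering_map_p0\<close>), and the lift of a path to this covering ends where
    the lift of its class to \<open>H\<close> ends (\<open>path_lift_transport\<close>). Continuity of the operations needs
    no computation: the operations of \<open>H\<close> send lifts to lifts. The simply connected cover is used
    only for the covering property: it provides small open sets of \<open>X\<close> in which parallel
    paths are homotopic in \<open>X\<close>, and over these the ends of lifts form the sheets.

  A morphism between coverings of a groupoid is determined by its object map, and an object map over
  the base extends to a morphism as soon as it respects the ends of lifts
  (\<open>covering_mor_eqI\<close>, \<open>covering_mor_extend\<close>). By the first two facts the continuous homomorphisms
  over \<open>X\<close> are therefore exactly the object maps of morphisms over \<open>\<pi>(X)\<close>, which is full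
  faithfulness. By the third, the groupoid of the constructed covering is isomorphic to \<open>H\<close> through the
  identity on objects, which is essential surjectivity.
\<close>

section \<open>Equivalences from fully faithful, essentially surjective functors\<close>

lemma equivalent_categories_if_fully_faithful_and_essentially_surjective:
  assumes C: "is_category C" and D: "is_category D"
    and F: "is_functor C D Fo Fm"
    and ff: "\<And>A B. A \<in> Ob C \<Longrightarrow> B \<in> Ob C \<Longrightarrow> bij_betw (Fm A B) (Hom C A B) (Hom D (Fo A) (Fo B))"
    and es: "\<And>B. B \<in> Ob D \<Longrightarrow> \<exists>A\<in>Ob C. \<exists>f. is_iso D (Fo A) B f"
  shows "equivalent_categories C D"
proof -
  have Cid: "Idn C A \<in> Hom C A A" if "A \<in> Ob C" for A
    using C that by (simp add: is_category_def)
  have Ccmp: "Cmp C A B E g f \<in> Hom C A E"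
    if "A \<in> Ob C" "B \<in> Ob C" "E \<in> Ob C" "f \<in> Hom C A B" "g \<in> Hom C B E" for A B E f g
    using C that by (simp add: is_category_def)
  have Did: "Idn D A \<in> Hom D A A" if "A \<in> Ob D" for A
    using D that by (simp add: is_category_def)
  have Dcmp: "Cmp D A B E g f \<in> Hom D A E"
    if "A \<in> Ob D" "B \<in> Ob D" "E \<in> Ob D" "f \<in> Hom D A B" "g \<in> Hom D B E" for A B E f g
    using D that by (simp add: is_category_def)
  have Dl: "Cmp D A B B (Idn D B) f = f" and Dr: "Cmp D A A B f (Idn D A) = f"
    if "A \<in> Ob D" "B \<in> Ob D" "f \<in> Hom D A B" for A B f
    using D that by (simp_all add: is_category_def)
  have Das: "Cmp D A E K h (Cmp D A B E g f) = Cmp D A B K (Cmp D B E K h g) f"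
    if "A \<in> Ob D" "B \<in> Ob D" "E \<in> Ob D" "K \<in> Ob D" "f \<in> Hom D A B" "g \<in> Hom D B E" "h \<in> Hom D E K"
    for A B E K f g h
    using D that by (simp add: is_category_def)
  have Fo: "Fo A \<in> Ob D" if "A \<in> Ob C" for A using F that by (simp add: is_functor_def)
  have Fm: "Fm A B f \<in> Hom D (Fo A) (Fo B)" if "A \<in> Ob C" "B \<in> Ob C" "f \<in> Hom C A B" for A B f
    using F that by (simp add: is_functor_def)
  have Fid: "Fm A A (Idn C A) = Idn D (Fo A)" if "A \<in> Ob C" for A
    using F that by (simp add: is_functor_def)
  have Fcmp: "Fm A E (Cmp C A B E g f) = Cmp D (Fo A) (Fo B) (Fo E) (Fm B E g) (Fm A B f)"
    if "A \<in> Ob C" "B \<in> Ob C" "E \<in> Ob C" "f \<in> Hom C A B" "g \<in> Hom C B E" for A B E f g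
    using F that by (simp add: is_functor_def)
  define Go where "Go B = (SOME A. A \<in> Ob C \<and> (\<exists>f. is_iso D (Fo A) B f))" for B
  have Go_ex: "Go B \<in> Ob C \<and> (\<exists>f. is_iso D (Fo (Go B)) B f)" if "B \<in> Ob D" for B
    unfolding Go_def by (rule someI_ex) (use es[OF that] in blast)
  then have Go: "Go B \<in> Ob C" if "B \<in> Ob D" for B using that by blast
  define e where "e B = (SOME f. is_iso D (Fo (Go B)) B f)" for B
  have e_iso: "is_iso D (Fo (Go B)) B (e B)" if "B \<in> Ob D" for B
    unfolding e_def by (rule someI_ex) (use Go_ex[OF that] in blast)
  define i where "i B = (SOME g. g \<in> Hom D B (Fo (Go B)) \<and>
      Cmp D (Fo (Go B)) B (Fo (Go B)) g (e B) = Idn D (Fo (Go B)) \<and> Cmp D B (Fo (Go B)) B (e B) g = Idn D B)" for B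
  have i_ex: "i B \<in> Hom D B (Fo (Go B)) \<and> Cmp D (Fo (Go B)) B (Fo (Go B)) (i B) (e B) = Idn D (Fo (Go B)) \<and>
      Cmp D B (Fo (Go B)) B (e B) (i B) = Idn D B" if "B \<in> Ob D" for B
    unfolding i_def by (rule someI_ex) (use e_iso[OF that] in \<open>auto simp: is_iso_def\<close>)
  then have i: "i B \<in> Hom D B (Fo (Go B))"
    and ie: "Cmp D (Fo (Go B)) B (Fo (Go B)) (i B) (e B) = Idn D (Fo (Go B))"
    and ei: "Cmp D B (Fo (Go B)) B (e B) (i B) = Idn D B" if "B \<in> Ob D" for B
    using that by blast+
  have e: "e B \<in> Hom D (Fo (Go B)) B" if "B \<in> Ob D" for B
    using e_iso[OF that] by (simp add: is_iso_def)
  define P where "P A B = inv_into (Hom C A B) (Fm A B)" for A B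
  have P: "P A B g \<in> Hom C A B" and FP: "Fm A B (P A B g) = g"
    if "A \<in> Ob C" "B \<in> Ob C" "g \<in> Hom D (Fo A) (Fo B)" for A B g
    using ff[OF that(1,2)] that(3)
    by (auto simp: P_def bij_betw_def inv_into_into f_inv_into_f)
  have inj: "f = g" if "A \<in> Ob C" "B \<in> Ob C" "f \<in> Hom C A B" "g \<in> Hom C A B" "Fm A B f = Fm A B g"
    for A B f g
    using ff[OF that(1,2)] that(3-) by (auto simp: bij_betw_def inj_on_def)
  \<comment> \<open>The inverse functor on arrows: conjugate by the chosen isomorphisms \<open>e\<close> (with inverses \<open>i\<close>),
    then take the unique preimage under \<open>Fm\<close>.\<close>
  define T where "T A B g = Cmp D (Fo (Go A)) B (Fo (Go B)) (i B) (Cmp D (Fo (Go A)) A B g (e A))" for A B g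
  have T: "T A B g \<in> Hom D (Fo (Go A)) (Fo (Go B))" if "A \<in> Ob D" "B \<in> Ob D" "g \<in> Hom D A B" for A B g
    unfolding T_def using that by (auto intro!: Dcmp Fo Go e i)
  have eT: "Cmp D (Fo (Go A)) (Fo (Go B)) B (e B) (T A B g) = Cmp D (Fo (Go A)) A B g (e A)"
    if "A \<in> Ob D" "B \<in> Ob D" "g \<in> Hom D A B" for A B g
    unfolding T_def using that
    by (subst Das) (auto intro!: Dcmp Fo Go e i Dl simp: ei)
  have cancel: "f = g"
    if "A \<in> Ob D" "B \<in> Ob D" "f \<in> Hom D A (Fo (Go B))" "g \<in> Hom D A (Fo (Go B))"
      "Cmp D A (Fo (Go B)) B (e B) f = Cmp D A (Fo (Go B)) B (e B) g" for A B f g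
  proof -
    have "Cmp D A B (Fo (Go B)) (i B) (Cmp D A (Fo (Go B)) B (e B) h) = h"
      if h: "h \<in> Hom D A (Fo (Go B))" for h
      using that \<open>A \<in> Ob D\<close> \<open>B \<in> Ob D\<close> by (subst Das) (auto intro!: Fo Go e i Dl simp: ie)
    then show ?thesis using that by metis
  qed
  define Gm where "Gm A B g = P (Go A) (Go B) (T A B g)" for A B g
  have Gm: "Gm A B g \<in> Hom C (Go A) (Go B)" and FGm: "Fm (Go A) (Go B) (Gm A B g) = T A B g"
    if "A \<in> Ob D" "B \<in> Ob D" "g \<in> Hom D A B" for A B g
    unfolding Gm_def using that T P FP Go by auto
  define \<eta> where "\<eta> A = P A (Go (Fo A)) (i (Fo A))" for A
  have \<eta>: "\<eta> A \<in> Hom C A (Go (Fo A))" and F\<eta>: "Fm A (Go (Fo A)) (\<eta> A) = i (Fo A)" if "A \<in> Ob C" for A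
    unfolding \<eta>_def using that P FP Go Fo i by auto
  define \<eta>' where "\<eta>' A = P (Go (Fo A)) A (e (Fo A))" for A
  have \<eta>': "\<eta>' A \<in> Hom C (Go (Fo A)) A" and F\<eta>': "Fm (Go (Fo A)) A (\<eta>' A) = e (Fo A)" if "A \<in> Ob C" for A
    unfolding \<eta>'_def using that P FP Go Fo e by auto
  have G: "is_functor D C Go Gm"
    unfolding is_functor_def
  proof (intro conjI ballI)
    fix A assume A: "A \<in> Ob D"
    show "Gm A A (Idn D A) = Idn C (Go A)"
    proof (rule inj)
      show "Fm (Go A) (Go A) (Gm A A (Idn D A)) = Fm (Go A) (Go A) (Idn C (Go A))"
        using A by (simp add: FGm Did Fid Go T_def Dl e Fo ie)
    qed (use A in \<open>auto intro!: Gm Go Did Cid\<close>)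
    fix B E f g assume B: "B \<in> Ob D" and E: "E \<in> Ob D" and f: "f \<in> Hom D A B" and g: "g \<in> Hom D B E"
    have gf: "Cmp D A B E g f \<in> Hom D A E" using A B E f g Dcmp by blast
    note ob = A B E Go[OF A] Go[OF B] Go[OF E] Fo[OF Go[OF A]] Fo[OF Go[OF B]] Fo[OF Go[OF E]]
    show "Gm A E (Cmp D A B E g f) = Cmp C (Go A) (Go B) (Go E) (Gm B E g) (Gm A B f)"
    proof (rule inj)
      have "Cmp D (Fo (Go A)) (Fo (Go E)) E (e E) (Cmp D (Fo (Go A)) (Fo (Go B)) (Fo (Go E)) (T B E g) (T A B f))
        = Cmp D (Fo (Go A)) (Fo (Go B)) E (Cmp D (Fo (Go B)) B E g (e B)) (T A B f)"
        using ob f g by (subst Das) (auto intro!: T e simp: eT)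
      also have "\<dots> = Cmp D (Fo (Go A)) B E g (Cmp D (Fo (Go A)) A B f (e A))"
        using ob f g by (subst Das[symmetric]) (auto intro!: T e simp: eT)
      also have "\<dots> = Cmp D (Fo (Go A)) A E (Cmp D A B E g f) (e A)"
        using ob f g by (subst Das) (auto intro!: e)
      also have "\<dots> = Cmp D (Fo (Go A)) (Fo (Go E)) E (e E) (T A E (Cmp D A B E g f))"
        using ob gf by (simp add: eT)
      finally have "T A E (Cmp D A B E g f) = Cmp D (Fo (Go A)) (Fo (Go B)) (Fo (Go E)) (T B E g) (T A B f)"
        using ob f g gf by (intro cancel[of "Fo (Go A)" E, OF _ _ T Dcmp[of _ "Fo (Go B)"]]) (simp_all add: T)
      then show "Fm (Go A) (Go E) (Gm A E (Cmp D A B E g f))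
          = Fm (Go A) (Go E) (Cmp C (Go A) (Go B) (Go E) (Gm B E g) (Gm A B f))"
        using ob f g gf by (simp add: FGm Fcmp Gm)
    qed (use ob f g gf in \<open>auto intro!: Gm Ccmp[of _ "Go B"]\<close>)
  qed (use Go Gm in auto)
  have nat1: "is_natural_iso C C (\<lambda>A. A) (\<lambda>A B f. f) (\<lambda>A. Go (Fo A)) (\<lambda>A B f. Gm (Fo A) (Fo B) (Fm A B f)) \<eta>"
    unfolding is_natural_iso_def is_iso_def
  proof (intro conjI ballI)
    fix A assume A: "A \<in> Ob C"
    note ob = A Fo[OF A] Go[OF Fo[OF A]] Fo[OF Go[OF Fo[OF A]]]
    show "\<eta> A \<in> Hom C A (Go (Fo A))" using A \<eta> by auto
    show "\<exists>g\<in>Hom C (Go (Fo A)) A. Cmp C A (Go (Fo A)) A g (\<eta> A) = Idn C A \<and>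
        Cmp C (Go (Fo A)) A (Go (Fo A)) (\<eta> A) g = Idn C (Go (Fo A))"
    proof (intro bexI conjI)
      show "Cmp C A (Go (Fo A)) A (\<eta>' A) (\<eta> A) = Idn C A"
      proof (rule inj)
        show "Fm A A (Cmp C A (Go (Fo A)) A (\<eta>' A) (\<eta> A)) = Fm A A (Idn C A)"
          using ob by (simp add: Fcmp[of A "Go (Fo A)" A] F\<eta> F\<eta>' \<eta> \<eta>' Fid ei)
      qed (use ob in \<open>auto intro!: Ccmp[of _ "Go (Fo A)"] Cid \<eta> \<eta>'\<close>)
      show "Cmp C (Go (Fo A)) A (Go (Fo A)) (\<eta> A) (\<eta>' A) = Idn C (Go (Fo A))"
      proof (rule inj)
        show "Fm (Go (Fo A)) (Go (Fo A)) (Cmp C (Go (Fo A)) A (Go (Fo A)) (\<eta> A) (\<eta>' A))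
            = Fm (Go (Fo A)) (Go (Fo A)) (Idn C (Go (Fo A)))"
          using ob by (simp add: Fcmp[of "Go (Fo A)" A "Go (Fo A)"] F\<eta> F\<eta>' \<eta> \<eta>' Fid ie)
      qed (use ob in \<open>auto intro!: Ccmp[of _ A] Cid \<eta> \<eta>'\<close>)
    qed (use A \<eta>' in auto)
    fix B f assume B: "B \<in> Ob C" and f: "f \<in> Hom C A B"
    note ob = ob B Fo[OF B] Go[OF Fo[OF B]] Fo[OF Go[OF Fo[OF B]]]
    have Ff: "Fm A B f \<in> Hom D (Fo A) (Fo B)" using A B f Fm by auto
    show "Cmp C A B (Go (Fo B)) (\<eta> B) f = Cmp C A (Go (Fo A)) (Go (Fo B)) (Gm (Fo A) (Fo B) (Fm A B f)) (\<eta> A)"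
    proof (rule inj)
      have "Cmp D (Fo A) (Fo (Go (Fo A))) (Fo (Go (Fo B))) (T (Fo A) (Fo B) (Fm A B f)) (i (Fo A))
        = Cmp D (Fo A) (Fo B) (Fo (Go (Fo B))) (i (Fo B))
            (Cmp D (Fo A) (Fo (Go (Fo A))) (Fo B) (Cmp D (Fo (Go (Fo A))) (Fo A) (Fo B) (Fm A B f) (e (Fo A))) (i (Fo A)))"
        unfolding T_def using ob Ff by (subst Das) (auto intro!: e i Dcmp[of _ "Fo A"])
      also have "\<dots> = Cmp D (Fo A) (Fo B) (Fo (Go (Fo B))) (i (Fo B)) (Fm A B f)"
        using ob Ff by (subst Das[symmetric]) (auto intro!: e i simp: ei Dr)
      finally show "Fm A (Go (Fo B)) (Cmp C A B (Go (Fo B)) (\<eta> B) f) =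
          Fm A (Go (Fo B)) (Cmp C A (Go (Fo A)) (Go (Fo B)) (Gm (Fo A) (Fo B) (Fm A B f)) (\<eta> A))"
        using ob f Ff
        by (simp add: Fcmp[of A B "Go (Fo B)"] Fcmp[of A "Go (Fo A)" "Go (Fo B)"] F\<eta> \<eta> FGm Gm)
    qed (use ob f Ff in \<open>auto intro!: Ccmp[of _ "Go (Fo A)"] Ccmp[of _ B] \<eta> Gm\<close>)
  qed
  have nat2: "is_natural_iso D D (\<lambda>A. Fo (Go A)) (\<lambda>A B f. Fm (Go A) (Go B) (Gm A B f)) (\<lambda>A. A) (\<lambda>A B f. f) e"
    unfolding is_natural_iso_def by (auto simp: e_iso FGm eT)
  show ?thesis
    unfolding equivalent_categories_def using C D F G nat1 nat2 by blast
qed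

text \<open>It can be easier to describe the bijection on hom-sets backwards, by a map \<open>U\<close> that forgets part of
  an arrow of \<open>D\<close>. Functoriality of its inverse then follows from that of \<open>U\<close>.\<close>

lemma equivalent_categories_if_bijective_on_homs:
  assumes C: "is_category C" and D: "is_category D"
    and Fo: "\<And>A. A \<in> Ob C \<Longrightarrow> Fo A \<in> Ob D"
    and bij: "\<And>A B. A \<in> Ob C \<Longrightarrow> B \<in> Ob C \<Longrightarrow> bij_betw (U A B) (Hom D (Fo A) (Fo B)) (Hom C A B)"
    and U_id: "\<And>A. A \<in> Ob C \<Longrightarrow> U A A (Idn D (Fo A)) = Idn C A"
    and U_cmp: "\<And>A B E f g. U A E (Cmp D (Fo A) (Fo B) (Fo E) g f) = Cmp C A B E (U B E g) (U A B f)"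
    and es: "\<And>B. B \<in> Ob D \<Longrightarrow> \<exists>A\<in>Ob C. \<exists>f. is_iso D (Fo A) B f"
  shows "equivalent_categories C D"
proof (rule equivalent_categories_if_fully_faithful_and_essentially_surjective[OF C D _ _ es])
  define Fm where "Fm A B = inv_into (Hom D (Fo A) (Fo B)) (U A B)" for A B
  show Fbij: "bij_betw (Fm A B) (Hom C A B) (Hom D (Fo A) (Fo B))" if "A \<in> Ob C" "B \<in> Ob C" for A B
    unfolding Fm_def by (rule bij_betw_inv_into[OF bij[OF that]])
  have Fm: "Fm A B f \<in> Hom D (Fo A) (Fo B)" "U A B (Fm A B f) = f"
    if "A \<in> Ob C" "B \<in> Ob C" "f \<in> Hom C A B" for A B f
    using bij_betw_apply[OF Fbij[OF that(1,2)] that(3)] bij_betw_inv_into_right[OF bij[OF that(1,2)] that(3)]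
    by (simp_all add: Fm_def)
  have Fm_eq: "Fm A B f = h"
    if "A \<in> Ob C" "B \<in> Ob C" "h \<in> Hom D (Fo A) (Fo B)" "U A B h = f" for A B f h
    using bij_betw_inv_into_left[OF bij[OF that(1,2)] that(3)] that(4) by (simp add: Fm_def)
  show "is_functor C D Fo Fm"
    unfolding is_functor_def
  proof (intro conjI ballI)
    fix A assume A: "A \<in> Ob C"
    show "Fm A A (Idn C A) = Idn D (Fo A)"
      using D Fo[OF A] U_id[OF A] by (intro Fm_eq A) (auto simp: is_category_def)
    fix B E f g assume "B \<in> Ob C" "E \<in> Ob C" "f \<in> Hom C A B" "g \<in> Hom C B E"
    note obs = A this
    show "Fm A E (Cmp C A B E g f) = Cmp D (Fo A) (Fo B) (Fo E) (Fm B E g) (Fm A B f)"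
    proof (rule Fm_eq)
      show "Cmp D (Fo A) (Fo B) (Fo E) (Fm B E g) (Fm A B f) \<in> Hom D (Fo A) (Fo E)"
        using D Fo Fm(1) obs by (simp add: is_category_def)
    qed (use obs Fm(2) U_cmp in auto)
  qed (use Fo Fm(1) in auto)
qed

section \<open>Homotopy of paths in an abstract topology\<close>

abbreviation unit_square :: "(real \<times> real) topology" where
  "unit_square \<equiv> top_of_set ({0..1} \<times> {0..1})"

lemma prod_topology_top_of_set:
  "prod_topology (top_of_set S) (top_of_set T) = top_of_set (S \<times> T)"
  by (simp add: subtopology_Times flip: euclidean_product_topology)

lemma homotopic_paths_in_iff:
  "homotopic_paths_in X p q \<longleftrightarrow> (\<exists>h. continuous_map unit_square X h \<and>
     (\<forall>t\<in>{0..1}. h (0, t) = p t \<and> h (1, t) = q t) \<and> (\<forall>s\<in>{0..1}. h (s, 0) = p 0 \<and> h (s, 1) = p 1))"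
  unfolding homotopic_paths_in_def
  by (subst homotopic_with) (auto simp: prod_topology_top_of_set)

lemma homotopic_paths_in_ends:
  assumes "homotopic_paths_in X p q"
  shows "q 0 = p 0" "q 1 = p 1"
  using homotopic_with_imp_property[OF assms[unfolded homotopic_paths_in_def]] by auto

lemma homotopic_paths_in_pathin:
  assumes "homotopic_paths_in X p q"
  shows "pathin X p" "pathin X q"
  using homotopic_with_imp_continuous_maps[OF assms[unfolded homotopic_paths_in_def]]
  by (auto simp: pathin_def)

lemma homotopic_paths_in_refl [simp]: "homotopic_paths_in X p p \<longleftrightarrow> pathin X p"
  by (simp add: homotopic_paths_in_def pathin_def)

lemma homotopic_paths_in_sym: "homotopic_paths_in X p q \<Longrightarrow> homotopic_paths_in X q p"
  using homotopic_paths_in_ends[of X p q] homotopic_with_symD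
  by (auto simp: homotopic_paths_in_def)

lemma homotopic_paths_in_trans:
  "homotopic_paths_in X p q \<Longrightarrow> homotopic_paths_in X q r \<Longrightarrow> homotopic_paths_in X p r"
  using homotopic_paths_in_ends[of X p q] homotopic_with_trans
  by (force simp: homotopic_paths_in_def)

lemma homotopic_paths_in_eq:
  assumes "pathin X p" "\<And>t. 0 \<le> t \<Longrightarrow> t \<le> 1 \<Longrightarrow> p t = q t"
  shows "homotopic_paths_in X p q"
  using assms unfolding homotopic_paths_in_def pathin_def
  by (intro homotopic_with_equal) auto

lemma homotopic_paths_in_compose:
  assumes "continuous_map X Y f" "homotopic_paths_in X p q"
  shows "homotopic_paths_in Y (\<lambda>t. f (p t)) (\<lambda>t. f (q t))"
proof -
  obtain h where "continuous_map unit_square X h"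
    "\<forall>t\<in>{0..1}. h (0, t) = p t \<and> h (1, t) = q t" "\<forall>s\<in>{0..1}. h (s, 0) = p 0 \<and> h (s, 1) = p 1"
    using assms(2) unfolding homotopic_paths_in_iff by blast
  then show ?thesis unfolding homotopic_paths_in_iff
    using continuous_map_compose[of unit_square X h Y f] assms(1) by (intro exI[of _ "f \<circ> h"]) auto
qed

lemma homotopic_paths_in_Pair:
  assumes "homotopic_paths_in X p p'" "homotopic_paths_in Y q q'"
  shows "homotopic_paths_in (prod_topology X Y) (\<lambda>t. (p t, q t)) (\<lambda>t. (p' t, q' t))"
proof -
  obtain h where h: "continuous_map unit_square X h"
    "\<forall>t\<in>{0..1}. h (0, t) = p t \<and> h (1, t) = p' t" "\<forall>s\<in>{0..1}. h (s, 0) = p 0 \<and> h (s, 1) = p 1"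
    using assms(1) unfolding homotopic_paths_in_iff by blast
  obtain k where k: "continuous_map unit_square Y k"
    "\<forall>t\<in>{0..1}. k (0, t) = q t \<and> k (1, t) = q' t" "\<forall>s\<in>{0..1}. k (s, 0) = q 0 \<and> k (s, 1) = q 1"
    using assms(2) unfolding homotopic_paths_in_iff by blast
  have "continuous_map unit_square (prod_topology X Y) (\<lambda>z. (h z, k z))"
    using h(1) k(1) by (simp add: continuous_map_pairwise o_def)
  then show ?thesis unfolding homotopic_paths_in_iff
    using h k by (intro exI[of _ "\<lambda>z. (h z, k z)"]) auto
qed

lemma homotopic_paths_in_binop:
  assumes "continuous_map (prod_topology X Y) Z (\<lambda>(x, y). f x y)"
    and "homotopic_paths_in X p p'" "homotopic_paths_in Y q q'"
  shows "homotopic_paths_in Z (\<lambda>t. f (p t) (q t)) (\<lambda>t. f (p' t) (q' t))"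
  using homotopic_paths_in_compose[OF assms(1) homotopic_paths_in_Pair[OF assms(2,3)]] by simp

text \<open>The unit interval is convex, so any two of its self-maps with the same end values are
  homotopic; all the groupoid laws for path classes are instances of this.\<close>

lemma homotopic_paths_in_reparametrize:
  assumes p: "pathin X p"
    and f: "continuous_on {0..1} f" "f ` {0..1} \<subseteq> {0..1::real}"
    and g: "continuous_on {0..1} g" "g ` {0..1} \<subseteq> {0..1::real}"
    and "f 0 = g 0" "f 1 = g 1"
  shows "homotopic_paths_in X (\<lambda>t. p (f t)) (\<lambda>t. p (g t))"
proof (rule homotopic_paths_in_compose[of "top_of_set {0..1}" X p f g])
  show "continuous_map (top_of_set {0..1}) X p" using p by (simp add: pathin_def)
  have seg: "(1 - s) * f t + s * g t \<in> {0..1}" if "s \<in> {0..1}" "t \<in> {0..1}" for s t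
  proof -
    have "f t \<in> {0..1}" "g t \<in> {0..1}" using that f(2) g(2) by blast+
    then show ?thesis using that by (auto intro!: convex_bound_le)
  qed
  let ?h = "\<lambda>z. (1 - fst z) * f (snd z) + fst z * g (snd z)"
  have "continuous_map unit_square (top_of_set {0..1}) ?h"
    using seg by (auto simp: image_subset_iff Pi_iff
        intro!: continuous_intros continuous_on_compose2[OF f(1)] continuous_on_compose2[OF g(1)])
  then show "homotopic_paths_in (top_of_set {0..1}) f g"
    unfolding homotopic_paths_in_iff using assms by (intro exI[of _ ?h]) (auto simp: algebra_simps)
qed

lemma join_paths_ends [simp]: "join_paths p q 0 = p 0" "join_paths p q 1 = q 1"
  by (simp_all add: join_paths_def)

lemma homotopic_paths_in_join:
  assumes "homotopic_paths_in X p p'" "homotopic_paths_in X q q'" "p 1 = q 0"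
  shows "homotopic_paths_in X (join_paths p q) (join_paths p' q')"
proof -
  obtain h where h: "continuous_map unit_square X h"
    "\<forall>t\<in>{0..1}. h (0, t) = p t \<and> h (1, t) = p' t" "\<forall>s\<in>{0..1}. h (s, 0) = p 0 \<and> h (s, 1) = p 1"
    using assms(1) unfolding homotopic_paths_in_iff by blast
  obtain k where k: "continuous_map unit_square X k"
    "\<forall>t\<in>{0..1}. k (0, t) = q t \<and> k (1, t) = q' t" "\<forall>s\<in>{0..1}. k (s, 0) = q 0 \<and> k (s, 1) = q 1"
    using assms(2) unfolding homotopic_paths_in_iff by blast
  let ?j = "\<lambda>z. if snd z \<le> 1/2 then h (fst z, 2 * snd z) else k (fst z, 2 * snd z - 1)"
  have "continuous_map unit_square X ?j"
  proof (rule continuous_map_cases_le)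
    have "continuous_map (subtopology unit_square {z \<in> topspace unit_square. snd z \<le> 1/2}) unit_square
        (\<lambda>z. (fst z, 2 * snd z))"
      by (auto simp: subtopology_subtopology Pi_iff intro!: continuous_intros)
    from continuous_map_compose[OF this h(1)]
    show "continuous_map (subtopology unit_square {z \<in> topspace unit_square. snd z \<le> 1/2}) X
        (\<lambda>z. h (fst z, 2 * snd z))" by (simp add: o_def)
    have "continuous_map (subtopology unit_square {z \<in> topspace unit_square. 1/2 \<le> snd z}) unit_square
        (\<lambda>z. (fst z, 2 * snd z - 1))"
      by (auto simp: subtopology_subtopology Pi_iff intro!: continuous_intros)
    from continuous_map_compose[OF this k(1)]
    show "continuous_map (subtopology unit_square {z \<in> topspace unit_square. 1/2 \<le> snd z}) X
        (\<lambda>z. k (fst z, 2 * snd z - 1))" by (simp add: o_def)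
    show "h (fst z, 2 * snd z) = k (fst z, 2 * snd z - 1)" if "z \<in> topspace unit_square" "snd z = 1/2" for z
    proof -
      have "2 * snd z = 1" "2 * snd z - 1 = 0" using that(2) by simp_all
      then show ?thesis using that(1) h(3) k(3) assms(3) by auto
    qed
  qed (auto intro!: continuous_intros)
  then show ?thesis unfolding homotopic_paths_in_iff
    using h k by (intro exI[of _ ?j]) (auto simp: join_paths_def)
qed

lemma pathin_join: "pathin X p \<Longrightarrow> pathin X q \<Longrightarrow> p 1 = q 0 \<Longrightarrow> pathin X (join_paths p q)"
  using homotopic_paths_in_join[of X p p q q] by simp

lemma pathin_reparametrize:
  "pathin X p \<Longrightarrow> continuous_on {0..1} f \<Longrightarrow> f ` {0..1} \<subseteq> {0..1} \<Longrightarrow> pathin X (\<lambda>t. p (f t))"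
  using homotopic_paths_in_reparametrize[of X p f f] by simp

lemma pathin_compose': "continuous_map X Y f \<Longrightarrow> pathin X p \<Longrightarrow> pathin Y (\<lambda>t. f (p t))"
  using homotopic_paths_in_compose[of X Y f p p] by simp

lemma pathin_binop:
  "continuous_map (prod_topology X Y) Z (\<lambda>(x, y). f x y) \<Longrightarrow> pathin X p \<Longrightarrow> pathin Y q \<Longrightarrow>
   pathin Z (\<lambda>t. f (p t) (q t))"
  using homotopic_paths_in_binop[of X Y Z f p p q q] by simp

lemma pathin_topspace: "pathin X p \<Longrightarrow> 0 \<le> t \<Longrightarrow> t \<le> 1 \<Longrightarrow> p t \<in> topspace X"
  by (auto simp: pathin_def continuous_map_def)

lemma homotopic_paths_in_join_assoc:
  assumes "pathin X p" "pathin X q" "pathin X r" "p 1 = q 0" "q 1 = r 0"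
  shows "homotopic_paths_in X (join_paths (join_paths p q) r) (join_paths p (join_paths q r))"
proof -
  let ?P = "join_paths p (join_paths q r)"
  \<comment> \<open>the piecewise linear map that sends the breakpoints 1/4 and 1/2 to 1/2 and 3/4\<close>
  define f :: "real \<Rightarrow> real" where "f t = min (2 * t) (min (t + 1/4) (t / 2 + 1/2))" for t
  have "pathin X ?P" using assms by (intro pathin_join) (auto simp: join_paths_def)
  then have "homotopic_paths_in X (\<lambda>t. ?P (f t)) (\<lambda>t. ?P t)"
    unfolding f_def by (rule homotopic_paths_in_reparametrize) (auto intro!: continuous_intros)
  moreover have "?P (f t) = join_paths (join_paths p q) r t" for t
    using assms(4,5)
    by (auto simp: f_def join_paths_def min_def add_divide_distrib algebra_simps
        intro!: arg_cong[where f = p] arg_cong[where f = q] arg_cong[where f = r])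
  ultimately show ?thesis by simp
qed

lemma homotopic_paths_in_join_const_left:
  assumes "pathin X p"
  shows "homotopic_paths_in X (join_paths (\<lambda>t. p 0) p) p"
proof -
  define f :: "real \<Rightarrow> real" where "f t = max 0 (2 * t - 1)" for t
  have "homotopic_paths_in X (\<lambda>t. p (f t)) (\<lambda>t. p t)"
    using assms unfolding f_def by (rule homotopic_paths_in_reparametrize) (auto intro!: continuous_intros)
  moreover have "p (f t) = join_paths (\<lambda>t. p 0) p t" for t
    by (auto simp: f_def join_paths_def max_def intro!: arg_cong[where f = p])
  ultimately show ?thesis by simp
qed

lemma homotopic_paths_in_join_const_right:
  assumes "pathin X p"
  shows "homotopic_paths_in X (join_paths p (\<lambda>t. p 1)) p"
proof -
  define f :: "real \<Rightarrow> real" where "f t = min 1 (2 * t)" for t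
  have "homotopic_paths_in X (\<lambda>t. p (f t)) (\<lambda>t. p t)"
    using assms unfolding f_def by (rule homotopic_paths_in_reparametrize) (auto intro!: continuous_intros)
  moreover have "p (f t) = join_paths p (\<lambda>t. p 1) t" for t
    by (auto simp: f_def join_paths_def min_def intro!: arg_cong[where f = p])
  ultimately show ?thesis by simp
qed

lemma homotopic_paths_in_join_reverse:
  assumes "pathin X p"
  shows "homotopic_paths_in X (join_paths p (\<lambda>t. p (1 - t))) (\<lambda>t. p 0)"
proof -
  define f :: "real \<Rightarrow> real" where "f t = min (2 * t) (2 - 2 * t)" for t
  have "homotopic_paths_in X (\<lambda>t. p (f t)) (\<lambda>t. p ((\<lambda>t. 0) t))"
    using assms unfolding f_def by (rule homotopic_paths_in_reparametrize) (auto intro!: continuous_intros)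
  moreover have "p (f t) = join_paths p (\<lambda>t. p (1 - t)) t" for t
    by (auto simp: f_def join_paths_def min_def intro!: arg_cong[where f = p])
  ultimately show ?thesis by simp
qed

lemma pathin_reverse: "pathin X p \<Longrightarrow> pathin X (\<lambda>t. p (1 - t))"
  by (rule pathin_reparametrize) (auto intro!: continuous_intros)

text \<open>Writing \<open>r\<close> for the reverse of \<open>q\<close>: \<open>p \<simeq> p\<cdot>(r\<cdot>q) \<simeq> (p\<cdot>r)\<cdot>q \<simeq> q\<close>.\<close>

lemma homotopic_paths_in_if_loop_contractible:
  assumes "pathin X p" "pathin X q" "p 0 = q 0" "p 1 = q 1"
    and "homotopic_paths_in X (join_paths p (\<lambda>t. q (1 - t))) (\<lambda>t. p 0)"
  shows "homotopic_paths_in X p q"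
proof -
  let ?q = "\<lambda>t. q (1 - t)"
  note rq = pathin_reverse[OF assms(2)]
  have "homotopic_paths_in X p (join_paths p (\<lambda>t. p 1))"
    using assms(1) by (intro homotopic_paths_in_sym[OF homotopic_paths_in_join_const_right])
  also have "homotopic_paths_in X \<dots> (join_paths p (join_paths ?q q))"
    using homotopic_paths_in_join_reverse[OF rq] assms
    by (intro homotopic_paths_in_join homotopic_paths_in_sym[of X "join_paths ?q q"]) auto
  also (homotopic_paths_in_trans) have "homotopic_paths_in X \<dots> (join_paths (join_paths p ?q) q)"
    using assms rq by (intro homotopic_paths_in_sym[OF homotopic_paths_in_join_assoc]) auto
  also (homotopic_paths_in_trans) have "homotopic_paths_in X \<dots> (join_paths (\<lambda>t. q 0) q)"
    using assms by (intro homotopic_paths_in_join) (auto simp: join_paths_def)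
  also (homotopic_paths_in_trans) have "homotopic_paths_in X \<dots> q"
    using assms(2) by (rule homotopic_paths_in_join_const_left)
  finally (homotopic_paths_in_trans) show ?thesis .
qed

lemma path_connectedinE:
  assumes "path_connectedin X U" "x \<in> U" "y \<in> U"
  obtains g where "pathin X g" "\<forall>t. 0 \<le> t \<longrightarrow> t \<le> 1 \<longrightarrow> g t \<in> U" "g 0 = x" "g 1 = y"
proof -
  have "topspace (subtopology X U) = U" and pc: "path_connected_space (subtopology X U)"
    using assms(1) by (auto simp: path_connectedin_def)
  then have "\<exists>g. pathin (subtopology X U) g \<and> g 0 = x \<and> g 1 = y"
    using assms(2,3) unfolding path_connected_space_def by metis
  then obtain g where "pathin (subtopology X U) g" "g 0 = x" "g 1 = y" by blast
  then show ?thesis by (intro that[of g]) (auto simp: pathin_subtopology)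
qed

section \<open>The fundamental groupoid of a topological group with operations\<close>

lemma path_class_eqI: "homotopic_paths_in X p q \<Longrightarrow> path_class X p = path_class X q"
  unfolding path_class_def by (blast intro: homotopic_paths_in_trans homotopic_paths_in_sym)

lemma path_class_eqD:
  assumes "path_class X p = path_class X q" "pathin X p"
  shows "homotopic_paths_in X p q"
proof -
  have "p \<in> path_class X p" using assms(2) by (simp add: path_class_def)
  then have "homotopic_paths_in X q p" unfolding assms(1) by (simp add: path_class_def)
  then show ?thesis by (rule homotopic_paths_in_sym)
qed

text \<open>Paths are functions on all reals, but only their values on the unit interval matter. Identities
  between operations hold for elements of the carrier, hence at those times only.\<close>

lemma path_class_cong:
  "pathin X p \<Longrightarrow> (\<And>t. 0 \<le> t \<Longrightarrow> t \<le> 1 \<Longrightarrow> p t = q t) \<Longrightarrow> path_class X p = path_class X q"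
  by (intro path_class_eqI homotopic_paths_in_eq)

lemma in_path_class_self: "pathin X p \<Longrightarrow> p \<in> path_class X p"
  by (simp add: path_class_def)

text \<open>The unions that define the operations on classes are unions of equal sets.\<close>

lemma UN_path_class:
  assumes p: "pathin X p" and f: "\<And>p'. homotopic_paths_in X p p' \<Longrightarrow> f p' = f p"
  shows "(\<Union>p'\<in>path_class X p. f p') = f p"
proof -
  have "f ` path_class X p = {f p}"
    using f in_path_class_self[OF p] unfolding path_class_def by blast
  then show ?thesis by simp
qed

lemma UN_path_class2:
  assumes p: "pathin X p" and q: "pathin Y q"
    and f: "\<And>p' q'. homotopic_paths_in X p p' \<Longrightarrow> homotopic_paths_in Y q q' \<Longrightarrow> f p' q' = f p q"
  shows "(\<Union>p'\<in>path_class X p. \<Union>q'\<in>path_class Y q. f p' q') = f p q"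
proof -
  have "(\<Union>q'\<in>path_class Y q. f p' q') = f p q" if "homotopic_paths_in X p p'" for p'
  proof -
    have "f p' q' = f p q" if "homotopic_paths_in Y q q'" for q'
      using f[OF \<open>homotopic_paths_in X p p'\<close> that] .
    moreover have "homotopic_paths_in Y q q" using q by simp
    ultimately show ?thesis using UN_path_class[OF q, of "f p'"] by metis
  qed
  moreover have "homotopic_paths_in X p p" using p by simp
  ultimately show ?thesis using UN_path_class[OF p, of "\<lambda>p'. \<Union>q'\<in>path_class Y q. f p' q'"] by metis
qed

lemma path_class_ends:
  assumes "pathin (topo X) p"
  shows "d0 (fundamental_groupoid X) (path_class (topo X) p) = p 0"
    and "d1 (fundamental_groupoid X) (path_class (topo X) p) = p 1"
proof -
  have "(\<lambda>q. q 0) ` path_class (topo X) p = {p 0}" "(\<lambda>q. q 1) ` path_class (topo X) p = {p 1}"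
    using in_path_class_self[OF assms] by (force simp: path_class_def dest: homotopic_paths_in_ends)+
  then show "d0 (fundamental_groupoid X) (path_class (topo X) p) = p 0"
    "d1 (fundamental_groupoid X) (path_class (topo X) p) = p 1"
    by (simp_all add: fundamental_groupoid_def)
qed

lemma path_algebra_carrierI:
  "pathin (topo X) p \<Longrightarrow> path_class (topo X) p \<in> carrier (path_algebra X)"
  by (auto simp: path_algebra_def)

lemma path_algebra_carrierE:
  assumes "c \<in> carrier (path_algebra X)"
  obtains p where "pathin (topo X) p" "c = path_class (topo X) p"
  using assms by (auto simp: path_algebra_def)

lemma ball_path_algebra:
  "(\<forall>c\<in>carrier (path_algebra X). P c) \<longleftrightarrow> (\<forall>p. pathin (topo X) p \<longrightarrow> P (path_class (topo X) p))"
  by (auto simp: path_algebra_def)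

lemma Pi_path_algebra:
  "f \<in> carrier (path_algebra X) \<rightarrow> S \<longleftrightarrow> (\<forall>p. pathin (topo X) p \<longrightarrow> f (path_class (topo X) p) \<in> S)"
  by (auto simp: path_algebra_def)

lemma fundamental_groupoid_sel [simp]:
  "elts (fundamental_groupoid X) = path_algebra X"
  "objs (fundamental_groupoid X) = gwo.truncate X"
  "eps (fundamental_groupoid X) x = path_class (topo X) (\<lambda>t. x)"
  by (simp_all add: fundamental_groupoid_def)

lemma truncate_sel [simp]:
  "carrier (gwo.truncate X) = carrier X" "mult (gwo.truncate X) = mult X" "one (gwo.truncate X) = one X"
  "uop (gwo.truncate X) = uop X" "bop (gwo.truncate X) = bop X"
  by (simp_all add: gwo.truncate_def)

lemma gcomp_path_class:
  assumes "pathin (topo X) p" "pathin (topo X) q" "p 1 = q 0"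
  shows "gcomp (fundamental_groupoid X) (path_class (topo X) p) (path_class (topo X) q)
    = path_class (topo X) (join_paths p q)"
proof -
  have "path_class (topo X) (join_paths p' q') = path_class (topo X) (join_paths p q)"
    if "homotopic_paths_in (topo X) p p'" "homotopic_paths_in (topo X) q q'" for p' q'
    using homotopic_paths_in_join[OF that assms(3)] by (rule path_class_eqI[symmetric])
  then show ?thesis
    using UN_path_class2[OF assms(1,2), of "\<lambda>p' q'. path_class (topo X) (join_paths p' q')"]
    by (simp add: fundamental_groupoid_def)
qed

lemma TC_object_topspace: "TC_object \<Sigma> X \<Longrightarrow> topspace (topo X) = carrier X"
  by (simp add: TC_object_def)

lemma TC_object_group: "TC_object \<Sigma> X \<Longrightarrow> group X"
  by (simp add: TC_object_def C_object_def)

lemma pathin_carrier: "TC_object \<Sigma> X \<Longrightarrow> pathin (topo X) p \<Longrightarrow> 0 \<le> t \<Longrightarrow> t \<le> 1 \<Longrightarrow> p t \<in> carrier X"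
  using pathin_topspace TC_object_topspace by fast

lemma pathin_const_carrier: "TC_object \<Sigma> X \<Longrightarrow> x \<in> carrier X \<Longrightarrow> pathin (topo X) (\<lambda>t. x)"
  by (simp add: TC_object_topspace pathin_def)

lemma path_algebra_mult:
  assumes "TC_object \<Sigma> X" "pathin (topo X) p" "pathin (topo X) q"
  shows "pathin (topo X) (\<lambda>t. p t \<otimes>\<^bsub>X\<^esub> q t)"
    and "path_class (topo X) p \<otimes>\<^bsub>path_algebra X\<^esub> path_class (topo X) q
      = path_class (topo X) (\<lambda>t. p t \<otimes>\<^bsub>X\<^esub> q t)"
proof -
  have c: "continuous_map (prod_topology (topo X) (topo X)) (topo X) (\<lambda>(x, y). x \<otimes>\<^bsub>X\<^esub> y)"
    using assms(1) by (simp add: TC_object_def)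
  show "pathin (topo X) (\<lambda>t. p t \<otimes>\<^bsub>X\<^esub> q t)" by (rule pathin_binop[OF c assms(2,3)])
  show "path_class (topo X) p \<otimes>\<^bsub>path_algebra X\<^esub> path_class (topo X) q
      = path_class (topo X) (\<lambda>t. p t \<otimes>\<^bsub>X\<^esub> q t)"
    using UN_path_class2[OF assms(2,3), of "\<lambda>p' q'. path_class (topo X) (\<lambda>t. p' t \<otimes>\<^bsub>X\<^esub> q' t)"]
      path_class_eqI[OF homotopic_paths_in_binop[OF c], symmetric]
    by (simp add: path_algebra_def)
qed

lemma path_algebra_bop:
  assumes "TC_object \<Sigma> X" "s \<in> Omega2' \<Sigma>" "pathin (topo X) p" "pathin (topo X) q"
  shows "pathin (topo X) (\<lambda>t. bop X s (p t) (q t))"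
    and "bop (path_algebra X) s (path_class (topo X) p) (path_class (topo X) q)
      = path_class (topo X) (\<lambda>t. bop X s (p t) (q t))"
proof -
  have c: "continuous_map (prod_topology (topo X) (topo X)) (topo X) (\<lambda>(x, y). bop X s x y)"
    using assms(1,2) by (simp add: TC_object_def)
  show "pathin (topo X) (\<lambda>t. bop X s (p t) (q t))" by (rule pathin_binop[OF c assms(3,4)])
  show "bop (path_algebra X) s (path_class (topo X) p) (path_class (topo X) q)
      = path_class (topo X) (\<lambda>t. bop X s (p t) (q t))"
    using UN_path_class2[OF assms(3,4), of "\<lambda>p' q'. path_class (topo X) (\<lambda>t. bop X s (p' t) (q' t))"]
      path_class_eqI[OF homotopic_paths_in_binop[OF c], symmetric]
    by (simp add: path_algebra_def)
qed

lemma path_algebra_uop: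
  assumes "TC_object \<Sigma> X" "w \<in> Omega1' \<Sigma>" "pathin (topo X) p"
  shows "pathin (topo X) (\<lambda>t. uop X w (p t))"
    and "uop (path_algebra X) w (path_class (topo X) p) = path_class (topo X) (\<lambda>t. uop X w (p t))"
proof -
  have c: "continuous_map (topo X) (topo X) (uop X w)"
    using assms(1,2) by (simp add: TC_object_def)
  show "pathin (topo X) (\<lambda>t. uop X w (p t))" by (rule pathin_compose'[OF c assms(3)])
  show "uop (path_algebra X) w (path_class (topo X) p) = path_class (topo X) (\<lambda>t. uop X w (p t))"
    using UN_path_class[OF assms(3), of "\<lambda>p'. path_class (topo X) (\<lambda>t. uop X w (p' t))"]
      path_class_eqI[OF homotopic_paths_in_compose[OF c], symmetric]
    by (simp add: path_algebra_def)
qed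

lemma path_algebra_one: "\<one>\<^bsub>path_algebra X\<^esub> = path_class (topo X) (\<lambda>t. \<one>\<^bsub>X\<^esub>)"
  by (simp add: path_algebra_def)

lemma group_path_algebra:
  assumes X: "TC_object \<Sigma> X"
  shows "group (path_algebra X)"
proof -
  interpret X: group X using X by (rule TC_object_group)
  note [simp] = TC_object_topspace[OF X] pathin_carrier[OF X] path_algebra_mult[OF X] path_algebra_one
  have inv: "pathin (topo X) (\<lambda>t. inv\<^bsub>X\<^esub> p t)" if "pathin (topo X) p" for p
    using X that by (auto simp: TC_object_def intro: pathin_compose')
  have one [simp]: "pathin (topo X) (\<lambda>t. \<one>\<^bsub>X\<^esub>)" by (intro pathin_const_carrier[OF X]) simp
  show ?thesis
  proof (rule groupI)
    show "\<one>\<^bsub>path_algebra X\<^esub> \<in> carrier (path_algebra X)"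
      using path_algebra_carrierI[OF one] by simp
  next
    fix x y assume "x \<in> carrier (path_algebra X)" "y \<in> carrier (path_algebra X)"
    then show "x \<otimes>\<^bsub>path_algebra X\<^esub> y \<in> carrier (path_algebra X)"
      by (auto elim!: path_algebra_carrierE simp: path_algebra_carrierI)
    fix z assume "z \<in> carrier (path_algebra X)"
    then show "x \<otimes>\<^bsub>path_algebra X\<^esub> y \<otimes>\<^bsub>path_algebra X\<^esub> z = x \<otimes>\<^bsub>path_algebra X\<^esub> (y \<otimes>\<^bsub>path_algebra X\<^esub> z)"
      using \<open>x \<in> _\<close> \<open>y \<in> _\<close>
      by (elim path_algebra_carrierE) (simp, rule path_class_cong, auto simp: X.m_assoc)
  next
    fix x assume "x \<in> carrier (path_algebra X)"
    then obtain p where p: "pathin (topo X) p" and x: "x = path_class (topo X) p"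
      by (rule path_algebra_carrierE)
    then show "\<one>\<^bsub>path_algebra X\<^esub> \<otimes>\<^bsub>path_algebra X\<^esub> x = x"
      using one p path_class_cong[OF p, of "\<lambda>t. \<one>\<^bsub>X\<^esub> \<otimes>\<^bsub>X\<^esub> p t", symmetric]
      by (simp del: pathin_const)
    show "\<exists>y\<in>carrier (path_algebra X). y \<otimes>\<^bsub>path_algebra X\<^esub> x = \<one>\<^bsub>path_algebra X\<^esub>"
    proof (intro bexI)
      have "path_class (topo X) (\<lambda>t. inv\<^bsub>X\<^esub> p t \<otimes>\<^bsub>X\<^esub> p t) = path_class (topo X) (\<lambda>t. \<one>\<^bsub>X\<^esub>)"
        using p inv[OF p] by (intro path_class_cong) simp_all
      then show "path_class (topo X) (\<lambda>t. inv\<^bsub>X\<^esub> p t) \<otimes>\<^bsub>path_algebra X\<^esub> x = \<one>\<^bsub>path_algebra X\<^esub>"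
        using p inv[OF p] x by simp
    qed (rule path_algebra_carrierI[OF inv[OF p]])
  qed
qed

lemma path_algebra_inv:
  assumes X: "TC_object \<Sigma> X" and p: "pathin (topo X) p"
  shows "pathin (topo X) (\<lambda>t. inv\<^bsub>X\<^esub> p t)"
    and "inv\<^bsub>path_algebra X\<^esub> path_class (topo X) p = path_class (topo X) (\<lambda>t. inv\<^bsub>X\<^esub> p t)"
proof -
  interpret X: group X using X by (rule TC_object_group)
  interpret P: group "path_algebra X" using X by (rule group_path_algebra)
  show i: "pathin (topo X) (\<lambda>t. inv\<^bsub>X\<^esub> p t)"
    using X p by (auto simp: TC_object_def intro: pathin_compose')
  show "inv\<^bsub>path_algebra X\<^esub> path_class (topo X) p = path_class (topo X) (\<lambda>t. inv\<^bsub>X\<^esub> p t)"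
    using p i pathin_carrier[OF X p]
    by (intro P.inv_equality) (auto intro!: path_class_cong path_algebra_carrierI path_algebra_mult[OF X]
        simp: path_algebra_mult[OF X] path_algebra_one)
qed

text \<open>Operations on classes are pointwise operations on representatives, hence so are derived
  operations, and an identity that holds at every time of a family of paths holds for the classes.\<close>

lemma eval_term_path_algebra:
  assumes X: "TC_object \<Sigma> X" and r: "\<And>n. pathin (topo X) (r n)"
    and "set1_gterm t \<subseteq> Omega1' \<Sigma>" "set2_gterm t \<subseteq> Omega2' \<Sigma>"
  shows "pathin (topo X) (\<lambda>s. eval_term X (\<lambda>n. r n s) t) \<and>
    eval_term (path_algebra X) (\<lambda>n. path_class (topo X) (r n)) t
      = path_class (topo X) (\<lambda>s. eval_term X (\<lambda>n. r n s) t)"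
  using assms(3-)
proof (induction t)
  case Zero
  then show ?case
    using pathin_const_carrier[OF X, of "\<one>\<^bsub>X\<^esub>"] TC_object_group[OF X]
    by (simp add: path_algebra_one group.is_monoid)
qed (auto simp: r path_algebra_inv[OF X] path_algebra_mult[OF X] path_algebra_uop[OF X] path_algebra_bop[OF X])

lemma C_object_path_algebra:
  assumes gw: "groups_with_operations \<Sigma>" and X: "TC_object \<Sigma> X"
  shows "C_object \<Sigma> (path_algebra X)"
  unfolding C_object_def
proof (intro conjI ballI)
  show "group (path_algebra X)" using X by (rule group_path_algebra)
next
  fix w c assume "w \<in> Omega1' \<Sigma>" "c \<in> carrier (path_algebra X)"
  then show "uop (path_algebra X) w c \<in> carrier (path_algebra X)"
    by (auto elim!: path_algebra_carrierE intro!: path_algebra_carrierI simp: path_algebra_uop[OF X])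
next
  fix s c d assume "s \<in> Omega2' \<Sigma>" "c \<in> carrier (path_algebra X)" "d \<in> carrier (path_algebra X)"
  then show "bop (path_algebra X) s c d \<in> carrier (path_algebra X)"
    by (auto elim!: path_algebra_carrierE intro!: path_algebra_carrierI simp: path_algebra_bop[OF X])
next
  fix e assume "e \<in> Idents \<Sigma>"
  then obtain s t where st: "e = (s, t)" "(s, t) \<in> Idents \<Sigma>" by (cases e) auto
  have ops: "set1_gterm s \<subseteq> Omega1' \<Sigma>" "set2_gterm s \<subseteq> Omega2' \<Sigma>"
    "set1_gterm t \<subseteq> Omega1' \<Sigma>" "set2_gterm t \<subseteq> Omega2' \<Sigma>"
    using gw st by (auto simp: groups_with_operations_def)
  have "eval_term (path_algebra X) v s = eval_term (path_algebra X) v t"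
    if v: "range v \<subseteq> carrier (path_algebra X)" for v
  proof -
    have "\<exists>p. pathin (topo X) p \<and> v n = path_class (topo X) p" for n
      using v path_algebra_carrierE[of "v n" X] by (metis rangeI subsetD)
    then obtain r where r: "\<And>n. pathin (topo X) (r n)" and vr: "\<And>n. v n = path_class (topo X) (r n)"
      by metis
    have v_eq: "v = (\<lambda>n. path_class (topo X) (r n))" using vr by auto
    have "eval_term X (\<lambda>n. r n \<tau>) s = eval_term X (\<lambda>n. r n \<tau>) t" if "0 \<le> \<tau>" "\<tau> \<le> 1" for \<tau>
    proof -
      have "range (\<lambda>n. r n \<tau>) \<subseteq> carrier X" using pathin_carrier[OF X r that] by auto
      then show ?thesis using X st by (auto simp: TC_object_def C_object_def)
    qed
    then have "path_class (topo X) (\<lambda>\<tau>. eval_term X (\<lambda>n. r n \<tau>) s)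
        = path_class (topo X) (\<lambda>\<tau>. eval_term X (\<lambda>n. r n \<tau>) t)"
      using eval_term_path_algebra[of \<Sigma> X r s, OF X r ops(1,2)] by (intro path_class_cong) auto
    then show ?thesis
      using eval_term_path_algebra[of \<Sigma> X r s, OF X r ops(1,2)]
        eval_term_path_algebra[of \<Sigma> X r t, OF X r ops(3,4)] unfolding v_eq by argo
  qed
  with st show "case e of (s, t) \<Rightarrow> \<forall>v. range v \<subseteq> carrier (path_algebra X) \<longrightarrow>
      eval_term (path_algebra X) v s = eval_term (path_algebra X) v t" by auto
qed

lemma m_inv_truncate: "m_inv (gwo.truncate X) = m_inv X"
  by (rule ext) (simp add: m_inv_def)

lemma eval_term_truncate: "eval_term (gwo.truncate X) v t = eval_term X v t"
  by (induction t) (simp_all add: m_inv_truncate)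

lemma group_truncate_iff: "group (gwo.truncate X) \<longleftrightarrow> group X"
  unfolding group_def group_axioms_def monoid_def Units_def truncate_sel ..

lemma C_object_truncate: "C_object \<Sigma> (gwo.truncate X) \<longleftrightarrow> C_object \<Sigma> X"
  by (simp add: C_object_def eval_term_truncate group_truncate_iff)

lemma is_groupoid_fundamental_groupoid:
  assumes X: "TC_object \<Sigma> X"
  shows "is_groupoid (fundamental_groupoid X)"
proof -
  note [simp] = TC_object_topspace[OF X] pathin_carrier[OF X] pathin_const_carrier[OF X] path_class_ends gcomp_path_class
    pathin_join path_algebra_carrierI
  show ?thesis
    unfolding is_groupoid_def fundamental_groupoid_sel truncate_sel
  proof (intro conjI ballI impI)
    fix a b assume "a \<in> carrier (path_algebra X)" "b \<in> carrier (path_algebra X)"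
      "d1 (fundamental_groupoid X) a = d0 (fundamental_groupoid X) b"
    then show "gcomp (fundamental_groupoid X) a b \<in> carrier (path_algebra X)"
      "d0 (fundamental_groupoid X) (gcomp (fundamental_groupoid X) a b) = d0 (fundamental_groupoid X) a"
      "d1 (fundamental_groupoid X) (gcomp (fundamental_groupoid X) a b) = d1 (fundamental_groupoid X) b"
      by (auto elim!: path_algebra_carrierE)
    fix c assume "c \<in> carrier (path_algebra X)" "d1 (fundamental_groupoid X) b = d0 (fundamental_groupoid X) c"
    then show "gcomp (fundamental_groupoid X) (gcomp (fundamental_groupoid X) a b) c =
      gcomp (fundamental_groupoid X) a (gcomp (fundamental_groupoid X) b c)"
      using \<open>a \<in> _\<close> \<open>b \<in> _\<close> \<open>d1 _ a = _\<close>
      by (elim path_algebra_carrierE) (simp, rule path_class_eqI[OF homotopic_paths_in_join_assoc], auto)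
  next
    fix a assume "a \<in> carrier (path_algebra X)"
    then obtain p where p: "pathin (topo X) p" and a: "a = path_class (topo X) p"
      by (rule path_algebra_carrierE)
    show "gcomp (fundamental_groupoid X) (path_class (topo X) (\<lambda>t. d0 (fundamental_groupoid X) a)) a = a"
      "gcomp (fundamental_groupoid X) a (path_class (topo X) (\<lambda>t. d1 (fundamental_groupoid X) a)) = a"
      using p path_class_eqI[OF homotopic_paths_in_join_const_left[OF p]]
        path_class_eqI[OF homotopic_paths_in_join_const_right[OF p]] by (simp_all add: a)
    let ?q = "\<lambda>t. p (1 - t)"
    note q = pathin_reverse[OF p]
    show "\<exists>b\<in>carrier (path_algebra X). d0 (fundamental_groupoid X) b = d1 (fundamental_groupoid X) a \<and>
      d1 (fundamental_groupoid X) b = d0 (fundamental_groupoid X) a \<and>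
      gcomp (fundamental_groupoid X) a b = path_class (topo X) (\<lambda>t. d0 (fundamental_groupoid X) a) \<and>
      gcomp (fundamental_groupoid X) b a = path_class (topo X) (\<lambda>t. d1 (fundamental_groupoid X) a)"
      using p q homotopic_paths_in_join_reverse[OF p] homotopic_paths_in_join_reverse[OF q]
      by (intro bexI[of _ "path_class (topo X) ?q"]) (auto simp: a intro!: path_class_eqI)
  qed (auto simp: Pi_path_algebra)
qed

lemma internal_groupoid_fundamental_groupoid:
  assumes gw: "groups_with_operations \<Sigma>" and X: "TC_object \<Sigma> X"
  shows "internal_groupoid \<Sigma> (fundamental_groupoid X)"
proof -
  note [simp] = TC_object_topspace[OF X] pathin_carrier[OF X] pathin_const_carrier[OF X] path_class_ends gcomp_path_class
    pathin_join path_algebra_carrierI path_algebra_mult[OF X] path_algebra_uop[OF X] path_algebra_bop[OF X]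
  have C: "C_object \<Sigma> X" using X by (simp add: TC_object_def)
  interpret X: group X using X by (rule TC_object_group)
  have comp: "(\<lambda>(a, b). gcomp (fundamental_groupoid X) a b)
      \<in> C_hom \<Sigma> (composable_pairs (fundamental_groupoid X)) (path_algebra X)"
  proof -
    \<comment> \<open>pointwise operations commute with concatenation on the nose\<close>
    let ?c = "\<lambda>p. path_class (topo X) p" and ?g = "gcomp (fundamental_groupoid X)"
    have join:
      "(\<lambda>t. uop X w (join_paths p q t)) = join_paths (\<lambda>t. uop X w (p t)) (\<lambda>t. uop X w (q t))"
      "(\<lambda>t. join_paths p q t \<otimes>\<^bsub>X\<^esub> join_paths p' q' t) = join_paths (\<lambda>t. p t \<otimes>\<^bsub>X\<^esub> p' t) (\<lambda>t. q t \<otimes>\<^bsub>X\<^esub> q' t)"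
      "(\<lambda>t. bop X s (join_paths p q t) (join_paths p' q' t))
         = join_paths (\<lambda>t. bop X s (p t) (p' t)) (\<lambda>t. bop X s (q t) (q' t))"
      for w s p q p' q'
      by (simp_all add: join_paths_def fun_eq_iff)
    have "?g (?c p) (?c q) \<in> carrier (path_algebra X)"
      "w \<in> Omega1' \<Sigma> \<Longrightarrow> ?g (uop (path_algebra X) w (?c p)) (uop (path_algebra X) w (?c q))
         = uop (path_algebra X) w (?g (?c p) (?c q))"
      if "pathin (topo X) p" "pathin (topo X) q" "p 1 = q 0" for p q w
      using that by (simp_all add: join)
    moreover have "?g (?c p \<otimes>\<^bsub>path_algebra X\<^esub> ?c p') (?c q \<otimes>\<^bsub>path_algebra X\<^esub> ?c q')
        = ?g (?c p) (?c q) \<otimes>\<^bsub>path_algebra X\<^esub> ?g (?c p') (?c q')"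
      "s \<in> Omega2' \<Sigma> \<Longrightarrow> ?g (bop (path_algebra X) s (?c p) (?c p')) (bop (path_algebra X) s (?c q) (?c q'))
         = bop (path_algebra X) s (?g (?c p) (?c q)) (?g (?c p') (?c q'))"
      if "pathin (topo X) p" "pathin (topo X) q" "p 1 = q 0"
        "pathin (topo X) p'" "pathin (topo X) q'" "p' 1 = q' 0" for p q p' q' s
      using that by (simp_all add: join)
    ultimately show ?thesis
      unfolding C_hom_def hom_def composable_pairs_def
      by (auto elim!: path_algebra_carrierE)
  qed
  have d: "d0 (fundamental_groupoid X) \<in> C_hom \<Sigma> (path_algebra X) (gwo.truncate X)"
    "d1 (fundamental_groupoid X) \<in> C_hom \<Sigma> (path_algebra X) (gwo.truncate X)"
    by (simp_all add: C_hom_def hom_def ball_path_algebra Pi_path_algebra)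
  have e: "eps (fundamental_groupoid X) \<in> C_hom \<Sigma> (gwo.truncate X) (path_algebra X)"
    by (simp add: C_hom_def hom_def)
  show ?thesis
    unfolding internal_groupoid_def fundamental_groupoid_sel(1,2) C_object_truncate
    using C C_object_path_algebra[OF gw X] is_groupoid_fundamental_groupoid[OF X] comp d e
    by (simp only: simp_thms)
qed

section \<open>Lifting through covering maps of abstract topologies\<close>

lemma covering_map_continuous: "covering_map S X p \<Longrightarrow> continuous_map S X p"
  by (simp add: covering_map_def)

lemma covering_map_surj: "covering_map S X p \<Longrightarrow> p ` topspace S = topspace X"
  by (simp add: covering_map_def)

text \<open>Sheets through two points of the same fibre are taken over the same open set, so that they
  are equal or disjoint; \<open>s\<close> is the local section with values in the first sheet.\<close>

lemma covering_map_sheets: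
  assumes cov: "covering_map S X p" and y: "y \<in> topspace S" and z: "z \<in> topspace S" and eq: "p y = p z"
  obtains T V W s where "openin X T" "p y \<in> T" "openin S V" "openin S W" "y \<in> V" "z \<in> W"
    "V = W \<or> V \<inter> W = {}" "p ` V \<subseteq> T" "inj_on p V"
    "continuous_map (subtopology X T) (subtopology S V) s" "\<And>x. x \<in> T \<Longrightarrow> s x \<in> V" "\<And>x. x \<in> T \<Longrightarrow> p (s x) = x"
proof -
  have "p y \<in> topspace X" using cov y by (auto simp: covering_map_def)
  then obtain T \<V> where T: "p y \<in> T" "openin X T" and un: "\<Union>\<V> = topspace S \<inter> p -` T"
    and op: "\<And>U. U \<in> \<V> \<Longrightarrow> openin S U" and dis: "pairwise disjnt \<V>"
    and hom: "\<And>U. U \<in> \<V> \<Longrightarrow> homeomorphic_map (subtopology S U) (subtopology X T) p"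
    using cov unfolding covering_map_def by meson
  obtain V where V: "V \<in> \<V>" "y \<in> V" using un y T by auto
  obtain W where W: "W \<in> \<V>" "z \<in> W" using un z T eq by auto
  obtain s where s: "homeomorphic_maps (subtopology S V) (subtopology X T) p s"
    using hom[OF V(1)] by (auto simp: homeomorphic_map_maps)
  have tV: "topspace (subtopology S V) = V" "topspace (subtopology X T) = T"
    using op[OF V(1)] T(2) openin_subset by force+
  have vs: "continuous_map (subtopology X T) (subtopology S V) s" "\<forall>v\<in>V. s (p v) = v" "\<forall>x\<in>T. p (s x) = x"
    "continuous_map (subtopology S V) (subtopology X T) p"
    using s unfolding homeomorphic_maps_def tV by auto
  show ?thesis
  proof
    show "V = W \<or> V \<inter> W = {}" using dis V W by (auto simp: pairwise_def disjnt_def)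
    show "inj_on p V" using vs(2) by (metis inj_onI)
    show "p ` V \<subseteq> T" using un V by auto
    show "s x \<in> V" if "x \<in> T" for x
      using continuous_map_funspace[OF vs(1)] that unfolding tV by blast
  qed (use T V W op vs in auto)
qed

text \<open>One open set serves the whole fibre over \<open>x\<close>; maps into it can be lifted from any starting
  value.\<close>

lemma covering_map_section:
  assumes cov: "covering_map S X p" and x: "x \<in> topspace X"
  obtains T where "openin X T" "x \<in> T"
    "\<And>y. y \<in> topspace S \<Longrightarrow> p y \<in> T \<Longrightarrow>
       \<exists>s. continuous_map (subtopology X T) S s \<and> s (p y) = y \<and> (\<forall>x\<in>T. p (s x) = x)"
proof -
  obtain T \<V> where T: "x \<in> T" "openin X T" and un: "\<Union>\<V> = topspace S \<inter> p -` T"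
    and op: "\<And>U. U \<in> \<V> \<Longrightarrow> openin S U"
    and hom: "\<And>U. U \<in> \<V> \<Longrightarrow> homeomorphic_map (subtopology S U) (subtopology X T) p"
    using cov x unfolding covering_map_def by meson
  have "\<exists>s. continuous_map (subtopology X T) S s \<and> s (p y) = y \<and> (\<forall>x\<in>T. p (s x) = x)"
    if y: "y \<in> topspace S" "p y \<in> T" for y
  proof -
    obtain V where V: "V \<in> \<V>" "y \<in> V" using un y T by auto
    obtain s where s: "homeomorphic_maps (subtopology S V) (subtopology X T) p s"
      using hom[OF V(1)] by (auto simp: homeomorphic_map_maps)
    have tV: "topspace (subtopology S V) = V" "topspace (subtopology X T) = T"
      using op[OF V(1)] T(2) openin_subset by force+
    have "continuous_map (subtopology X T) (subtopology S V) s" "\<forall>v\<in>V. s (p v) = v" "\<forall>x\<in>T. p (s x) = x"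
      using s unfolding homeomorphic_maps_def tV by auto
    then show ?thesis using V by (auto simp: continuous_map_in_subtopology)
  qed
  then show ?thesis using T that by blast
qed

text \<open>Both the points where two lifts agree and those where they differ form open sets: near a point
  the lifts run in two sheets over the same set, and these are equal or disjoint.\<close>

lemma unique_lift:
  assumes cov: "covering_map S X p" and conn: "connected_space Z"
    and g: "continuous_map Z S g" and h: "continuous_map Z S h"
    and eq: "\<And>z. z \<in> topspace Z \<Longrightarrow> p (g z) = p (h z)"
    and a: "a \<in> topspace Z" "g a = h a" and z: "z \<in> topspace Z"
  shows "g z = h z"
proof (rule ccontr)
  assume ne: "g z \<noteq> h z"
  let ?A = "{z \<in> topspace Z. g z = h z}" and ?B = "{z \<in> topspace Z. g z \<noteq> h z}"
  have nbhd: "\<exists>U. openin Z U \<and> w \<in> U \<and> (\<forall>u\<in>U. g u = h u \<longleftrightarrow> g w = h w)" if w: "w \<in> topspace Z" for w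
  proof -
    have gw: "g w \<in> topspace S" "h w \<in> topspace S" using g h w by (auto simp: continuous_map_def)
    show ?thesis
    proof (rule covering_map_sheets[OF cov gw eq[OF w]])
      fix T V W s
      assume VW: "openin S V" "openin S W" "g w \<in> V" "h w \<in> W" "V = W \<or> V \<inter> W = {}" "inj_on p V"
    let ?U = "{u \<in> topspace Z. g u \<in> V} \<inter> {u \<in> topspace Z. h u \<in> W}"
      have 1: "openin Z ?U" using VW g h by (intro openin_Int openin_continuous_map_preimage)
    have 2: "g u = h u \<longleftrightarrow> g w = h w" if "u \<in> ?U" for u
    proof (cases "V = W")
      case True
      then show ?thesis using that VW eq w by (auto dest: inj_onD)
    next
      case False
      then show ?thesis using that VW by auto
    qed
    have "w \<in> ?U" using w VW by simp
    then show ?thesis using 1 2 by blast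
    qed
  qed
  have "openin Z ?A" "openin Z ?B"
  proof -
    have "\<exists>U. openin Z U \<and> w \<in> U \<and> U \<subseteq> ?A" if "w \<in> ?A" for w
      using nbhd[of w] that openin_subset by blast
    then show "openin Z ?A" by (subst openin_subopen) blast
    have "\<exists>U. openin Z U \<and> w \<in> U \<and> U \<subseteq> ?B" if "w \<in> ?B" for w
      using nbhd[of w] that openin_subset by blast
    then show "openin Z ?B" by (subst openin_subopen) blast
  qed
  moreover have "topspace Z \<subseteq> ?A \<union> ?B" "?A \<inter> ?B = {}" "?A \<noteq> {}" "?B \<noteq> {}" using a z ne by auto
  ultimately show False using conn unfolding connected_space_def by blast
qed

text \<open>Arbitrary starting points are allowed so that this property survives gluing: a lift over one piece
  is continued over the next from a point of the overlap.\<close>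

definition liftable ::
  "'a topology \<Rightarrow> 'b topology \<Rightarrow> ('a \<Rightarrow> 'b) \<Rightarrow> ('c::topological_space \<Rightarrow> 'b) \<Rightarrow> 'c set \<Rightarrow> bool" where
  "liftable S X p F Z \<longleftrightarrow> (\<forall>z\<in>Z. \<forall>y\<in>topspace S. p y = F z \<longrightarrow>
     (\<exists>G. continuous_map (top_of_set Z) S G \<and> G z = y \<and> (\<forall>w\<in>Z. p (G w) = F w)))"

lemma continuous_map_Un_closed:
  assumes A: "closedin (top_of_set (A \<union> B)) A" and B: "closedin (top_of_set (A \<union> B)) B"
    and g: "continuous_map (top_of_set A) Y g" and h: "continuous_map (top_of_set B) Y h"
    and eq: "\<And>x. x \<in> A \<inter> B \<Longrightarrow> g x = h x"
  shows "continuous_map (top_of_set (A \<union> B)) Y (\<lambda>x. if x \<in> A then g x else h x)"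
  unfolding continuous_map_closedin
proof (intro conjI allI impI)
  show "(\<lambda>x. if x \<in> A then g x else h x) \<in> topspace (top_of_set (A \<union> B)) \<rightarrow> topspace Y"
    using g h by (auto simp: continuous_map_def)
  fix C assume C: "closedin Y C"
  have "closedin (top_of_set A) {x \<in> A. g x \<in> C}" "closedin (top_of_set B) {x \<in> B. h x \<in> C}"
    using g h C by (auto simp: continuous_map_closedin)
  then have "closedin (top_of_set (A \<union> B)) {x \<in> A. g x \<in> C}" "closedin (top_of_set (A \<union> B)) {x \<in> B. h x \<in> C}"
    using A B by (auto intro: closedin_trans)
  then have "closedin (top_of_set (A \<union> B)) ({x \<in> A. g x \<in> C} \<union> {x \<in> B. h x \<in> C})" by (rule closedin_Un)
  moreover have "{x \<in> A. g x \<in> C} \<union> {x \<in> B. h x \<in> C}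
    = {x \<in> topspace (top_of_set (A \<union> B)). (if x \<in> A then g x else h x) \<in> C}" using eq by auto
  ultimately show "closedin (top_of_set (A \<union> B))
      {x \<in> topspace (top_of_set (A \<union> B)). (if x \<in> A then g x else h x) \<in> C}" by simp
qed

lemma liftable_Un:
  assumes cov: "covering_map S X p"
    and A: "closedin (top_of_set (A \<union> B)) A" and B: "closedin (top_of_set (A \<union> B)) B"
    and conn: "connected (A \<inter> B)" and ne: "A \<inter> B \<noteq> {}"
    and lA: "liftable S X p F A" and lB: "liftable S X p F B"
  shows "liftable S X p F (A \<union> B)"
proof -
  have *: "\<exists>G. continuous_map (top_of_set (A \<union> B)) S G \<and> G z = y \<and> (\<forall>w\<in>A \<union> B. p (G w) = F w)"
    if A: "closedin (top_of_set (A \<union> B)) A" and B: "closedin (top_of_set (A \<union> B)) B"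
    and conn: "connected (A \<inter> B)" and ne: "A \<inter> B \<noteq> {}"
    and lA: "liftable S X p F A" and lB: "liftable S X p F B"
    and z: "z \<in> A" and y: "y \<in> topspace S" "p y = F z" for A B z y
  proof -
    obtain g where g: "continuous_map (top_of_set A) S g" "g z = y" "\<And>w. w \<in> A \<Longrightarrow> p (g w) = F w"
      using lA z y unfolding liftable_def by meson
    obtain w where w: "w \<in> A" "w \<in> B" using ne by blast
    have "g w \<in> topspace S" using g(1) w by (auto simp: continuous_map_def)
    then obtain h where h: "continuous_map (top_of_set B) S h" "h w = g w" "\<And>u. u \<in> B \<Longrightarrow> p (h u) = F u"
      using lB w g(3) unfolding liftable_def by metis
    have "g u = h u" if "u \<in> A \<inter> B" for u
    proof (rule unique_lift[OF cov, of "top_of_set (A \<inter> B)" g h w])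
      show "connected_space (top_of_set (A \<inter> B))" using conn by (simp add: connected_space_subtopology)
      show "continuous_map (top_of_set (A \<inter> B)) S g" "continuous_map (top_of_set (A \<inter> B)) S h"
        using g(1) h(1) by (auto intro: continuous_map_from_subtopology_mono)
    qed (use g h w that in auto)
    with A B g h have "continuous_map (top_of_set (A \<union> B)) S (\<lambda>x. if x \<in> A then g x else h x)"
      by (intro continuous_map_Un_closed) auto
    then show ?thesis
      using g h z by (intro exI[of _ "\<lambda>x. if x \<in> A then g x else h x"]) auto
  qed
  show ?thesis
    unfolding liftable_def
  proof (intro ballI impI)
    fix z y assume "z \<in> A \<union> B" "y \<in> topspace S" "p y = F z"
    then show "\<exists>G. continuous_map (top_of_set (A \<union> B)) S G \<and> G z = y \<and> (\<forall>w\<in>A \<union> B. p (G w) = F w)"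
      using *[OF A B conn ne lA lB] *[of B A] A B conn ne lA lB
      by (auto simp: Un_commute Int_commute)
  qed
qed

lemma locally_liftable:
  fixes F :: "'c::topological_space \<Rightarrow> 'b"
  assumes cov: "covering_map S X p" and F: "continuous_map (top_of_set D) X F" and w: "w \<in> D"
  obtains U where "open U" "w \<in> U" "\<And>Z. Z \<subseteq> U \<inter> D \<Longrightarrow> liftable S X p F Z"
proof -
  have "F w \<in> topspace X" using F w by (auto simp: continuous_map_def)
  then obtain T where T: "openin X T" "F w \<in> T" and sec: "\<And>y. y \<in> topspace S \<Longrightarrow> p y \<in> T \<Longrightarrow>
       \<exists>s. continuous_map (subtopology X T) S s \<and> s (p y) = y \<and> (\<forall>x\<in>T. p (s x) = x)"
    using covering_map_section[OF cov] by metis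
  have "openin (top_of_set D) {x \<in> D. F x \<in> T}"
    using openin_continuous_map_preimage[OF F T(1)] by simp
  then obtain U where U: "open U" "{x \<in> D. F x \<in> T} = D \<inter> U" by (auto simp: openin_open)
  have "liftable S X p F Z" if Z: "Z \<subseteq> U \<inter> D" for Z
    unfolding liftable_def
  proof (intro ballI impI)
    fix z y assume z: "z \<in> Z" and y: "y \<in> topspace S" "p y = F z"
    have FT: "F x \<in> T" if "x \<in> Z" for x using that Z U(2) by blast
    obtain s where s: "continuous_map (subtopology X T) S s" "s (p y) = y" "\<forall>x\<in>T. p (s x) = x"
      using sec[OF y(1)] y(2) FT[OF z] by auto
    have "continuous_map (top_of_set Z) (subtopology X T) F"
      using F FT Z by (auto simp: continuous_map_in_subtopology intro: continuous_map_from_subtopology_mono)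
    then have "continuous_map (top_of_set Z) S (s \<circ> F)" using s(1) by (rule continuous_map_compose)
    then show "\<exists>G. continuous_map (top_of_set Z) S G \<and> G z = y \<and> (\<forall>w\<in>Z. p (G w) = F w)"
      using s y FT by (intro exI[of _ "s \<circ> F"]) auto
  qed
  moreover have "w \<in> U" using U w T by auto
  ultimately show ?thesis using that U by blast
qed

text \<open>Rectangles are lifted by bisection, first in the second coordinate, which yields thin vertical
  strips, and then in the first: two rectangles with a common side can be lifted one after the other,
  because the lift over the common side is unique.\<close>

lemma liftable_unit_square:
  assumes cov: "covering_map S X p" and F: "continuous_map unit_square X F"
  shows "liftable S X p F ({0..1} \<times> {0..1})"
proof -
  have join1: "liftable S X p F ({a..c} \<times> {u..v})"
    if "liftable S X p F ({a..b} \<times> {u..v})" "liftable S X p F ({b..c} \<times> {u..v})" "a \<le> b" "b \<le> c" "u \<le> v"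
    for a b c u v :: real
  proof -
    have "{a..b} \<times> {u..v} \<union> {b..c} \<times> {u..v} = {a..c} \<times> {u..v}" using that by auto
    moreover have "{a..b} \<times> {u..v} \<inter> {b..c} \<times> {u..v} = {b} \<times> {u..v}" using that by auto
    moreover have "connected ({b} \<times> {u..v})" by (intro connected_Times) auto
    ultimately show ?thesis
      using liftable_Un[OF cov, of "{a..b} \<times> {u..v}" "{b..c} \<times> {u..v}" F] that
      by (auto intro!: closed_subset closed_Times)
  qed
  have join2: "liftable S X p F ({u..v} \<times> {a..c})"
    if "liftable S X p F ({u..v} \<times> {a..b})" "liftable S X p F ({u..v} \<times> {b..c})" "a \<le> b" "b \<le> c" "u \<le> v"
    for a b c u v :: real
  proof -
    have "{u..v} \<times> {a..b} \<union> {u..v} \<times> {b..c} = {u..v} \<times> {a..c}" using that by auto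
    moreover have "{u..v} \<times> {a..b} \<inter> {u..v} \<times> {b..c} = {u..v} \<times> {b}" using that by auto
    moreover have "connected ({u..v} \<times> {b})" by (intro connected_Times) auto
    ultimately show ?thesis
      using liftable_Un[OF cov, of "{u..v} \<times> {a..b}" "{u..v} \<times> {b..c}" F] that
      by (auto intro!: closed_subset closed_Times)
  qed
  define R where "R s c d \<longleftrightarrow> (0 \<le> c \<longrightarrow> d \<le> 1 \<longrightarrow>
      (\<exists>e>0. \<forall>a b. 0 \<le> a \<longrightarrow> a \<le> s \<longrightarrow> s \<le> b \<longrightarrow> b \<le> 1 \<longrightarrow> b - a < e \<longrightarrow> liftable S X p F ({a..b} \<times> {c..d})))"
    for s c d :: real
  have small: "\<exists>e>0. \<forall>a b c d. a \<le> s \<and> s \<le> b \<and> c \<le> t \<and> t \<le> d \<and> b - a < e \<and> d - c < e \<and>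
      0 \<le> a \<and> b \<le> 1 \<and> 0 \<le> c \<and> d \<le> 1 \<longrightarrow> liftable S X p F ({a..b} \<times> {c..d})"
    if "0 \<le> s" "s \<le> 1" "0 \<le> t" "t \<le> 1" for s t :: real
  proof -
    have "(s, t) \<in> {0..1} \<times> {0..1}" using that by auto
    then obtain U where U: "open U" "(s, t) \<in> U" "\<And>Z. Z \<subseteq> U \<inter> ({0..1} \<times> {0..1}) \<Longrightarrow> liftable S X p F Z"
      using locally_liftable[OF cov F] by metis
    obtain e where e: "e > 0" "ball (s, t) e \<subseteq> U" using U by (meson openE)
    have "liftable S X p F ({a..b} \<times> {c..d})"
      if "a \<le> s" "s \<le> b" "c \<le> t" "t \<le> d" "b - a < e/2" "d - c < e/2" "0 \<le> a" "b \<le> 1" "0 \<le> c" "d \<le> 1" for a b c d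
    proof (rule U(3), rule subsetI)
      fix z assume z: "z \<in> {a..b} \<times> {c..d}"
      obtain u v where uv: "z = (u, v)" by (cases z)
      have "dist (s, t) (u, v) \<le> \<bar>s - u\<bar> + \<bar>t - v\<bar>"
        unfolding dist_Pair_Pair by (rule order_trans[OF sqrt_sum_squares_le_sum_abs]) (simp add: dist_real_def)
      also have "\<dots> < e" using z that uv by auto
      finally have "z \<in> U" using e uv by auto
      then show "z \<in> U \<inter> ({0..1} \<times> {0..1})" using z that by auto
    qed
    then show ?thesis using e by (intro exI[of _ "e/2"]) auto
  qed
  have R: "R s 0 1" if s: "0 \<le> s" "s \<le> 1" for s
  proof (rule Bolzano)
    fix a b c assume R: "R s a b" "R s b c" and le: "a \<le> b" "b \<le> c"
    show "R s a c" unfolding R_def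
    proof (intro impI)
      assume ac: "0 \<le> a" "c \<le> 1"
      obtain e where e: "e > 0" "\<And>u v. 0 \<le> u \<Longrightarrow> u \<le> s \<Longrightarrow> s \<le> v \<Longrightarrow> v \<le> 1 \<Longrightarrow> v - u < e \<Longrightarrow> liftable S X p F ({u..v} \<times> {a..b})"
        using R(1) ac le unfolding R_def by force
      obtain e' where e': "e' > 0" "\<And>u v. 0 \<le> u \<Longrightarrow> u \<le> s \<Longrightarrow> s \<le> v \<Longrightarrow> v \<le> 1 \<Longrightarrow> v - u < e' \<Longrightarrow> liftable S X p F ({u..v} \<times> {b..c})"
        using R(2) ac le unfolding R_def by force
      show "\<exists>e>0. \<forall>u v. 0 \<le> u \<longrightarrow> u \<le> s \<longrightarrow> s \<le> v \<longrightarrow> v \<le> 1 \<longrightarrow> v - u < e \<longrightarrow> liftable S X p F ({u..v} \<times> {a..c})"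
        using e e' le by (intro exI[of _ "min e e'"]) (auto intro!: join2[of _ _ a b c])
    qed
  next
    fix t :: real assume t: "0 \<le> t" "t \<le> 1"
    obtain e where e: "e > 0" "\<And>a b c d. a \<le> s \<and> s \<le> b \<and> c \<le> t \<and> t \<le> d \<and> b - a < e \<and> d - c < e \<and>
      0 \<le> a \<and> b \<le> 1 \<and> 0 \<le> c \<and> d \<le> 1 \<Longrightarrow> liftable S X p F ({a..b} \<times> {c..d})"
      using small[OF s t] by blast
    have "R s c d" if "c \<le> t" "t \<le> d" "d - c < e" for c d
      unfolding R_def using e that by (intro impI exI[of _ e]) auto
    then show "\<exists>e>0. \<forall>c d. c \<le> t \<and> t \<le> d \<and> d - c < e \<longrightarrow> R s c d" using e(1) by blast
  qed simp
  define Q where "Q a b \<longleftrightarrow> (0 \<le> a \<longrightarrow> b \<le> 1 \<longrightarrow> liftable S X p F ({a..b} \<times> {0..1}))" for a b :: real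
  have "Q 0 1"
  proof (rule Bolzano)
    fix a b c assume "Q a b" "Q b c" "a \<le> b" "b \<le> c"
    then show "Q a c" unfolding Q_def using join1[of a b 0 1 c] by auto
  next
    fix s :: real assume s: "0 \<le> s" "s \<le> 1"
    obtain e where e: "e > 0" "\<And>a b. 0 \<le> a \<Longrightarrow> a \<le> s \<Longrightarrow> s \<le> b \<Longrightarrow> b \<le> 1 \<Longrightarrow> b - a < e \<Longrightarrow> liftable S X p F ({a..b} \<times> {0..1})"
      using R[OF s] unfolding R_def by auto
    then show "\<exists>e>0. \<forall>a b. a \<le> s \<and> s \<le> b \<and> b - a < e \<longrightarrow> Q a b" unfolding Q_def by blast
  qed simp
  then show ?thesis by (simp add: Q_def)
qed

lemma square_lift:
  assumes "covering_map S X p" "continuous_map unit_square X F" "y \<in> topspace S" "p y = F (0, 0)"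
  obtains G where "continuous_map unit_square S G" "G (0, 0) = y"
    "\<And>s t. s \<in> {0..1} \<Longrightarrow> t \<in> {0..1} \<Longrightarrow> p (G (s, t)) = F (s, t)"
  using liftable_unit_square[OF assms(1,2)] assms(3,4) unfolding liftable_def by force

lemma pathin_square_edges:
  assumes "continuous_map unit_square X h"
  shows "c \<in> {0..1} \<Longrightarrow> pathin X (\<lambda>t. h (c, t))" "c \<in> {0..1} \<Longrightarrow> pathin X (\<lambda>t. h (t, c))"
proof -
  assume c: "c \<in> {0..1}"
  have "continuous_map (top_of_set {0..1}) unit_square (\<lambda>t. (c, t))"
    "continuous_map (top_of_set {0..1}) unit_square (\<lambda>t. (t, c))"
    using c by (auto intro!: continuous_intros)
  from this[THEN continuous_map_compose, OF assms]
  show "pathin X (\<lambda>t. h (c, t))" "pathin X (\<lambda>t. h (t, c))" by (simp_all add: pathin_def o_def)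
qed

lemma path_lift:
  assumes cov: "covering_map S X p" and g: "pathin X g" and y: "y \<in> topspace S" "p y = g 0"
  obtains d where "pathin S d" "d 0 = y" "\<And>t. 0 \<le> t \<Longrightarrow> t \<le> 1 \<Longrightarrow> p (d t) = g t"
proof -
  have "continuous_map unit_square (top_of_set {0..1}) snd" by (auto intro!: continuous_intros)
  then have "continuous_map unit_square X (g \<circ> snd)"
    using g unfolding pathin_def by (rule continuous_map_compose)
  then obtain G where G: "continuous_map unit_square S G" "G (0, 0) = y"
    "\<And>s t. s \<in> {0..1} \<Longrightarrow> t \<in> {0..1} \<Longrightarrow> p (G (s, t)) = (g \<circ> snd) (s, t)"
    using y(2) by (auto intro: square_lift[OF cov _ y(1), of "g \<circ> snd"])
  show ?thesis
    using G by (intro that[of "\<lambda>t. G (0, t)"]) (auto intro!: pathin_square_edges)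
qed

lemma unique_path_lift:
  assumes cov: "covering_map S X p" and "pathin S d" "pathin S e" "d 0 = e 0"
    and "\<And>t. 0 \<le> t \<Longrightarrow> t \<le> 1 \<Longrightarrow> p (d t) = p (e t)" and "0 \<le> t" "t \<le> 1"
  shows "d t = e t"
  by (rule unique_lift[OF cov, of "top_of_set {0..1}" d e 0])
     (use assms in \<open>auto simp: pathin_def connected_space_subtopology\<close>)

text \<open>The sides of a lifted homotopy of paths lift constant paths, so they are constant.\<close>

lemma homotopic_paths_in_lift:
  assumes cov: "covering_map S X p" and d: "pathin S d" and e: "pathin S e" and de: "d 0 = e 0"
    and hp: "homotopic_paths_in X (\<lambda>t. p (d t)) (\<lambda>t. p (e t))"
  shows "homotopic_paths_in S d e"
proof -
  obtain h where h: "continuous_map unit_square X h"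
    "\<And>t. t \<in> {0..1} \<Longrightarrow> h (0, t) = p (d t)" "\<And>t. t \<in> {0..1} \<Longrightarrow> h (1, t) = p (e t)"
    "\<And>s. s \<in> {0..1} \<Longrightarrow> h (s, 0) = p (d 0)" "\<And>s. s \<in> {0..1} \<Longrightarrow> h (s, 1) = p (d 1)"
    using hp unfolding homotopic_paths_in_iff by blast
  have d01: "d 0 \<in> topspace S" "d 1 \<in> topspace S" using pathin_topspace[OF d] by auto
  obtain G where G: "continuous_map unit_square S G" "G (0, 0) = d 0"
    "\<And>s t. s \<in> {0..1} \<Longrightarrow> t \<in> {0..1} \<Longrightarrow> p (G (s, t)) = h (s, t)"
    using square_lift[OF cov h(1) d01(1)] h(2)[of 0] by auto
  note G_edges = pathin_square_edges[OF G(1)]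
  have G0: "G (0, t) = d t" if "0 \<le> t" "t \<le> 1" for t
    by (rule unique_path_lift[OF cov _ d]) (use that G G_edges h in auto)
  have Gs0: "G (s, 0) = d 0" if "0 \<le> s" "s \<le> 1" for s
    by (rule unique_path_lift[OF cov, of "\<lambda>s. G (s, 0)" "\<lambda>s. d 0"]) (use that G G_edges h d01 in auto)
  have G1: "G (1, t) = e t" if "0 \<le> t" "t \<le> 1" for t
    by (rule unique_path_lift[OF cov _ e]) (use that G G_edges h Gs0[of 1] de in auto)
  have Gs1: "G (s, 1) = d 1" if "0 \<le> s" "s \<le> 1" for s
    by (rule unique_path_lift[OF cov, of "\<lambda>s. G (s, 1)" "\<lambda>s. d 1"]) (use that G G_edges h d01 G0[of 1] in auto)
  show ?thesis
    unfolding homotopic_paths_in_iff using G G0 Gs0 G1 Gs1 by (intro exI[of _ G]) auto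
qed

section \<open>Consequences of a simply connected cover\<close>

lemma simply_connected_spaceD:
  "simply_connected_space S \<Longrightarrow> pathin S p \<Longrightarrow> p 0 = p 1 \<Longrightarrow> homotopic_paths_in S p (\<lambda>t. p 0)"
  by (simp add: simply_connected_space_def)

lemma homotopic_paths_in_simply_connected:
  assumes "simply_connected_space S" "pathin S p" "pathin S q" "p 0 = q 0" "p 1 = q 1"
  shows "homotopic_paths_in S p q"
proof (rule homotopic_paths_in_if_loop_contractible)
  have "pathin S (join_paths p (\<lambda>t. q (1 - t)))"
    using assms by (intro pathin_join pathin_reverse) auto
  from simply_connected_spaceD[OF assms(1) this]
  show "homotopic_paths_in S (join_paths p (\<lambda>t. q (1 - t))) (\<lambda>t. p 0)"
    using assms(4) by simp
qed (use assms in auto)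

text \<open>Over an evenly covered set parallel paths are carried by a section to parallel paths of the simply
  connected cover; these are homotopic there, and so are their images.\<close>

lemma semilocally_simply_connected:
  assumes cov: "covering_map S X r" and sc: "simply_connected_space S" and x: "x \<in> topspace X"
  obtains T where "openin X T" "x \<in> T"
    "\<And>p q. pathin (subtopology X T) p \<Longrightarrow> pathin (subtopology X T) q \<Longrightarrow> p 0 = q 0 \<Longrightarrow> p 1 = q 1 \<Longrightarrow>
       homotopic_paths_in X p q"
proof -
  obtain T where T: "openin X T" "x \<in> T" and sec: "\<And>y. y \<in> topspace S \<Longrightarrow> r y \<in> T \<Longrightarrow>
       \<exists>s. continuous_map (subtopology X T) S s \<and> s (r y) = y \<and> (\<forall>x\<in>T. r (s x) = x)"
    using covering_map_section[OF cov x] by metis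
  obtain y where "y \<in> topspace S" "r y = x" using x unfolding covering_map_surj[OF cov, symmetric] by blast
  then obtain s where s: "continuous_map (subtopology X T) S s" "\<And>x. x \<in> T \<Longrightarrow> r (s x) = x"
    using sec T by metis
  have "homotopic_paths_in X p q"
    if p: "pathin (subtopology X T) p" and q: "pathin (subtopology X T) q" and "p 0 = q 0" "p 1 = q 1" for p q
  proof -
    have "homotopic_paths_in S (\<lambda>t. s (p t)) (\<lambda>t. s (q t))"
      using homotopic_paths_in_simply_connected[OF sc pathin_compose'[OF s(1) p] pathin_compose'[OF s(1) q]] that
      by simp
    then have *: "homotopic_paths_in X (\<lambda>t. r (s (p t))) (\<lambda>t. r (s (q t)))"
      by (rule homotopic_paths_in_compose[OF covering_map_continuous[OF cov]])
    have "r (s (p t)) = p t" "r (s (q t)) = q t" if "0 \<le> t" "t \<le> 1" for t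
      using s(2) pathin_topspace[OF p that] pathin_topspace[OF q that] by auto
    then have "homotopic_paths_in X (\<lambda>t. r (s (p t))) p" "homotopic_paths_in X (\<lambda>t. r (s (q t))) q"
      using homotopic_paths_in_pathin[OF *] by (auto intro: homotopic_paths_in_eq)
    with * show ?thesis using homotopic_paths_in_sym homotopic_paths_in_trans by blast
  qed
  then show ?thesis using that T by blast
qed

lemma path_connected_space_covering_image:
  assumes cov: "covering_map S X r" and "path_connected_space S"
  shows "path_connected_space X"
  unfolding path_connected_space_def
proof (intro ballI)
  fix x y assume "x \<in> topspace X" "y \<in> topspace X"
  then obtain a b where ab: "a \<in> topspace S" "r a = x" "b \<in> topspace S" "r b = y"
    unfolding covering_map_surj[OF cov, symmetric] by blast
  then obtain g where "pathin S g" "g 0 = a" "g 1 = b"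
    using assms(2) unfolding path_connected_space_def by blast
  then show "\<exists>g. pathin X g \<and> g 0 = x \<and> g 1 = y"
    using ab pathin_compose'[OF covering_map_continuous[OF cov]] by (intro exI[of _ "\<lambda>t. r (g t)"]) auto
qed

section \<open>Morphisms of groupoid coverings\<close>

lemma C_homD:
  assumes "f \<in> C_hom \<Sigma> A B"
  shows "x \<in> carrier A \<Longrightarrow> f x \<in> carrier B"
    and "x \<in> carrier A \<Longrightarrow> y \<in> carrier A \<Longrightarrow> f (x \<otimes>\<^bsub>A\<^esub> y) = f x \<otimes>\<^bsub>B\<^esub> f y"
    and "w \<in> Omega1' \<Sigma> \<Longrightarrow> x \<in> carrier A \<Longrightarrow> f (uop A w x) = uop B w (f x)"
    and "s \<in> Omega2' \<Sigma> \<Longrightarrow> x \<in> carrier A \<Longrightarrow> y \<in> carrier A \<Longrightarrow> f (bop A s x y) = bop B s (f x) (f y)"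
  using assms by (auto simp: C_hom_def hom_def)

lemma C_homI:
  assumes "\<And>x. x \<in> carrier A \<Longrightarrow> f x \<in> carrier B"
    and "\<And>x y. x \<in> carrier A \<Longrightarrow> y \<in> carrier A \<Longrightarrow> f (x \<otimes>\<^bsub>A\<^esub> y) = f x \<otimes>\<^bsub>B\<^esub> f y"
    and "\<And>w x. w \<in> Omega1' \<Sigma> \<Longrightarrow> x \<in> carrier A \<Longrightarrow> f (uop A w x) = uop B w (f x)"
    and "\<And>s x y. s \<in> Omega2' \<Sigma> \<Longrightarrow> x \<in> carrier A \<Longrightarrow> y \<in> carrier A \<Longrightarrow> f (bop A s x y) = bop B s (f x) (f y)"
  shows "f \<in> C_hom \<Sigma> A B"
  using assms by (auto simp: C_hom_def hom_def)

lemma C_objectD: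
  assumes "C_object \<Sigma> A"
  shows "group A"
    and "x \<in> carrier A \<Longrightarrow> y \<in> carrier A \<Longrightarrow> x \<otimes>\<^bsub>A\<^esub> y \<in> carrier A"
    and "w \<in> Omega1' \<Sigma> \<Longrightarrow> x \<in> carrier A \<Longrightarrow> uop A w x \<in> carrier A"
    and "s \<in> Omega2' \<Sigma> \<Longrightarrow> x \<in> carrier A \<Longrightarrow> y \<in> carrier A \<Longrightarrow> bop A s x y \<in> carrier A"
  using assms by (auto simp: C_object_def group.is_monoid monoid.m_closed)

lemma C_hom_compose:
  assumes "C_object \<Sigma> A" "f \<in> C_hom \<Sigma> A B" "g \<in> C_hom \<Sigma> B D"
  shows "compose (carrier A) g f \<in> C_hom \<Sigma> A D"
  using C_objectD[OF assms(1)] C_homD[OF assms(2)] C_homD[OF assms(3)]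
  by (intro C_homI) (simp_all add: compose_eq)

lemma C_hom_id: "C_object \<Sigma> A \<Longrightarrow> (\<lambda>x\<in>carrier A. x) \<in> C_hom \<Sigma> A A"
  by (intro C_homI) (simp_all add: C_objectD)

lemma internal_groupoidD:
  assumes "internal_groupoid \<Sigma> H"
  shows "C_object \<Sigma> (elts H)" "C_object \<Sigma> (objs H)"
    and "d0 H \<in> C_hom \<Sigma> (elts H) (objs H)" "d1 H \<in> C_hom \<Sigma> (elts H) (objs H)"
    and "x \<in> carrier (objs H) \<Longrightarrow> eps H x \<in> carrier (elts H)"
    and "x \<in> carrier (objs H) \<Longrightarrow> d0 H (eps H x) = x" "x \<in> carrier (objs H) \<Longrightarrow> d1 H (eps H x) = x"
    and "a \<in> carrier (elts H) \<Longrightarrow> d0 H a \<in> carrier (objs H)"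
    and "a \<in> carrier (elts H) \<Longrightarrow> d1 H a \<in> carrier (objs H)"
    and "a \<in> carrier (elts H) \<Longrightarrow> b \<in> carrier (elts H) \<Longrightarrow> d1 H a = d0 H b \<Longrightarrow> gcomp H a b \<in> carrier (elts H)"
    and "a \<in> carrier (elts H) \<Longrightarrow> b \<in> carrier (elts H) \<Longrightarrow> d1 H a = d0 H b \<Longrightarrow> d0 H (gcomp H a b) = d0 H a"
    and "a \<in> carrier (elts H) \<Longrightarrow> b \<in> carrier (elts H) \<Longrightarrow> d1 H a = d0 H b \<Longrightarrow> d1 H (gcomp H a b) = d1 H b"
  using assms unfolding internal_groupoid_def is_groupoid_def by auto

lemma covering_morD:
  assumes "(p0, p1) \<in> covering_mor \<Sigma> H G"
  shows "p0 \<in> C_hom \<Sigma> (objs H) (objs G)" "p0 \<in> extensional (carrier (objs H))"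
    and "p1 \<in> C_hom \<Sigma> (elts H) (elts G)" "p1 \<in> extensional (carrier (elts H))"
    and "a \<in> carrier (elts H) \<Longrightarrow> d0 G (p1 a) = p0 (d0 H a)"
    and "a \<in> carrier (elts H) \<Longrightarrow> d1 G (p1 a) = p0 (d1 H a)"
    and "x \<in> carrier (objs H) \<Longrightarrow> p1 (eps H x) = eps G (p0 x)"
    and "a \<in> carrier (elts H) \<Longrightarrow> b \<in> carrier (elts H) \<Longrightarrow> d1 H a = d0 H b \<Longrightarrow>
      p1 (gcomp H a b) = gcomp G (p1 a) (p1 b)"
    and "x \<in> carrier (objs H) \<Longrightarrow> bij_betw p1 (gstar H x) (gstar G (p0 x))"
  using assms unfolding covering_mor_def internal_groupoid_mor_def by auto

lemma covering_morI:
  assumes "p0 \<in> C_hom \<Sigma> (objs H) (objs G)" "p0 \<in> extensional (carrier (objs H))"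
    and "p1 \<in> C_hom \<Sigma> (elts H) (elts G)" "p1 \<in> extensional (carrier (elts H))"
    and "\<And>a. a \<in> carrier (elts H) \<Longrightarrow> d0 G (p1 a) = p0 (d0 H a)"
    and "\<And>a. a \<in> carrier (elts H) \<Longrightarrow> d1 G (p1 a) = p0 (d1 H a)"
    and "\<And>x. x \<in> carrier (objs H) \<Longrightarrow> p1 (eps H x) = eps G (p0 x)"
    and "\<And>a b. a \<in> carrier (elts H) \<Longrightarrow> b \<in> carrier (elts H) \<Longrightarrow> d1 H a = d0 H b \<Longrightarrow>
      p1 (gcomp H a b) = gcomp G (p1 a) (p1 b)"
    and "\<And>x. x \<in> carrier (objs H) \<Longrightarrow> bij_betw p1 (gstar H x) (gstar G (p0 x))"
  shows "(p0, p1) \<in> covering_mor \<Sigma> H G"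
  using assms unfolding covering_mor_def internal_groupoid_mor_def by auto

lemma covering_mor_star_inj:
  assumes "internal_groupoid \<Sigma> H" "(p0, p1) \<in> covering_mor \<Sigma> H G"
    and "a \<in> carrier (elts H)" "b \<in> carrier (elts H)" "d0 H a = d0 H b" "p1 a = p1 b"
  shows "a = b"
  using covering_morD(9)[OF assms(2) internal_groupoidD(8)[OF assms(1,3)]] assms(3-)
  by (auto simp: bij_betw_def gstar_def dest!: inj_onD)

lemma covering_mor_star_lift:
  assumes "(p0, p1) \<in> covering_mor \<Sigma> H G"
    and "y \<in> carrier (objs H)" "c \<in> carrier (elts G)" "d0 G c = p0 y"
  obtains a where "a \<in> carrier (elts H)" "d0 H a = y" "p1 a = c"
proof -
  have "c \<in> p1 ` gstar H y"
    using covering_morD(9)[OF assms(1,2)] assms(3,4) by (auto simp: bij_betw_def gstar_def)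
  then show ?thesis using that by (auto simp: gstar_def)
qed

lemma covering_mor_id:
  assumes "internal_groupoid \<Sigma> H"
  shows "(\<lambda>x\<in>carrier (objs H). x, \<lambda>a\<in>carrier (elts H). a) \<in> covering_mor \<Sigma> H H"
proof (rule covering_morI)
  fix x assume x: "x \<in> carrier (objs H)"
  have "bij_betw id (gstar H x) (gstar H x)" by simp
  then have "bij_betw (\<lambda>a\<in>carrier (elts H). a) (gstar H x) (gstar H x)"
    by (rule bij_betw_cong[THEN iffD1, rotated]) (auto simp: gstar_def)
  then show "bij_betw (\<lambda>a\<in>carrier (elts H). a) (gstar H x) (gstar H ((\<lambda>x\<in>carrier (objs H). x) x))"
    using x by simp
qed (use internal_groupoidD[OF assms] in \<open>simp_all add: C_hom_id\<close>)

lemma covering_mor_compose: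
  assumes H: "internal_groupoid \<Sigma> H" and f: "(f0, f1) \<in> covering_mor \<Sigma> H K" and g: "(g0, g1) \<in> covering_mor \<Sigma> K L"
  shows "(compose (carrier (objs H)) g0 f0, compose (carrier (elts H)) g1 f1) \<in> covering_mor \<Sigma> H L"
proof (rule covering_morI)
  note D = internal_groupoidD[OF H]
  note f' = covering_morD[OF f] and g' = covering_morD[OF g]
  note f0 = C_homD(1)[OF f'(1)] and f1 = C_homD(1)[OF f'(3)]
  show "compose (carrier (objs H)) g0 f0 \<in> C_hom \<Sigma> (objs H) (objs L)"
    using D(2) f'(1) g'(1) by (rule C_hom_compose)
  show "compose (carrier (elts H)) g1 f1 \<in> C_hom \<Sigma> (elts H) (elts L)"
    using D(1) f'(3) g'(3) by (rule C_hom_compose)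
  fix x assume x: "x \<in> carrier (objs H)"
  have "bij_betw (g1 \<circ> f1) (gstar H x) (gstar L (g0 (f0 x)))"
    using f'(9)[OF x] g'(9)[OF f0[OF x]] by (rule bij_betw_trans)
  then have "bij_betw (compose (carrier (elts H)) g1 f1) (gstar H x) (gstar L (g0 (f0 x)))"
    by (rule bij_betw_cong[THEN iffD1, rotated]) (auto simp: gstar_def compose_eq)
  then show "bij_betw (compose (carrier (elts H)) g1 f1) (gstar H x) (gstar L (compose (carrier (objs H)) g0 f0 x))"
    using x by (simp add: compose_eq)
next
  note D = internal_groupoidD[OF H]
  note f' = covering_morD[OF f] and g' = covering_morD[OF g]
  note f0 = C_homD(1)[OF f'(1)] and f1 = C_homD(1)[OF f'(3)]
  fix a b assume a: "a \<in> carrier (elts H)" and b: "b \<in> carrier (elts H)" and ab: "d1 H a = d0 H b"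
  have "d1 K (f1 a) = d0 K (f1 b)" using a b ab f' by simp
  then show "compose (carrier (elts H)) g1 f1 (gcomp H a b)
      = gcomp L (compose (carrier (elts H)) g1 f1 a) (compose (carrier (elts H)) g1 f1 b)"
    using a b ab D(10) f'(8) g'(8) f1 by (simp add: compose_eq)
qed (use internal_groupoidD[OF H] covering_morD[OF f] covering_morD[OF g]
      C_homD(1)[OF covering_morD(1)[OF f]] C_homD(1)[OF covering_morD(3)[OF f]] in \<open>simp_all add: compose_eq\<close>)

text \<open>An element of a covering groupoid is determined by its source and its image, so a morphism
  over the base is determined by its object map.\<close>

lemma covering_mor_eqI:
  assumes H: "internal_groupoid \<Sigma> H" and K: "internal_groupoid \<Sigma> K" and q: "(q0, q1) \<in> covering_mor \<Sigma> K G"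
    and f: "(f0, f1) \<in> covering_mor \<Sigma> H K" and g: "(f0, g1) \<in> covering_mor \<Sigma> H K"
    and eq: "\<And>a. a \<in> carrier (elts H) \<Longrightarrow> q1 (f1 a) = q1 (g1 a)"
  shows "f1 = g1"
proof (rule extensionalityI)
  fix a assume a: "a \<in> carrier (elts H)"
  show "f1 a = g1 a"
    using covering_morD[OF f] covering_morD[OF g] a eq
    by (intro covering_mor_star_inj[OF K q]) (auto intro: C_homD)
qed (use covering_morD[OF f] covering_morD[OF g] in auto)

text \<open>Unique lifting makes the elementwise choice of lifts compatible with all the structure: the two
  sides of each equation to be checked have the same source and the same image in the base.\<close>

lemma covering_mor_extend:
  assumes H: "internal_groupoid \<Sigma> H" and K: "internal_groupoid \<Sigma> K"
    and p: "(p0, p1) \<in> covering_mor \<Sigma> H G" and q: "(q0, q1) \<in> covering_mor \<Sigma> K G"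
    and f0: "f0 \<in> C_hom \<Sigma> (objs H) (objs K)" "f0 \<in> extensional (carrier (objs H))"
    and qf: "\<And>x. x \<in> carrier (objs H) \<Longrightarrow> q0 (f0 x) = p0 x"
    and lifts: "\<And>a. a \<in> carrier (elts H) \<Longrightarrow>
      \<exists>b\<in>carrier (elts K). d0 K b = f0 (d0 H a) \<and> d1 K b = f0 (d1 H a) \<and> q1 b = p1 a"
  obtains f1 where "(f0, f1) \<in> covering_mor \<Sigma> H K" "\<And>a. a \<in> carrier (elts H) \<Longrightarrow> q1 (f1 a) = p1 a"
proof -
  define f1 where "f1 = (\<lambda>a\<in>carrier (elts H). SOME b. b \<in> carrier (elts K) \<and>
      d0 K b = f0 (d0 H a) \<and> d1 K b = f0 (d1 H a) \<and> q1 b = p1 a)"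
  have f1: "f1 a \<in> carrier (elts K) \<and> d0 K (f1 a) = f0 (d0 H a) \<and> d1 K (f1 a) = f0 (d1 H a) \<and> q1 (f1 a) = p1 a"
    if a: "a \<in> carrier (elts H)" for a
  proof -
    have "f1 a = (SOME b. b \<in> carrier (elts K) \<and>
      d0 K b = f0 (d0 H a) \<and> d1 K b = f0 (d1 H a) \<and> q1 b = p1 a)" using a by (simp add: f1_def)
    then show ?thesis using lifts[OF a] by (metis (mono_tags, lifting) someI_ex)
  qed
  have f1_eq: "f1 a = b"
    if "a \<in> carrier (elts H)" "b \<in> carrier (elts K)" "d0 K b = f0 (d0 H a)" "q1 b = p1 a" for a b
    using that f1 by (intro covering_mor_star_inj[OF K q]) auto
  note HD = internal_groupoidD[OF H] and KD = internal_groupoidD[OF K]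
  note p' = covering_morD[OF p] and q' = covering_morD[OF q]
  note HE = C_objectD[OF HD(1)] and KE = C_objectD[OF KD(1)]
  note d0H = C_homD[OF HD(3)] and d0K = C_homD[OF KD(3)]
  note p1 = C_homD[OF p'(3)] and q1 = C_homD[OF q'(3)] and f0h = C_homD[OF f0(1)]
  have "(f0, f1) \<in> covering_mor \<Sigma> H K"
  proof (rule covering_morI)
    show "f1 \<in> extensional (carrier (elts H))" by (simp add: f1_def)
    show "f1 \<in> C_hom \<Sigma> (elts H) (elts K)"
    proof (rule C_homI)
      fix a b assume ab: "a \<in> carrier (elts H)" "b \<in> carrier (elts H)"
      show "f1 (a \<otimes>\<^bsub>elts H\<^esub> b) = f1 a \<otimes>\<^bsub>elts K\<^esub> f1 b"
        by (rule f1_eq) (use ab f1 HE KE d0H d0K p1 q1 f0h in simp_all)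
      fix s assume s: "s \<in> Omega2' \<Sigma>"
      show "f1 (bop (elts H) s a b) = bop (elts K) s (f1 a) (f1 b)"
        by (rule f1_eq) (use s ab f1 HE KE d0H d0K p1 q1 f0h in simp_all)
    next
      fix w a assume w: "w \<in> Omega1' \<Sigma>" "a \<in> carrier (elts H)"
      show "f1 (uop (elts H) w a) = uop (elts K) w (f1 a)"
        by (rule f1_eq) (use w f1 HE KE d0H d0K p1 q1 f0h in simp_all)
    qed (use f1 in auto)
    fix x assume x: "x \<in> carrier (objs H)"
    show "f1 (eps H x) = eps K (f0 x)"
      by (rule f1_eq) (use x HD KD f0h p' q' qf in simp_all)
    show "bij_betw f1 (gstar H x) (gstar K (f0 x))"
    proof (rule bij_betwI')
      fix a b assume ab: "a \<in> gstar H x" "b \<in> gstar H x"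
      show "(f1 a = f1 b) = (a = b)"
      proof
        assume "f1 a = f1 b"
        then have "p1 a = p1 b" using f1 ab by (auto simp: gstar_def) metis
        then show "a = b" using ab by (intro covering_mor_star_inj[OF H p]) (auto simp: gstar_def)
      qed simp
    next
      fix a assume "a \<in> gstar H x" then show "f1 a \<in> gstar K (f0 x)" using f1 by (auto simp: gstar_def)
    next
      fix b assume "b \<in> gstar K (f0 x)"
      then have b: "b \<in> carrier (elts K)" "d0 K b = f0 x" by (auto simp: gstar_def)
      have "q1 b \<in> carrier (elts G)" "d0 G (q1 b) = p0 x" using b x q1 q' qf by auto
      then obtain a where a: "a \<in> carrier (elts H)" "d0 H a = x" "p1 a = q1 b"
        by (rule covering_mor_star_lift[OF p x])
      have "f1 a = b" by (rule f1_eq) (use a b in simp_all)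
      then show "\<exists>a\<in>gstar H x. b = f1 a" using a by (auto simp: gstar_def)
    qed
  next
    fix a b assume ab: "a \<in> carrier (elts H)" "b \<in> carrier (elts H)" "d1 H a = d0 H b"
    have "d1 K (f1 a) = d0 K (f1 b)" using ab f1 by simp
    then show "f1 (gcomp H a b) = gcomp K (f1 a) (f1 b)"
      by (intro f1_eq) (use ab HD KD f1 p' q' in simp_all)
  qed (use f0 f1 in auto)
  then show ?thesis using that f1 by blast
qed

section \<open>The two categories of coverings\<close>

lemma compose_id_right: "f \<in> extensional A \<Longrightarrow> compose A f (\<lambda>x\<in>A. x) = f"
  by (auto simp: fun_eq_iff compose_def extensional_def)

lemma compose_id_left:
  "f \<in> extensional A \<Longrightarrow> (\<And>x. x \<in> A \<Longrightarrow> f x \<in> B) \<Longrightarrow> compose A (\<lambda>x\<in>B. x) f = f"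
  by (auto simp: fun_eq_iff compose_def extensional_def)

lemma compose_assoc':
  "(\<And>x. x \<in> A \<Longrightarrow> f x \<in> B) \<Longrightarrow> compose A h (compose A g f) = compose A (compose B h g) f"
  by (auto simp: fun_eq_iff compose_def)

lemma TC_morD:
  assumes "f \<in> TC_mor \<Sigma> Y Z"
  shows "f \<in> C_hom \<Sigma> Y Z" "continuous_map (topo Y) (topo Z) f" "f \<in> extensional (carrier Y)"
  using assms by (auto simp: TC_mor_def)

lemma is_category_Cov_TC:
  fixes \<Sigma> :: "('w, 'b) op_presentation" and X :: "('a, 'w, 'b) tgwo"
  shows "is_category (Cov_TC \<Sigma> X :: (('u, 'w, 'b) tgwo \<times> ('u \<Rightarrow> 'a), 'u \<Rightarrow> 'u) cat)"
proof -
  have id: "(\<lambda>y\<in>carrier Y. y) \<in> TC_mor \<Sigma> Y Y" if "TC_object \<Sigma> Y" for Y :: "('u, 'w, 'b) tgwo"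
  proof -
    have "continuous_map (topo Y) (topo Y) (\<lambda>y\<in>carrier Y. y)"
      by (rule continuous_map_eq[OF continuous_map_id]) (simp add: TC_object_topspace[OF that])
    then show ?thesis using that by (auto simp: TC_mor_def TC_object_def C_hom_id)
  qed
  have comp: "compose (carrier Y) g f \<in> TC_mor \<Sigma> Y W"
    if "TC_object \<Sigma> Y" "f \<in> TC_mor \<Sigma> Y Z" "g \<in> TC_mor \<Sigma> Z W" for Y Z W :: "('u, 'w, 'b) tgwo" and f g
  proof -
    have "continuous_map (topo Y) (topo W) (compose (carrier Y) g f)"
      using continuous_map_compose[OF TC_morD(2)[OF that(2)] TC_morD(2)[OF that(3)]]
      by (rule continuous_map_eq) (simp add: TC_object_topspace[OF that(1)] compose_eq)
    moreover have "C_object \<Sigma> Y" using that(1) by (simp add: TC_object_def)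
    ultimately show ?thesis
      using C_hom_compose[OF _ TC_morD(1)[OF that(2)] TC_morD(1)[OF that(3)]] by (auto simp: TC_mor_def)
  qed
  show ?thesis
    unfolding is_category_def Cov_TC_def
    by (auto simp: id comp compose_eq C_homD(1)[OF TC_morD(1)]
        intro!: compose_id_right compose_id_left compose_assoc' TC_morD(3) intro: C_homD(1)[OF TC_morD(1)])
qed

lemma Cov_CatD:
  assumes "(H, p) \<in> Ob (Cov_Cat \<Sigma> G)"
  shows "internal_groupoid \<Sigma> H" "internal_groupoid \<Sigma> G" "p \<in> covering_mor \<Sigma> H G"
  using assms by (auto simp: Cov_Cat_def)

lemma is_category_Cov_Cat: "is_category (Cov_Cat \<Sigma> G)"
  unfolding is_category_def
proof (intro conjI ballI, goal_cases)
  case (1 A)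
  then show ?case using covering_mor_id by (auto simp: Cov_Cat_def)
next
  case (2 A B D f g)
  then show ?case
    by (cases A, cases B, cases D, cases f, cases g)
       (auto simp: Cov_Cat_def compose_eq intro!: covering_mor_compose
         dest: C_homD(1)[OF covering_morD(1)] C_homD(1)[OF covering_morD(3)])
next
  case (3 A B f)
  then show ?case
    by (cases A, cases B, cases f)
       (auto simp: Cov_Cat_def intro!: compose_id_right dest: covering_morD(2,4))
next
  case (4 A B f)
  then show ?case
    by (cases A, cases B, cases f)
       (auto simp: Cov_Cat_def intro!: compose_id_left dest: covering_morD(2,4)
         C_homD(1)[OF covering_morD(1)] C_homD(1)[OF covering_morD(3)])
next
  case (5 A B D E f g h)
  then show ?case
    by (cases A, cases B, cases D, cases E, cases f, cases g, cases h)
       (auto simp: Cov_Cat_def intro!: compose_assoc'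
         dest: C_homD(1)[OF covering_morD(1)] C_homD(1)[OF covering_morD(3)])
qed

section \<open>The transport topology\<close>

text \<open>A groupoid covering of the fundamental groupoid determines a topology on its objects: a set is
  open if transport along sufficiently small paths of \<open>X\<close> does not leave it. No choice of a good base
  of \<open>X\<close> enters the definition, so that its naturality is immediate; such a base is needed only to
  see that the projection is a covering map.\<close>

locale path_class_covering =
  fixes \<Sigma> :: "('w, 'b) op_presentation" and X :: "('a, 'w, 'b) tgwo"
    and H :: "('e, 'o, 'w, 'b) igpd" and p0 p1
  assumes X: "TC_object \<Sigma> X" and H: "internal_groupoid \<Sigma> H"
    and p: "(p0, p1) \<in> covering_mor \<Sigma> H (fundamental_groupoid X)"
begin

definition transport_open :: "'o set \<Rightarrow> bool" where
  "transport_open W \<longleftrightarrow> W \<subseteq> carrier (objs H) \<and> (\<forall>y\<in>W. \<exists>U. openin (topo X) U \<and> p0 y \<in> U \<and>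
     (\<forall>a\<in>gstar H y. \<forall>g. pathin (subtopology (topo X) U) g \<longrightarrow> p1 a = path_class (topo X) g \<longrightarrow> d1 H a \<in> W))"

definition transport_topology :: "'o topology" where
  "transport_topology = topology transport_open"

lemma p0_carrier: "y \<in> carrier (objs H) \<Longrightarrow> p0 y \<in> carrier X"
  using C_homD(1)[OF covering_morD(1)[OF p]] by simp

lemma p0_topspace: "y \<in> carrier (objs H) \<Longrightarrow> p0 y \<in> topspace (topo X)"
  using p0_carrier TC_object_topspace[OF X] by simp

lemma transport_openE:
  assumes "transport_open W" "y \<in> W"
  obtains U where "openin (topo X) U" "p0 y \<in> U"
    "\<And>a g. a \<in> gstar H y \<Longrightarrow> pathin (subtopology (topo X) U) g \<Longrightarrow> p1 a = path_class (topo X) g \<Longrightarrow> d1 H a \<in> W"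
proof -
  have "\<exists>U. openin (topo X) U \<and> p0 y \<in> U \<and>
     (\<forall>a\<in>gstar H y. \<forall>g. pathin (subtopology (topo X) U) g \<longrightarrow> p1 a = path_class (topo X) g \<longrightarrow> d1 H a \<in> W)"
    using assms by (simp add: transport_open_def)
  then obtain U where U: "openin (topo X) U \<and> p0 y \<in> U \<and>
     (\<forall>a\<in>gstar H y. \<forall>g. pathin (subtopology (topo X) U) g \<longrightarrow> p1 a = path_class (topo X) g \<longrightarrow> d1 H a \<in> W)" ..
  show ?thesis by (rule that[of U]) (use U in simp_all)
qed

lemma transport_openI:
  assumes "W \<subseteq> carrier (objs H)"
    and "\<And>y. y \<in> W \<Longrightarrow> \<exists>U. openin (topo X) U \<and> p0 y \<in> U \<and> (\<forall>a g. a \<in> gstar H y \<longrightarrow>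
      pathin (subtopology (topo X) U) g \<longrightarrow> p1 a = path_class (topo X) g \<longrightarrow> d1 H a \<in> W)"
  shows "transport_open W"
  using assms by (simp add: transport_open_def Ball_def)

lemma openin_transport [simp]: "openin transport_topology W \<longleftrightarrow> transport_open W"
proof -
  have "istopology transport_open"
    unfolding istopology_def
  proof (intro conjI allI impI)
    fix S T assume S: "transport_open S" and T: "transport_open T"
    show "transport_open (S \<inter> T)"
    proof (rule transport_openI)
      fix y assume y: "y \<in> S \<inter> T"
      obtain U where U: "openin (topo X) U" "p0 y \<in> U" "\<And>a g. a \<in> gstar H y \<Longrightarrow>
          pathin (subtopology (topo X) U) g \<Longrightarrow> p1 a = path_class (topo X) g \<Longrightarrow> d1 H a \<in> S"
        using y by (auto intro: transport_openE[OF S])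
      obtain V where V: "openin (topo X) V" "p0 y \<in> V" "\<And>a g. a \<in> gstar H y \<Longrightarrow>
          pathin (subtopology (topo X) V) g \<Longrightarrow> p1 a = path_class (topo X) g \<Longrightarrow> d1 H a \<in> T"
        using y by (auto intro: transport_openE[OF T])
      show "\<exists>U. openin (topo X) U \<and> p0 y \<in> U \<and> (\<forall>a g. a \<in> gstar H y \<longrightarrow> pathin (subtopology (topo X) U) g \<longrightarrow>
          p1 a = path_class (topo X) g \<longrightarrow> d1 H a \<in> S \<inter> T)"
      proof (intro exI conjI allI impI)
        fix a g assume a: "a \<in> gstar H y" and g: "pathin (subtopology (topo X) (U \<inter> V)) g" "p1 a = path_class (topo X) g"
        have "pathin (subtopology (topo X) U) g" "pathin (subtopology (topo X) V) g"
          using g(1) by (auto simp: pathin_subtopology)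
        then show "d1 H a \<in> S \<inter> T" using U(3)[OF a _ g(2)] V(3)[OF a _ g(2)] by blast
      qed (use U V in auto)
    qed (use S in \<open>auto simp: transport_open_def\<close>)
  next
    fix \<K> assume *: "\<forall>K\<in>\<K>. transport_open K"
    show "transport_open (\<Union>\<K>)"
    proof (rule transport_openI)
      show "\<Union>\<K> \<subseteq> carrier (objs H)" using * by (auto simp: transport_open_def)
      fix y assume "y \<in> \<Union>\<K>"
      then obtain K where K: "K \<in> \<K>" "y \<in> K" by blast
      then have "transport_open K" using * by blast
      then obtain U where U: "openin (topo X) U" "p0 y \<in> U" "\<And>a g. a \<in> gstar H y \<Longrightarrow>
          pathin (subtopology (topo X) U) g \<Longrightarrow> p1 a = path_class (topo X) g \<Longrightarrow> d1 H a \<in> K"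
        using K(2) by (auto intro: transport_openE)
      then show "\<exists>U. openin (topo X) U \<and> p0 y \<in> U \<and> (\<forall>a g. a \<in> gstar H y \<longrightarrow>
          pathin (subtopology (topo X) U) g \<longrightarrow> p1 a = path_class (topo X) g \<longrightarrow> d1 H a \<in> \<Union>\<K>)"
        using K(1) by (intro exI[of _ U]) auto
    qed
  qed
  then show ?thesis by (simp add: transport_topology_def)
qed

lemma transport_open_carrier: "transport_open (carrier (objs H))"
  unfolding transport_open_def
proof (intro conjI ballI)
  fix y assume "y \<in> carrier (objs H)"
  then show "\<exists>U. openin (topo X) U \<and> p0 y \<in> U \<and> (\<forall>a\<in>gstar H y. \<forall>g. pathin (subtopology (topo X) U) g \<longrightarrow>
      p1 a = path_class (topo X) g \<longrightarrow> d1 H a \<in> carrier (objs H))"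
    using p0_topspace internal_groupoidD(9)[OF H] by (intro exI[of _ "topspace (topo X)"]) (auto simp: gstar_def)
qed simp

lemma topspace_transport [simp]: "topspace transport_topology = carrier (objs H)"
proof
  show "topspace transport_topology \<subseteq> carrier (objs H)"
    using openin_topspace[of transport_topology] unfolding openin_transport transport_open_def by blast
  show "carrier (objs H) \<subseteq> topspace transport_topology"
    using openin_subset[of transport_topology] transport_open_carrier by simp
qed

end

text \<open>The topology is defined by lifts of path classes alone, and morphisms over the base preserve
  lifts.\<close>

lemma continuous_map_transport:
  assumes "path_class_covering \<Sigma> X H p0 p1" "path_class_covering \<Sigma> X K q0 q1"
    and f: "(f0, f1) \<in> covering_mor \<Sigma> H K"
    and qf0: "\<And>x. x \<in> carrier (objs H) \<Longrightarrow> q0 (f0 x) = p0 x"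
    and qf1: "\<And>a. a \<in> carrier (elts H) \<Longrightarrow> q1 (f1 a) = p1 a"
  shows "continuous_map (path_class_covering.transport_topology X H p0 p1)
    (path_class_covering.transport_topology X K q0 q1) f0"
proof -
  interpret H: path_class_covering \<Sigma> X H p0 p1 by fact
  interpret K: path_class_covering \<Sigma> X K q0 q1 by fact
  note f' = covering_morD[OF f]
  have "H.transport_open {y \<in> carrier (objs H). f0 y \<in> W}" if W: "K.transport_open W" for W
  proof (rule H.transport_openI)
    fix y assume "y \<in> {y \<in> carrier (objs H). f0 y \<in> W}"
    then have y: "y \<in> carrier (objs H)" "f0 y \<in> W" by auto
    obtain U where U: "openin (topo X) U" "q0 (f0 y) \<in> U" "\<And>a g. a \<in> gstar K (f0 y) \<Longrightarrow>
        pathin (subtopology (topo X) U) g \<Longrightarrow> q1 a = path_class (topo X) g \<Longrightarrow> d1 K a \<in> W"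
      using y(2) by (auto intro: K.transport_openE[OF W])
    have "d1 H a \<in> {y \<in> carrier (objs H). f0 y \<in> W}"
      if a: "a \<in> gstar H y" and g: "pathin (subtopology (topo X) U) g" "p1 a = path_class (topo X) g" for a g
    proof -
      have "f1 a \<in> gstar K (f0 y)" using a f'(5) C_homD(1)[OF f'(3)] by (auto simp: gstar_def)
      then have "d1 K (f1 a) \<in> W" using g a qf1 by (intro U(3)) (auto simp: gstar_def)
      then show ?thesis using a f'(6) internal_groupoidD(9)[OF H.H] by (auto simp: gstar_def)
    qed
    moreover have "p0 y \<in> U" using U(2) qf0[OF y(1)] by simp
    ultimately show "\<exists>U. openin (topo X) U \<and> p0 y \<in> U \<and> (\<forall>a g. a \<in> gstar H y \<longrightarrow>
        pathin (subtopology (topo X) U) g \<longrightarrow> p1 a = path_class (topo X) g \<longrightarrow> d1 H a \<in> {y \<in> carrier (objs H). f0 y \<in> W})"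
      using U(1) by (intro exI[of _ U]) simp
  qed auto
  then show ?thesis
    using C_homD(1)[OF f'(1)] by (auto simp: continuous_map_def)
qed

section \<open>From topological coverings to groupoid coverings\<close>

definition path_class_map :: "('u, 'w, 'b) tgwo \<Rightarrow> ('a, 'w, 'b) tgwo \<Rightarrow> ('u \<Rightarrow> 'a) \<Rightarrow> (real \<Rightarrow> 'u) set \<Rightarrow> (real \<Rightarrow> 'a) set" where
  "path_class_map Y X p = (\<lambda>c\<in>carrier (path_algebra Y). \<Union>g\<in>c. path_class (topo X) (\<lambda>t. p (g t)))"

lemma path_class_map:
  assumes "continuous_map (topo Y) (topo X) p" "pathin (topo Y) g"
  shows "path_class_map Y X p (path_class (topo Y) g) = path_class (topo X) (\<lambda>t. p (g t))"
  using UN_path_class[OF assms(2), of "\<lambda>g. path_class (topo X) (\<lambda>t. p (g t))"]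
    path_class_eqI[OF homotopic_paths_in_compose[OF assms(1)], symmetric] assms(2)
  by (simp add: path_class_map_def path_algebra_carrierI)

text \<open>Bijectivity on stars is unique lifting: surjectivity by lifting paths, injectivity by lifting
  homotopies.\<close>

lemma covering_mor_path_class_map:
  assumes X: "TC_object \<Sigma> X" and Y: "TC_object \<Sigma> Y"
    and p: "p \<in> TC_mor \<Sigma> Y X" and cov: "covering_map (topo Y) (topo X) p"
  shows "(p, path_class_map Y X p) \<in> covering_mor \<Sigma> (fundamental_groupoid Y) (fundamental_groupoid X)"
proof (rule covering_morI)
  note hom = C_homD[OF TC_morD(1)[OF p]] and cont = TC_morD(2)[OF p]
  note map = path_class_map[OF cont] and pp = pathin_compose'[OF cont]
  note opsY = path_algebra_mult[OF Y] path_algebra_uop[OF Y] path_algebra_bop[OF Y]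
  note opsX = path_algebra_mult[OF X] path_algebra_uop[OF X] path_algebra_bop[OF X]
  show "p \<in> C_hom \<Sigma> (objs (fundamental_groupoid Y)) (objs (fundamental_groupoid X))"
    by (intro C_homI) (simp_all add: hom)
  show "p \<in> extensional (carrier (objs (fundamental_groupoid Y)))" using TC_morD(3)[OF p] by simp
  show "path_class_map Y X p \<in> extensional (carrier (elts (fundamental_groupoid Y)))"
    by (simp add: path_class_map_def)
  show "path_class_map Y X p \<in> C_hom \<Sigma> (elts (fundamental_groupoid Y)) (elts (fundamental_groupoid X))"
    unfolding fundamental_groupoid_sel
  proof (rule C_homI)
    fix a assume "a \<in> carrier (path_algebra Y)"
    then obtain g where g: "pathin (topo Y) g" "a = path_class (topo Y) g" by (rule path_algebra_carrierE)
    show "path_class_map Y X p a \<in> carrier (path_algebra X)"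
      using g by (simp add: map path_algebra_carrierI pp)
    show "path_class_map Y X p (uop (path_algebra Y) w a) = uop (path_algebra X) w (path_class_map Y X p a)"
      if "w \<in> Omega1' \<Sigma>" for w
      using g that pathin_carrier[OF Y g(1)]
      by (simp add: map opsY opsX pp) (intro path_class_cong pp opsY; simp add: hom)
    fix b assume "b \<in> carrier (path_algebra Y)"
    then obtain h where h: "pathin (topo Y) h" "b = path_class (topo Y) h" by (rule path_algebra_carrierE)
    show "path_class_map Y X p (a \<otimes>\<^bsub>path_algebra Y\<^esub> b) = path_class_map Y X p a \<otimes>\<^bsub>path_algebra X\<^esub> path_class_map Y X p b"
      using g h pathin_carrier[OF Y g(1)] pathin_carrier[OF Y h(1)]
      by (simp add: map opsY opsX pp) (intro path_class_cong pp opsY; simp add: hom)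
    show "path_class_map Y X p (bop (path_algebra Y) s a b)
        = bop (path_algebra X) s (path_class_map Y X p a) (path_class_map Y X p b)"
      if "s \<in> Omega2' \<Sigma>" for s
      using g h that pathin_carrier[OF Y g(1)] pathin_carrier[OF Y h(1)]
      by (simp add: map opsY opsX pp) (intro path_class_cong pp opsY; simp add: hom)
  qed
next
  note hom = C_homD[OF TC_morD(1)[OF p]] and cont = TC_morD(2)[OF p]
  note map = path_class_map[OF cont] and pp = pathin_compose'[OF cont]
  fix a assume "a \<in> carrier (elts (fundamental_groupoid Y))"
  then obtain g where g: "pathin (topo Y) g" "a = path_class (topo Y) g"
    by (auto elim: path_algebra_carrierE)
  show "d0 (fundamental_groupoid X) (path_class_map Y X p a) = p (d0 (fundamental_groupoid Y) a)"
    "d1 (fundamental_groupoid X) (path_class_map Y X p a) = p (d1 (fundamental_groupoid Y) a)"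
    using g by (simp_all add: map path_class_ends pp)
  fix b assume "b \<in> carrier (elts (fundamental_groupoid Y))"
    and ab: "d1 (fundamental_groupoid Y) a = d0 (fundamental_groupoid Y) b"
  then obtain h where h: "pathin (topo Y) h" "b = path_class (topo Y) h"
    by (auto elim: path_algebra_carrierE)
  have gh: "g 1 = h 0" using ab g h by (simp add: path_class_ends)
  have "(\<lambda>t. p (join_paths g h t)) = join_paths (\<lambda>t. p (g t)) (\<lambda>t. p (h t))"
    by (simp add: join_paths_def fun_eq_iff)
  then show "path_class_map Y X p (gcomp (fundamental_groupoid Y) a b)
      = gcomp (fundamental_groupoid X) (path_class_map Y X p a) (path_class_map Y X p b)"
    using g h gh by (simp add: map gcomp_path_class pathin_join pp)
next
  note hom = C_homD[OF TC_morD(1)[OF p]] and cont = TC_morD(2)[OF p]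
  note map = path_class_map[OF cont] and pp = pathin_compose'[OF cont]
  fix x assume "x \<in> carrier (objs (fundamental_groupoid Y))"
  then have x: "x \<in> carrier Y" by simp
  then show "path_class_map Y X p (eps (fundamental_groupoid Y) x) = eps (fundamental_groupoid X) (p x)"
    using map[OF pathin_const_carrier[OF Y x]] by simp
  show "bij_betw (path_class_map Y X p) (gstar (fundamental_groupoid Y) x) (gstar (fundamental_groupoid X) (p x))"
  proof (rule bij_betwI')
    fix a b assume ab: "a \<in> gstar (fundamental_groupoid Y) x" "b \<in> gstar (fundamental_groupoid Y) x"
    obtain g where g: "pathin (topo Y) g" "a = path_class (topo Y) g"
      using ab by (auto simp: gstar_def elim: path_algebra_carrierE)
    obtain h where h: "pathin (topo Y) h" "b = path_class (topo Y) h"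
      using ab by (auto simp: gstar_def elim: path_algebra_carrierE)
    have gh: "g 0 = h 0" using ab g h by (simp add: gstar_def path_class_ends)
    have "a = b" if "path_class_map Y X p a = path_class_map Y X p b"
    proof -
      have "homotopic_paths_in (topo X) (\<lambda>t. p (g t)) (\<lambda>t. p (h t))"
        using that g h by (intro path_class_eqD) (simp_all add: map pp)
      then show ?thesis
        using homotopic_paths_in_lift[OF cov g(1) h(1) gh] g h path_class_eqI by blast
    qed
    then show "(path_class_map Y X p a = path_class_map Y X p b) = (a = b)" by blast
  next
    fix a assume "a \<in> gstar (fundamental_groupoid Y) x"
    then show "path_class_map Y X p a \<in> gstar (fundamental_groupoid X) (p x)"
      by (auto simp: gstar_def map path_class_ends pp path_algebra_carrierI elim!: path_algebra_carrierE)
  next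
    fix b assume b: "b \<in> gstar (fundamental_groupoid X) (p x)"
    then obtain g where g: "pathin (topo X) g" "b = path_class (topo X) g"
      by (auto simp: gstar_def elim: path_algebra_carrierE)
    have "p x = g 0" using b g by (simp add: gstar_def path_class_ends)
    then obtain d where d: "pathin (topo Y) d" "d 0 = x" "\<And>t. 0 \<le> t \<Longrightarrow> t \<le> 1 \<Longrightarrow> p (d t) = g t"
      using path_lift[OF cov g(1)] x TC_object_topspace[OF Y] by metis
    have "path_class (topo X) (\<lambda>t. p (d t)) = path_class (topo X) g"
      by (rule path_class_cong[OF pp[OF d(1)] d(3)])
    then show "\<exists>a\<in>gstar (fundamental_groupoid Y) x. b = path_class_map Y X p a"
      using d g by (intro bexI[of _ "path_class (topo Y) d"])
        (simp_all add: gstar_def map path_class_ends path_algebra_carrierI)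
  qed
qed

text \<open>A covering of a locally path connected space is recovered from its groupoid: an open set absorbs
  the ends of lifts of small paths because these stay in a sheet, and conversely the points near \<open>y\<close> in
  its sheet are ends of lifts of small paths.\<close>

lemma topo_eq_transport_topology:
  assumes gw: "groups_with_operations \<Sigma>" and X: "TC_object \<Sigma> X" and Y: "TC_object \<Sigma> Y"
    and mor: "p \<in> TC_mor \<Sigma> Y X" and cov: "covering_map (topo Y) (topo X) p"
    and lpc: "locally_path_connected_space (topo X)"
  shows "path_class_covering \<Sigma> X (fundamental_groupoid Y) p (path_class_map Y X p)"
    and "topo Y = path_class_covering.transport_topology X (fundamental_groupoid Y) p (path_class_map Y X p)"
proof -
  show pcc: "path_class_covering \<Sigma> X (fundamental_groupoid Y) p (path_class_map Y X p)"
    using X internal_groupoid_fundamental_groupoid[OF gw Y] covering_mor_path_class_map[OF X Y mor cov]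
    by unfold_locales
  interpret path_class_covering \<Sigma> X "fundamental_groupoid Y" p "path_class_map Y X p" by (rule pcc)
  note cont = TC_morD(2)[OF mor]
  note map = path_class_map[OF cont]
  note topY = TC_object_topspace[OF Y]
  have "openin (topo Y) W \<longleftrightarrow> transport_open W" for W
  proof
    assume W: "openin (topo Y) W"
    show "transport_open W"
    proof (rule transport_openI)
      show "W \<subseteq> carrier (objs (fundamental_groupoid Y))" using openin_subset[OF W] topY by simp
      fix y assume y: "y \<in> W"
      then have yY: "y \<in> topspace (topo Y)" using openin_subset[OF W] by blast
      show "\<exists>U. openin (topo X) U \<and> p y \<in> U \<and> (\<forall>a g. a \<in> gstar (fundamental_groupoid Y) y \<longrightarrow>
          pathin (subtopology (topo X) U) g \<longrightarrow> path_class_map Y X p a = path_class (topo X) g \<longrightarrow>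
          d1 (fundamental_groupoid Y) a \<in> W)"
      proof (rule covering_map_sheets[OF cov yY yY refl])
        fix T V s
        assume T: "openin (topo X) T" "p y \<in> T" and V: "openin (topo Y) V" "y \<in> V" "inj_on p V"
          and s: "continuous_map (subtopology (topo X) T) (subtopology (topo Y) V) s"
            "\<And>x. x \<in> T \<Longrightarrow> s x \<in> V" "\<And>x. x \<in> T \<Longrightarrow> p (s x) = x"
        have s': "continuous_map (subtopology (topo X) T) (topo Y) s"
          using s(1) by (simp add: continuous_map_in_subtopology)
        define U where "U = {x \<in> T. s x \<in> W}"
        have spy: "s (p y) = y" using s(2,3) T V by (metis inj_onD)
        have "openin (subtopology (topo X) T) {x \<in> topspace (subtopology (topo X) T). s x \<in> W}"
          using s' W by (rule openin_continuous_map_preimage)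
        moreover have "topspace (subtopology (topo X) T) = T" using openin_subset[OF T(1)] by auto
        ultimately have "openin (subtopology (topo X) T) U" by (metis U_def)
        then have U: "openin (topo X) U" using T(1) openin_trans_full by blast
        have "d1 (fundamental_groupoid Y) a \<in> W"
          if a: "a \<in> gstar (fundamental_groupoid Y) y"
            and g: "pathin (subtopology (topo X) U) g" "path_class_map Y X p a = path_class (topo X) g" for a g
        proof -
          obtain d where d: "pathin (topo Y) d" "a = path_class (topo Y) d"
            using a by (auto simp: gstar_def elim: path_algebra_carrierE)
          have gU: "g t \<in> U" if "0 \<le> t" "t \<le> 1" for t
            using g(1) that by (auto simp: pathin_subtopology)
          have gT: "pathin (subtopology (topo X) T) g" and gX: "pathin (topo X) g"
            using g(1) by (auto simp: pathin_subtopology U_def)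
          have sg: "pathin (topo Y) (\<lambda>t. s (g t))" by (rule pathin_compose'[OF s' gT])
          have "homotopic_paths_in (topo X) (\<lambda>t. p (d t)) g"
            using g(2) d by (intro path_class_eqD) (simp_all add: map pathin_compose'[OF cont])
          moreover have "homotopic_paths_in (topo X) g (\<lambda>t. p (s (g t)))"
            using gX gU s(3) by (intro homotopic_paths_in_eq) (auto simp: U_def)
          ultimately have hp: "homotopic_paths_in (topo X) (\<lambda>t. p (d t)) (\<lambda>t. p (s (g t)))"
            by (rule homotopic_paths_in_trans)
          have d0y: "d 0 = y" using a d by (simp add: gstar_def path_class_ends)
          have "p y = g 0" using homotopic_paths_in_ends(1)[OF hp] gU[of 0] s(3) d0y by (simp add: U_def)
          then have "d 0 = s (g 0)" using d0y spy by simp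
          then have "homotopic_paths_in (topo Y) d (\<lambda>t. s (g t))"
            using homotopic_paths_in_lift[OF cov d(1) sg] hp by simp
          then have "d 1 = s (g 1)" using homotopic_paths_in_ends(2) by metis
          then show ?thesis using d gU[of 1] by (simp add: path_class_ends U_def)
        qed
        moreover have "p y \<in> U" using T y spy by (simp add: U_def)
        ultimately show ?thesis using U by blast
      qed
    qed
  next
    assume W: "transport_open W"
    have "\<exists>N. openin (topo Y) N \<and> y \<in> N \<and> N \<subseteq> W" if y: "y \<in> W" for y
    proof -
      have yY: "y \<in> topspace (topo Y)" using W y topY by (auto simp: transport_open_def)
      obtain U where U: "openin (topo X) U" "p y \<in> U" "\<And>a g. a \<in> gstar (fundamental_groupoid Y) y \<Longrightarrow>
          pathin (subtopology (topo X) U) g \<Longrightarrow> path_class_map Y X p a = path_class (topo X) g \<Longrightarrow>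
          d1 (fundamental_groupoid Y) a \<in> W"
        using y by (auto intro: transport_openE[OF W])
      show ?thesis
      proof (rule covering_map_sheets[OF cov yY yY refl])
        fix T V s
        assume T: "openin (topo X) T" "p y \<in> T" and V: "openin (topo Y) V" "y \<in> V" "inj_on p V"
          and s: "continuous_map (subtopology (topo X) T) (subtopology (topo Y) V) s"
            "\<And>x. x \<in> T \<Longrightarrow> s x \<in> V" "\<And>x. x \<in> T \<Longrightarrow> p (s x) = x"
        have s': "continuous_map (subtopology (topo X) T) (topo Y) s"
          using s(1) by (simp add: continuous_map_in_subtopology)
        obtain C where C: "openin (topo X) C" "path_connectedin (topo X) C" "p y \<in> C" "C \<subseteq> U \<inter> T"
          using lpc U T unfolding locally_path_connected_space by (meson IntI openin_Int)
        let ?N = "V \<inter> {z \<in> topspace (topo Y). p z \<in> C}"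
        have "openin (topo Y) ?N" using V C cont by (intro openin_Int openin_continuous_map_preimage)
        moreover have "?N \<subseteq> W"
        proof
          fix z assume z: "z \<in> ?N"
          then have "p z \<in> C" by simp
          obtain g where gX: "pathin (topo X) g" and gC: "\<forall>t. 0 \<le> t \<longrightarrow> t \<le> 1 \<longrightarrow> g t \<in> C"
            and g: "g 0 = p y" "g 1 = p z" by (rule path_connectedinE[OF C(2,3) \<open>p z \<in> C\<close>])
          have gT: "pathin (subtopology (topo X) T) g" and gU: "pathin (subtopology (topo X) U) g"
            using gX gC C by (auto simp: pathin_subtopology)
          have sg: "pathin (topo Y) (\<lambda>t. s (g t))" by (rule pathin_compose'[OF s' gT])
          have "s (p v) = v" if "v \<in> V" "p v \<in> C" for v
            using that C(4) s(2,3) by (intro inj_onD[OF V(3)]) auto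
          then have ends: "s (g 0) = y" "s (g 1) = z" using g V(2) C(3) z by auto
          have "path_class (topo X) g = path_class (topo X) (\<lambda>t. p (s (g t)))"
            using gX gC C s(3) by (intro path_class_cong) auto
          then have "d1 (fundamental_groupoid Y) (path_class (topo Y) (\<lambda>t. s (g t))) \<in> W"
            using sg ends by (intro U(3)[OF _ gU]) (simp_all add: gstar_def path_class_ends path_algebra_carrierI map)
          then show "z \<in> W" using sg ends by (simp add: path_class_ends)
        qed
        moreover have "y \<in> ?N" using V C yY by auto
        ultimately show ?thesis by blast
      qed
    qed
    then show "openin (topo Y) W" by (subst openin_subopen) blast
  qed
  then show "topo Y = transport_topology" by (simp add: topology_eq)
qed

section \<open>From groupoid coverings to topological coverings\<close>

context path_class_covering
begin

lemma lift_exists: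
  assumes y: "y \<in> carrier (objs H)" and g: "pathin (topo X) g" "g 0 = p0 y"
  obtains a where "a \<in> gstar H y" "p1 a = path_class (topo X) g"
proof -
  have "path_class (topo X) g \<in> carrier (elts (fundamental_groupoid X))"
    "d0 (fundamental_groupoid X) (path_class (topo X) g) = p0 y"
    using g by (simp_all add: path_algebra_carrierI path_class_ends)
  then show ?thesis
    by (rule covering_mor_star_lift[OF p y]) (auto simp: gstar_def intro: that)
qed

lemma lift_end:
  assumes "a \<in> gstar H y" "pathin (topo X) g" "p1 a = path_class (topo X) g"
  shows "p0 (d1 H a) = g 1" "p0 y = g 0" "d1 H a \<in> carrier (objs H)"
  using assms covering_morD(5,6)[OF p, of a] internal_groupoidD(9)[OF H, of a]
  by (auto simp: gstar_def path_class_ends)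

lemma lift_unique: "a \<in> gstar H y \<Longrightarrow> b \<in> gstar H y \<Longrightarrow> p1 a = p1 b \<Longrightarrow> a = b"
  by (rule covering_mor_star_inj[OF H p]) (auto simp: gstar_def)

lemma lift_join:
  assumes a: "a \<in> gstar H y" "pathin (topo X) g" "p1 a = path_class (topo X) g"
    and b: "b \<in> gstar H (d1 H a)" "pathin (topo X) h" "p1 b = path_class (topo X) h"
  shows "gcomp H a b \<in> gstar H y" "d1 H (gcomp H a b) = d1 H b" "g 1 = h 0"
    "p1 (gcomp H a b) = path_class (topo X) (join_paths g h)"
proof -
  have ab: "a \<in> carrier (elts H)" "b \<in> carrier (elts H)" "d1 H a = d0 H b"
    using a b by (auto simp: gstar_def)
  show "gcomp H a b \<in> gstar H y" "d1 H (gcomp H a b) = d1 H b"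
    using internal_groupoidD(10-12)[OF H ab] a by (auto simp: gstar_def)
  show gh: "g 1 = h 0" using lift_end[OF a] lift_end[OF b] by simp
  show "p1 (gcomp H a b) = path_class (topo X) (join_paths g h)"
    using covering_morD(8)[OF p ab] a b gh by (simp add: gcomp_path_class)
qed

lemma lift_const:
  assumes "y \<in> carrier (objs H)"
  shows "eps H y \<in> gstar H y" "d1 H (eps H y) = y" "p1 (eps H y) = path_class (topo X) (\<lambda>t. p0 y)"
  using assms internal_groupoidD(5-7)[OF H assms] covering_morD(7)[OF p assms] by (auto simp: gstar_def)

lemma transport_open_p0_vimage:
  assumes "openin (topo X) U"
  shows "transport_open {y \<in> carrier (objs H). p0 y \<in> U}"
proof (rule transport_openI)
  fix y assume "y \<in> {y \<in> carrier (objs H). p0 y \<in> U}"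
  then have "p0 y \<in> U" by simp
  moreover have "d1 H a \<in> {y \<in> carrier (objs H). p0 y \<in> U}"
    if a: "a \<in> gstar H y" and g: "pathin (subtopology (topo X) U) g" and e: "p1 a = path_class (topo X) g" for a g
  proof -
    have "pathin (topo X) g" "g 1 \<in> U" using g by (auto simp: pathin_subtopology)
    then show ?thesis using lift_end[OF a _ e] by simp
  qed
  ultimately show "\<exists>U'. openin (topo X) U' \<and> p0 y \<in> U' \<and> (\<forall>a g. a \<in> gstar H y \<longrightarrow>
      pathin (subtopology (topo X) U') g \<longrightarrow> p1 a = path_class (topo X) g \<longrightarrow>
      d1 H a \<in> {y \<in> carrier (objs H). p0 y \<in> U})"
    using assms by (intro exI[of _ U]) simp
qed auto

lemma continuous_map_p0: "continuous_map transport_topology (topo X) p0"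
  using p0_topspace transport_open_p0_vimage by (auto simp: continuous_map_def)

text \<open>For open \<open>U\<close> these sets form a neighbourhood base at \<open>y\<close>; when \<open>U\<close> is small they will be the sheets
  of the covering over \<open>U\<close>.\<close>

definition sheet :: "'a set \<Rightarrow> 'o \<Rightarrow> 'o set" where
  "sheet U y = {d1 H a | a. a \<in> gstar H y \<and> (\<exists>g. pathin (subtopology (topo X) U) g \<and> p1 a = path_class (topo X) g)}"

lemma sheetE:
  assumes "z \<in> sheet U y"
  obtains a g where "a \<in> gstar H y" "pathin (topo X) g" "\<forall>t. 0 \<le> t \<longrightarrow> t \<le> 1 \<longrightarrow> g t \<in> U"
    "p1 a = path_class (topo X) g" "z = d1 H a"
proof -
  obtain a g where ag: "a \<in> gstar H y" "pathin (subtopology (topo X) U) g" "p1 a = path_class (topo X) g" "z = d1 H a"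
    using assms unfolding sheet_def by blast
  have "pathin (topo X) g" "\<forall>t. 0 \<le> t \<longrightarrow> t \<le> 1 \<longrightarrow> g t \<in> U" using ag(2) by (auto simp: pathin_subtopology)
  with ag show ?thesis using that by blast
qed

lemma sheetI:
  assumes a: "a \<in> gstar H y" "pathin (topo X) g" "\<And>t. 0 \<le> t \<Longrightarrow> t \<le> 1 \<Longrightarrow> g t \<in> U" "p1 a = path_class (topo X) g"
  shows "d1 H a \<in> sheet U y"
proof -
  have "pathin (subtopology (topo X) U) g" using a(2,3) by (auto simp: pathin_subtopology)
  then show ?thesis using a(1,4) unfolding sheet_def by blast
qed

lemma sheet_carrier: "sheet U y \<subseteq> carrier (objs H)"
  by (rule subsetI, erule sheetE) (simp add: lift_end(3))

lemma sheet_p0: "z \<in> sheet U y \<Longrightarrow> p0 z \<in> U"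
  by (erule sheetE) (simp add: lift_end(1))

lemma sheet_self:
  assumes "y \<in> carrier (objs H)" "p0 y \<in> U"
  shows "y \<in> sheet U y"
proof -
  have "pathin (topo X) (\<lambda>t. p0 y)" using p0_topspace[OF assms(1)] by simp
  then show ?thesis using lift_const[OF assms(1)] assms(2) sheetI[of "eps H y" y "\<lambda>t. p0 y" U] by simp
qed

lemma sheet_trans:
  assumes "z \<in> sheet U y" "w \<in> sheet U z"
  shows "w \<in> sheet U y"
proof -
  obtain a g where a: "a \<in> gstar H y" "pathin (topo X) g" "\<forall>t. 0 \<le> t \<longrightarrow> t \<le> 1 \<longrightarrow> g t \<in> U"
    "p1 a = path_class (topo X) g" and z: "z = d1 H a" using assms(1) by (rule sheetE)
  obtain b h where b: "b \<in> gstar H z" "pathin (topo X) h" "\<forall>t. 0 \<le> t \<longrightarrow> t \<le> 1 \<longrightarrow> h t \<in> U"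
    "p1 b = path_class (topo X) h" and w: "w = d1 H b" using assms(2) by (rule sheetE)
  note ab = lift_join[OF a(1,2,4) b(1)[unfolded z] b(2,4)]
  have "d1 H (gcomp H a b) \<in> sheet U y"
  proof (rule sheetI[OF ab(1) _ _ ab(4)])
    show "pathin (topo X) (join_paths g h)" using a(2) b(2) ab(3) by (rule pathin_join)
    show "join_paths g h t \<in> U" if "0 \<le> t" "t \<le> 1" for t
      using that a(3) b(3) by (simp add: join_paths_def)
  qed
  then show ?thesis using ab(2) w by simp
qed

lemma sheet_sym:
  assumes y: "y \<in> carrier (objs H)" and z: "z \<in> sheet U y"
  shows "y \<in> sheet U z"
proof -
  obtain a g where a: "a \<in> gstar H y" "pathin (topo X) g" "\<forall>t. 0 \<le> t \<longrightarrow> t \<le> 1 \<longrightarrow> g t \<in> U"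
    "p1 a = path_class (topo X) g" and za: "z = d1 H a" using z by (rule sheetE)
  let ?h = "\<lambda>t. g (1 - t)"
  note le = lift_end[OF a(1,2,4)]
  have h: "pathin (topo X) ?h" using a(2) by (rule pathin_reverse)
  obtain b where b: "b \<in> gstar H z" "p1 b = path_class (topo X) ?h"
    by (rule lift_exists[of z ?h]) (use h le za in simp_all)
  note ab = lift_join[OF a(1,2,4) b(1)[unfolded za] h b(2)]
  have "p1 (gcomp H a b) = path_class (topo X) (\<lambda>t. g 0)"
    unfolding ab(4) using homotopic_paths_in_join_reverse[OF a(2)] by (rule path_class_eqI)
  then have "gcomp H a b = eps H y"
    using lift_const[OF y] ab(1) le(2) by (intro lift_unique) auto
  then have "d1 H b = y" using ab(2) lift_const[OF y] by simp
  moreover have "d1 H b \<in> sheet U z" by (rule sheetI[OF b(1) h _ b(2)]) (use a(3) in auto)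
  ultimately show ?thesis by simp
qed

lemma sheet_eq:
  assumes "y \<in> carrier (objs H)" "z \<in> sheet U y"
  shows "sheet U z = sheet U y"
  using sheet_sym[OF assms] sheet_trans assms(2) by blast

lemma transport_open_sheet:
  assumes U: "openin (topo X) U"
  shows "transport_open (sheet U y)"
proof (rule transport_openI[OF sheet_carrier])
  fix z assume z: "z \<in> sheet U y"
  have "d1 H a \<in> sheet U y"
    if "a \<in> gstar H z" "pathin (subtopology (topo X) U) g" "p1 a = path_class (topo X) g" for a g
    by (rule sheet_trans[OF z]) (use that in \<open>auto simp: sheet_def\<close>)
  then show "\<exists>U'. openin (topo X) U' \<and> p0 z \<in> U' \<and> (\<forall>a g. a \<in> gstar H z \<longrightarrow>
      pathin (subtopology (topo X) U') g \<longrightarrow> p1 a = path_class (topo X) g \<longrightarrow> d1 H a \<in> sheet U y)"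
    using U sheet_p0[OF z] by (intro exI[of _ U]) blast
qed

lemma sheet_base:
  assumes W: "transport_open W" and y: "y \<in> W"
  obtains U where "openin (topo X) U" "p0 y \<in> U" "\<And>V. V \<subseteq> U \<Longrightarrow> sheet V y \<subseteq> W"
proof -
  obtain U where U: "openin (topo X) U" "p0 y \<in> U" "\<And>a g. a \<in> gstar H y \<Longrightarrow>
      pathin (subtopology (topo X) U) g \<Longrightarrow> p1 a = path_class (topo X) g \<Longrightarrow> d1 H a \<in> W"
    using y by (auto intro: transport_openE[OF W])
  have "sheet V y \<subseteq> W" if V: "V \<subseteq> U" for V
  proof
    fix z assume "z \<in> sheet V y"
    then obtain a g where a: "a \<in> gstar H y" "pathin (topo X) g" "\<forall>t. 0 \<le> t \<longrightarrow> t \<le> 1 \<longrightarrow> g t \<in> V"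
      "p1 a = path_class (topo X) g" "z = d1 H a" by (rule sheetE)
    then have "pathin (subtopology (topo X) U) g" using V by (auto simp: pathin_subtopology)
    then show "z \<in> W" using U(3) a by blast
  qed
  then show ?thesis using that U by blast
qed

text \<open>Operations are continuous because lifting commutes with them: ends of lifts of small paths are
  sent to the end of a lift of the image path, which is small by continuity on the base.\<close>

lemma transport_continuous_binop:
  assumes cont: "continuous_map (prod_topology (topo X) (topo X)) (topo X) (\<lambda>(x, y). fX x y)"
    and fO: "\<And>y z. y \<in> carrier (objs H) \<Longrightarrow> z \<in> carrier (objs H) \<Longrightarrow>
      fO y z \<in> carrier (objs H) \<and> p0 (fO y z) = fX (p0 y) (p0 z)"
    and fE: "\<And>a b. a \<in> carrier (elts H) \<Longrightarrow> b \<in> carrier (elts H) \<Longrightarrow>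
      fE a b \<in> carrier (elts H) \<and> d0 H (fE a b) = fO (d0 H a) (d0 H b) \<and> d1 H (fE a b) = fO (d1 H a) (d1 H b)"
    and p1f: "\<And>a b g h. a \<in> carrier (elts H) \<Longrightarrow> b \<in> carrier (elts H) \<Longrightarrow> pathin (topo X) g \<Longrightarrow>
      pathin (topo X) h \<Longrightarrow> p1 a = path_class (topo X) g \<Longrightarrow> p1 b = path_class (topo X) h \<Longrightarrow>
      p1 (fE a b) = path_class (topo X) (\<lambda>t. fX (g t) (h t))"
  shows "continuous_map (prod_topology transport_topology transport_topology) transport_topology (\<lambda>(y, z). fO y z)"
  unfolding continuous_map_def
proof (intro conjI allI impI)
  show "(\<lambda>(y, z). fO y z) \<in> topspace (prod_topology transport_topology transport_topology) \<rightarrow> topspace transport_topology"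
    using fO by auto
  fix W assume "openin transport_topology W"
  then have W: "transport_open W" by simp
  let ?P = "{u \<in> topspace (prod_topology transport_topology transport_topology). (case u of (y, z) \<Rightarrow> fO y z) \<in> W}"
  have "\<exists>N. openin (prod_topology transport_topology transport_topology) N \<and> u \<in> N \<and> N \<subseteq> ?P" if u: "u \<in> ?P" for u
  proof -
    obtain y z where yz: "u = (y, z)" "y \<in> carrier (objs H)" "z \<in> carrier (objs H)" "fO y z \<in> W"
      using u by auto
    obtain U where U: "openin (topo X) U" "p0 (fO y z) \<in> U" "\<And>V. V \<subseteq> U \<Longrightarrow> sheet V (fO y z) \<subseteq> W"
      using sheet_base[OF W yz(4)] by blast
    define Q where "Q = {v \<in> topspace (prod_topology (topo X) (topo X)). (case v of (x, y) \<Rightarrow> fX x y) \<in> U}"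
    have Q: "openin (prod_topology (topo X) (topo X)) Q"
      unfolding Q_def using cont U(1) by (rule openin_continuous_map_preimage)
    have "(p0 y, p0 z) \<in> Q" using U(2) fO[OF yz(2,3)] p0_topspace yz by (simp add: Q_def)
    with Q have "\<exists>A B. openin (topo X) A \<and> openin (topo X) B \<and> p0 y \<in> A \<and> p0 z \<in> B \<and> A \<times> B \<subseteq> Q"
      by (simp add: openin_prod_topology_alt)
    then obtain A B where AB: "openin (topo X) A" "openin (topo X) B" "p0 y \<in> A" "p0 z \<in> B" and "A \<times> B \<subseteq> Q"
      by (elim exE conjE)
    then have ABU: "fX x x' \<in> U" if "x \<in> A" "x' \<in> B" for x x' using that by (auto simp: Q_def)
    have "fO y' z' \<in> W" if y': "y' \<in> sheet A y" and z': "z' \<in> sheet B z" for y' z'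
    proof -
      obtain a g where a: "a \<in> gstar H y" "pathin (topo X) g" "\<forall>t. 0 \<le> t \<longrightarrow> t \<le> 1 \<longrightarrow> g t \<in> A"
        "p1 a = path_class (topo X) g" "y' = d1 H a" using y' by (rule sheetE)
      obtain b h where b: "b \<in> gstar H z" "pathin (topo X) h" "\<forall>t. 0 \<le> t \<longrightarrow> t \<le> 1 \<longrightarrow> h t \<in> B"
        "p1 b = path_class (topo X) h" "z' = d1 H b" using z' by (rule sheetE)
      have ab: "a \<in> carrier (elts H)" "b \<in> carrier (elts H)" "d0 H a = y" "d0 H b = z"
        using a b by (auto simp: gstar_def)
      have "d1 H (fE a b) \<in> sheet U (fO y z)"
      proof (rule sheetI)
        show "fE a b \<in> gstar H (fO y z)" using fE ab by (auto simp: gstar_def)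
        show "pathin (topo X) (\<lambda>t. fX (g t) (h t))" by (rule pathin_binop[OF cont a(2) b(2)])
        show "fX (g t) (h t) \<in> U" if "0 \<le> t" "t \<le> 1" for t using a(3) b(3) that by (intro ABU) simp_all
        show "p1 (fE a b) = path_class (topo X) (\<lambda>t. fX (g t) (h t))" using p1f ab a b by blast
      qed
      then show ?thesis using U(3)[of U] fE ab a b by auto
    qed
    then have "sheet A y \<times> sheet B z \<subseteq> ?P" using sheet_carrier by fastforce
    moreover have "openin (prod_topology transport_topology transport_topology) (sheet A y \<times> sheet B z)"
      using transport_open_sheet AB by (simp add: openin_prod_Times_iff)
    moreover have "u \<in> sheet A y \<times> sheet B z" using sheet_self yz AB by auto
    ultimately show ?thesis by blast
  qed
  then show "openin (prod_topology transport_topology transport_topology) ?P" by (subst openin_subopen) blast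
qed

lemma transport_continuous_unop:
  assumes cont: "continuous_map (topo X) (topo X) fX"
    and fO: "\<And>y. y \<in> carrier (objs H) \<Longrightarrow> fO y \<in> carrier (objs H) \<and> p0 (fO y) = fX (p0 y)"
    and fE: "\<And>a. a \<in> carrier (elts H) \<Longrightarrow>
      fE a \<in> carrier (elts H) \<and> d0 H (fE a) = fO (d0 H a) \<and> d1 H (fE a) = fO (d1 H a)"
    and p1f: "\<And>a g. a \<in> carrier (elts H) \<Longrightarrow> pathin (topo X) g \<Longrightarrow> p1 a = path_class (topo X) g \<Longrightarrow>
      p1 (fE a) = path_class (topo X) (\<lambda>t. fX (g t))"
  shows "continuous_map transport_topology transport_topology fO"
  unfolding continuous_map_def
proof (intro conjI allI impI)
  show "fO \<in> topspace transport_topology \<rightarrow> topspace transport_topology" using fO by auto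
  fix W assume "openin transport_topology W"
  then have W: "transport_open W" by simp
  have "transport_open {y \<in> carrier (objs H). fO y \<in> W}"
  proof (rule transport_openI)
    fix y assume "y \<in> {y \<in> carrier (objs H). fO y \<in> W}"
    then have y: "y \<in> carrier (objs H)" "fO y \<in> W" by auto
    obtain U where U: "openin (topo X) U" "p0 (fO y) \<in> U" "\<And>V. V \<subseteq> U \<Longrightarrow> sheet V (fO y) \<subseteq> W"
      using sheet_base[OF W y(2)] by blast
    let ?Q = "{x \<in> topspace (topo X). fX x \<in> U}"
    have "openin (topo X) ?Q" using cont U(1) by (rule openin_continuous_map_preimage)
    moreover have "p0 y \<in> ?Q" using U(2) fO[OF y(1)] p0_topspace y by auto
    moreover have "d1 H a \<in> {y \<in> carrier (objs H). fO y \<in> W}"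
      if a: "a \<in> gstar H y" and g: "pathin (subtopology (topo X) ?Q) g" and e: "p1 a = path_class (topo X) g" for a g
    proof -
      have a': "a \<in> carrier (elts H)" "d0 H a = y" using a by (auto simp: gstar_def)
      have gX: "pathin (topo X) g" and gU: "\<And>t. 0 \<le> t \<Longrightarrow> t \<le> 1 \<Longrightarrow> fX (g t) \<in> U"
        using g by (auto simp: pathin_subtopology)
      have "d1 H (fE a) \<in> sheet U (fO y)"
      proof (rule sheetI)
        show "fE a \<in> gstar H (fO y)" using fE a' by (auto simp: gstar_def)
        show "pathin (topo X) (\<lambda>t. fX (g t))" by (rule pathin_compose'[OF cont gX])
        show "p1 (fE a) = path_class (topo X) (\<lambda>t. fX (g t))" using p1f a' gX e by blast
      qed (rule gU)
      then show ?thesis using U(3)[of U] fE a' internal_groupoidD(9)[OF H] by auto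
    qed
    ultimately show "\<exists>U. openin (topo X) U \<and> p0 y \<in> U \<and> (\<forall>a g. a \<in> gstar H y \<longrightarrow>
        pathin (subtopology (topo X) U) g \<longrightarrow> p1 a = path_class (topo X) g \<longrightarrow> d1 H a \<in> {y \<in> carrier (objs H). fO y \<in> W})"
      by (intro exI[of _ ?Q]) blast
  qed auto
  then show "openin transport_topology {y \<in> topspace transport_topology. fO y \<in> W}" by simp
qed

definition total_space :: "('o, 'w, 'b) tgwo" where
  "total_space = \<lparr>carrier = carrier (objs H), mult = mult (objs H), one = one (objs H),
     uop = uop (objs H), bop = bop (objs H), topo = transport_topology\<rparr>"

lemma total_space_sel [simp]:
  "carrier total_space = carrier (objs H)" "mult total_space = mult (objs H)" "one total_space = one (objs H)"
  "uop total_space = uop (objs H)" "bop total_space = bop (objs H)" "topo total_space = transport_topology"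
  by (simp_all add: total_space_def)

lemma truncate_total_space: "gwo.truncate total_space = objs H"
  by (simp add: total_space_def gwo.truncate_def)

lemma group_hom_of_C_hom: "C_object \<Sigma> A \<Longrightarrow> C_object \<Sigma> B \<Longrightarrow> f \<in> C_hom \<Sigma> A B \<Longrightarrow> group_hom A B f"
  by (simp add: C_object_def C_hom_def group_hom_def group_hom_axioms_def)

lemma TC_object_total_space: "TC_object \<Sigma> total_space"
proof -
  note HD = internal_groupoidD[OF H] and p' = covering_morD[OF p]
  note oO = C_objectD[OF HD(2)] and oE = C_objectD[OF HD(1)]
  note d0 = C_homD[OF HD(3)] and d1 = C_homD[OF HD(4)]
  note p0 = C_homD[OF p'(1), simplified] and p1 = C_homD[OF p'(3), simplified]
  have C: "C_object \<Sigma> total_space"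
    using HD(2) C_object_truncate[of \<Sigma> total_space] by (simp add: truncate_total_space)
  have inv_eq: "inv\<^bsub>total_space\<^esub> x = inv\<^bsub>objs H\<^esub> x" for x
    using m_inv_truncate[of total_space] by (simp add: truncate_total_space)
  have P: "group (path_algebra X)" using X by (rule group_path_algebra)
  interpret d0h: group_hom "elts H" "objs H" "d0 H" by (rule group_hom_of_C_hom[OF HD(1-3)])
  interpret d1h: group_hom "elts H" "objs H" "d1 H" by (rule group_hom_of_C_hom[OF HD(1,2,4)])
  interpret p0h: group_hom "objs H" X p0
    using oO(1) TC_object_group[OF X] p0 by (simp add: group_hom_def group_hom_axioms_def hom_def)
  interpret p1h: group_hom "elts H" "path_algebra X" p1
    using oE(1) P p1 by (simp add: group_hom_def group_hom_axioms_def hom_def)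
  have "continuous_map (prod_topology transport_topology transport_topology) transport_topology
      (\<lambda>(x, y). x \<otimes>\<^bsub>objs H\<^esub> y)"
    by (rule transport_continuous_binop[of "mult X" _ "mult (elts H)"])
       (use X oO oE d0 d1 p0 p1 path_algebra_mult[OF X] in \<open>auto simp: TC_object_def\<close>)
  moreover have "continuous_map transport_topology transport_topology (\<lambda>x. inv\<^bsub>objs H\<^esub> x)"
    by (rule transport_continuous_unop[of "\<lambda>x. inv\<^bsub>X\<^esub> x" _ "\<lambda>x. inv\<^bsub>elts H\<^esub> x"])
       (use X path_algebra_inv[OF X] in \<open>auto simp: TC_object_def\<close>)
  moreover have "continuous_map transport_topology transport_topology (uop (objs H) w)" if "w \<in> Omega1' \<Sigma>" for w
    by (rule transport_continuous_unop[of "uop X w" _ "uop (elts H) w"])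
       (use that X oO oE d0 d1 p0 p1 path_algebra_uop[OF X] in \<open>auto simp: TC_object_def\<close>)
  moreover have "continuous_map (prod_topology transport_topology transport_topology) transport_topology
      (\<lambda>(x, y). bop (objs H) s x y)" if "s \<in> Omega2' \<Sigma>" for s
    by (rule transport_continuous_binop[of "bop X s" _ "bop (elts H) s"])
       (use that X oO oE d0 d1 p0 p1 path_algebra_bop[OF X] in \<open>auto simp: TC_object_def\<close>)
  ultimately show ?thesis
    using C by (simp add: TC_object_def inv_eq)
qed

lemma p0_TC_mor: "p0 \<in> TC_mor \<Sigma> total_space X"
  using covering_morD(1,2)[OF p] continuous_map_p0
  by (auto simp: TC_mor_def C_hom_def hom_def)

text \<open>Over an open path connected set in which parallel paths are homotopic in \<open>X\<close>, each sheet is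
  mapped bijectively: its points are ends of lifts, which depend only on the end of the path below.\<close>

lemma covering_map_p0:
  assumes lpc: "locally_path_connected_space (topo X)" and pc: "path_connected_space (topo X)"
    and slsc: "\<And>x. x \<in> topspace (topo X) \<Longrightarrow> \<exists>T. openin (topo X) T \<and> x \<in> T \<and>
      (\<forall>g h. pathin (subtopology (topo X) T) g \<longrightarrow> pathin (subtopology (topo X) T) h \<longrightarrow> g 0 = h 0 \<longrightarrow> g 1 = h 1 \<longrightarrow>
        homotopic_paths_in (topo X) g h)"
  shows "covering_map transport_topology (topo X) p0"
proof -
  have small: "\<exists>U. openin (topo X) U \<and> path_connectedin (topo X) U \<and> x \<in> U \<and> U \<subseteq> V"
    if "openin (topo X) V" "x \<in> V" for V x
    using lpc that unfolding locally_path_connected_space by blast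
  have path: "\<exists>g. pathin (topo X) g \<and> (\<forall>t. 0 \<le> t \<longrightarrow> t \<le> 1 \<longrightarrow> g t \<in> U) \<and> g 0 = x \<and> g 1 = x'"
    if "path_connectedin (topo X) U" "x \<in> U" "x' \<in> U" for U x x'
    using path_connectedinE[OF that] by blast
  have open_map_p0: "openin (topo X) (p0 ` W)" if W: "transport_open W" for W
  proof -
    have "\<exists>N. openin (topo X) N \<and> x \<in> N \<and> N \<subseteq> p0 ` W" if x: "x \<in> p0 ` W" for x
    proof -
      obtain y where y: "y \<in> W" "x = p0 y" using x by blast
      then have yH: "y \<in> carrier (objs H)" using W by (auto simp: transport_open_def)
      obtain V where V: "openin (topo X) V" "p0 y \<in> V" "\<And>U. U \<subseteq> V \<Longrightarrow> sheet U y \<subseteq> W"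
        using sheet_base[OF W y(1)] by blast
      obtain U where U: "openin (topo X) U" "path_connectedin (topo X) U" "p0 y \<in> U" "U \<subseteq> V"
        using small[OF V(1,2)] by blast
      have "x' \<in> p0 ` W" if x': "x' \<in> U" for x'
      proof -
        obtain g where g: "pathin (topo X) g" "\<And>t. 0 \<le> t \<Longrightarrow> t \<le> 1 \<Longrightarrow> g t \<in> U" "g 0 = p0 y" "g 1 = x'"
          using path[OF U(2,3) x'] by blast
        obtain a where a: "a \<in> gstar H y" "p1 a = path_class (topo X) g" by (rule lift_exists[OF yH g(1,3)])
        have "d1 H a \<in> sheet U y" by (rule sheetI[OF a(1) g(1,2) a(2)])
        then have "d1 H a \<in> W" using V(3)[OF U(4)] by blast
        then show ?thesis using lift_end(1)[OF a(1) g(1) a(2)] g(4) by (metis image_eqI)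
      qed
      then show ?thesis using U y by blast
    qed
    then show ?thesis by (subst openin_subopen) blast
  qed
  have surj: "p0 ` carrier (objs H) = topspace (topo X)"
  proof
    show "p0 ` carrier (objs H) \<subseteq> topspace (topo X)" using p0_topspace by blast
    show "topspace (topo X) \<subseteq> p0 ` carrier (objs H)"
    proof
      fix x assume x: "x \<in> topspace (topo X)"
      have o: "\<one>\<^bsub>objs H\<^esub> \<in> carrier (objs H)"
        using C_objectD(1)[OF internal_groupoidD(2)[OF H]] by (simp add: group.is_monoid)
      obtain g where g: "pathin (topo X) g" "g 0 = p0 \<one>\<^bsub>objs H\<^esub>" "g 1 = x"
        using pc x p0_topspace[OF o] unfolding path_connected_space_def by blast
      obtain a where a: "a \<in> gstar H \<one>\<^bsub>objs H\<^esub>" "p1 a = path_class (topo X) g" by (rule lift_exists[OF o g(1,2)])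
      show "x \<in> p0 ` carrier (objs H)" using lift_end[OF a(1) g(1) a(2)] g(3) by (metis image_eqI)
    qed
  qed
  have even: "\<exists>T. x \<in> T \<and> openin (topo X) T \<and>
      (\<exists>\<V>. \<Union>\<V> = topspace transport_topology \<inter> p0 -` T \<and> (\<forall>U\<in>\<V>. openin transport_topology U) \<and> pairwise disjnt \<V> \<and>
        (\<forall>U\<in>\<V>. homeomorphic_map (subtopology transport_topology U) (subtopology (topo X) T) p0))"
    if x: "x \<in> topspace (topo X)" for x
  proof -
    obtain T where T: "openin (topo X) T" "x \<in> T" "\<And>g h. pathin (subtopology (topo X) T) g \<Longrightarrow>
        pathin (subtopology (topo X) T) h \<Longrightarrow> g 0 = h 0 \<Longrightarrow> g 1 = h 1 \<Longrightarrow> homotopic_paths_in (topo X) g h"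
      using slsc[OF x] by blast
    obtain U where U: "openin (topo X) U" "path_connectedin (topo X) U" "x \<in> U" "U \<subseteq> T"
      using small[OF T(1,2)] by blast
    let ?V = "{sheet U y | y. y \<in> carrier (objs H) \<and> p0 y \<in> U}"
    have "\<Union>?V = topspace transport_topology \<inter> p0 -` U"
      using sheet_self sheet_carrier sheet_p0 by fastforce
    moreover have "\<forall>V\<in>?V. openin transport_topology V" using transport_open_sheet[OF U(1)] by auto
    moreover have "pairwise disjnt ?V"
    proof (rule pairwiseI)
      fix V V' assume "V \<in> ?V" "V' \<in> ?V" "V \<noteq> V'"
      then obtain y y' where y: "y \<in> carrier (objs H)" "V = sheet U y"
        and y': "y' \<in> carrier (objs H)" "V' = sheet U y'" and ne: "V \<noteq> V'" by blast
      have "False" if "w \<in> V" "w \<in> V'" for w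
        using sheet_eq[OF y(1), of w U] sheet_eq[OF y'(1), of w U] that y(2) y'(2) ne by simp
      then show "disjnt V V'" by (auto simp: disjnt_iff)
    qed
    moreover have "homeomorphic_map (subtopology transport_topology V) (subtopology (topo X) U) p0" if V_in: "V \<in> ?V" for V
    proof -
      obtain y where y: "y \<in> carrier (objs H)" "p0 y \<in> U" and V: "V = sheet U y" using V_in by blast
      have tV: "topspace (subtopology transport_topology V) = V" using sheet_carrier V by auto
      have tU: "topspace (subtopology (topo X) U) = U" using openin_subset[OF U(1)] by auto
      have VO: "openin transport_topology V" using transport_open_sheet[OF U(1)] V by simp
      show ?thesis
      proof (rule bijective_open_imp_homeomorphic_map)
        show "continuous_map (subtopology transport_topology V) (subtopology (topo X) U) p0"
          using continuous_map_p0 sheet_p0 V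
          by (auto simp: continuous_map_in_subtopology continuous_map_from_subtopology)
        show "open_map (subtopology transport_topology V) (subtopology (topo X) U) p0"
          unfolding open_map_def
        proof (intro allI impI)
          fix W assume "openin (subtopology transport_topology V) W"
          then have "openin transport_topology W" "W \<subseteq> V"
            using VO openin_trans_full openin_subset tV by blast+
          then show "openin (subtopology (topo X) U) (p0 ` W)"
            using open_map_p0 sheet_p0 V by (auto intro!: subset_openin_subtopology)
        qed
        show "p0 ` topspace (subtopology transport_topology V) = topspace (subtopology (topo X) U)"
          unfolding tV tU
        proof
          show "p0 ` V \<subseteq> U" using sheet_p0 V by blast
          show "U \<subseteq> p0 ` V"
          proof
            fix x' assume x': "x' \<in> U"
            obtain g where g: "pathin (topo X) g" "\<And>t. 0 \<le> t \<Longrightarrow> t \<le> 1 \<Longrightarrow> g t \<in> U" "g 0 = p0 y" "g 1 = x'"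
              using path[OF U(2) y(2) x'] by blast
            obtain a where a: "a \<in> gstar H y" "p1 a = path_class (topo X) g" by (rule lift_exists[OF y(1) g(1,3)])
            have "d1 H a \<in> V" unfolding V by (rule sheetI[OF a(1) g(1,2) a(2)])
            then show "x' \<in> p0 ` V" using lift_end(1)[OF a(1) g(1) a(2)] g(4) by (metis image_eqI)
          qed
        qed
        show "inj_on p0 (topspace (subtopology transport_topology V))"
          unfolding tV unfolding V
        proof (rule inj_onI)
          fix z z' assume z: "z \<in> sheet U y" and z': "z' \<in> sheet U y" and eq: "p0 z = p0 z'"
          obtain a g where a: "a \<in> gstar H y" "pathin (topo X) g" "\<forall>t. 0 \<le> t \<longrightarrow> t \<le> 1 \<longrightarrow> g t \<in> U"
            "p1 a = path_class (topo X) g" "z = d1 H a" using z by (rule sheetE)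
          obtain b h where b: "b \<in> gstar H y" "pathin (topo X) h" "\<forall>t. 0 \<le> t \<longrightarrow> t \<le> 1 \<longrightarrow> h t \<in> U"
            "p1 b = path_class (topo X) h" "z' = d1 H b" using z' by (rule sheetE)
          have "homotopic_paths_in (topo X) g h"
          proof (rule T(3))
            show "pathin (subtopology (topo X) T) g" "pathin (subtopology (topo X) T) h"
              using a b U(4) by (auto simp: pathin_subtopology)
            show "g 0 = h 0" "g 1 = h 1"
              using lift_end[OF a(1,2,4)] lift_end[OF b(1,2,4)] eq a(5) b(5) by auto
          qed
          then have "p1 a = p1 b" using a b path_class_eqI by metis
          then show "z = z'" using lift_unique a b by blast
        qed
      qed
    qed
    ultimately show ?thesis using U by (intro exI[of _ U] conjI exI[of _ ?V]) blast+
  qed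
  show ?thesis unfolding covering_map_def using continuous_map_p0 surj even by simp
qed

text \<open>The ends of the lifts of the initial segments of \<open>g\<close> trace out the path: the lift at time \<open>t'\<close> is
  the lift at time \<open>t\<close> followed by a lift of the segment in between, which is small when \<open>t'\<close> is near
  \<open>t\<close>. So topological lifting agrees with lifting in the groupoid.\<close>

lemma path_lift_transport:
  assumes y: "y \<in> carrier (objs H)" and g: "pathin (topo X) g" "g 0 = p0 y"
    and a: "a \<in> gstar H y" "p1 a = path_class (topo X) g"
  obtains d where "pathin transport_topology d" "d 0 = y" "d 1 = d1 H a" "\<And>t. 0 \<le> t \<Longrightarrow> t \<le> 1 \<Longrightarrow> p0 (d t) = g t"
proof -
  have seg: "pathin (topo X) (\<lambda>s. g (t * s))" if "t \<in> {0..1}" for t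
  proof (rule pathin_reparametrize[OF g(1), of "\<lambda>s. t * s"])
    show "continuous_on {0..1} (\<lambda>s. t * s)" by (intro continuous_intros)
    show "(\<lambda>s. t * s) ` {0..1} \<subseteq> {0..1}" using that by (auto simp: mult_le_one)
  qed
  define L where "L t = (SOME b. b \<in> gstar H y \<and> p1 b = path_class (topo X) (\<lambda>s. g (t * s)))" for t
  have L: "L t \<in> gstar H y" "p1 (L t) = path_class (topo X) (\<lambda>s. g (t * s))" if t: "t \<in> {0..1}" for t
  proof -
    have "\<exists>b. b \<in> gstar H y \<and> p1 b = path_class (topo X) (\<lambda>s. g (t * s))"
      using g(2) by (auto intro: lift_exists[OF y seg[OF t]])
    then have "L t \<in> gstar H y \<and> p1 (L t) = path_class (topo X) (\<lambda>s. g (t * s))"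
      unfolding L_def by (rule someI_ex)
    then show "L t \<in> gstar H y" "p1 (L t) = path_class (topo X) (\<lambda>s. g (t * s))" by auto
  qed
  define d where "d t = d1 H (L t)" for t
  have d: "d t \<in> carrier (objs H)" "p0 (d t) = g t" if t: "t \<in> {0..1}" for t
    using lift_end[OF L(1)[OF t] seg[OF t] L(2)[OF t]] by (simp_all add: d_def)
  have "L 0 = eps H y" using L[of 0] lift_const[OF y] g(2) by (intro lift_unique) auto
  then have d0: "d 0 = y" using lift_const[OF y] by (simp add: d_def)
  have "L 1 = a" using L[of 1] a by (intro lift_unique) auto
  then have d1: "d 1 = d1 H a" by (simp add: d_def)
  have "pathin transport_topology d"
    unfolding pathin_def continuous_map_def
  proof (intro conjI allI impI)
    show "d \<in> topspace (top_of_set {0..1}) \<rightarrow> topspace transport_topology" using d by auto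
    fix W assume "openin transport_topology W"
    then have W: "transport_open W" by simp
    have "\<exists>e>0. \<forall>t'\<in>{0..1}. dist t' t < e \<longrightarrow> d t' \<in> W" if t: "t \<in> {0..1}" "d t \<in> W" for t
    proof -
      obtain U where U: "openin (topo X) U" "p0 (d t) \<in> U" "\<And>V. V \<subseteq> U \<Longrightarrow> sheet V (d t) \<subseteq> W"
        using sheet_base[OF W t(2)] by blast
      define N where "N = {s \<in> topspace (top_of_set {0..1}). g s \<in> U}"
      have "openin (top_of_set {0..1}) N"
        unfolding N_def using g(1) U(1) unfolding pathin_def by (rule openin_continuous_map_preimage)
      then have "\<forall>s\<in>N. \<exists>e>0. \<forall>s'\<in>{0..1}. dist s' s < e \<longrightarrow> s' \<in> N"
        unfolding openin_euclidean_subtopology_iff by (rule conjunct2)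
      moreover have "t \<in> N" using U(2) d t by (simp add: N_def)
      ultimately obtain e where "e > 0" "\<forall>s'\<in>{0..1}. dist s' t < e \<longrightarrow> s' \<in> N" by blast
      then have e: "e > 0" "\<And>s. s \<in> {0..1} \<Longrightarrow> dist s t < e \<Longrightarrow> g s \<in> U" by (auto simp: N_def)
      have "d t' \<in> W" if t': "t' \<in> {0..1}" "dist t' t < e" for t'
      proof -
        define f :: "real \<Rightarrow> real" where "f s = (1 - s) * t + s * t'" for s
        have f01: "f s \<in> {0..1}" if "0 \<le> s" "s \<le> 1" for s
          using that t t' by (auto simp: f_def intro!: convex_bound_le)
        have fe: "dist (f s) t < e" if s: "0 \<le> s" "s \<le> 1" for s
        proof -
          have "f s - t = s * (t' - t)" by (simp add: f_def algebra_simps)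
          then have "dist (f s) t = s * dist t' t" using s by (simp add: dist_real_def abs_mult)
          also have "\<dots> \<le> dist t' t" using s by (simp add: mult_left_le_one_le)
          finally show ?thesis using t' by simp
        qed
        have cf: "continuous_on {0..1} f" by (auto simp: f_def intro!: continuous_intros)
        have gf: "pathin (topo X) (\<lambda>s. g (f s))"
          by (rule pathin_reparametrize[OF g(1) cf]) (use f01 in auto)
        have gfU: "g (f s) \<in> U" if "0 \<le> s" "s \<le> 1" for s using e f01 fe that by auto
        have f0: "g (f 0) = p0 (d t)" using d t by (simp add: f_def)
        obtain b where b: "b \<in> gstar H (d t)" "p1 b = path_class (topo X) (\<lambda>s. g (f s))"
          by (rule lift_exists[of "d t" "\<lambda>s. g (f s)"]) (use d t gf f0 in simp_all)
        note Lb = lift_join[OF L(1)[OF t(1)] seg[OF t(1)] L(2)[OF t(1)] b(1)[unfolded d_def] gf b(2)]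
        have "gcomp H (L t) b = L t'"
        proof (rule lift_unique[OF Lb(1) L(1)[OF t'(1)]])
          have I: "pathin (top_of_set {0..1}) (join_paths (\<lambda>s. t * s) f)"
          proof (rule pathin_join)
            show "pathin (top_of_set {0..1}) (\<lambda>s. t * s)"
              using t by (auto simp: pathin_def mult_le_one intro!: continuous_intros)
            show "pathin (top_of_set {0..1}) f" using cf f01 by (auto simp: pathin_def)
          qed (simp add: f_def)
          have "homotopic_paths_in (topo X) (\<lambda>s. g (join_paths (\<lambda>s. t * s) f s)) (\<lambda>s. g (t' * s))"
          proof (rule homotopic_paths_in_reparametrize[OF g(1)])
            show "continuous_on {0..1} (join_paths (\<lambda>s. t * s) f)" "join_paths (\<lambda>s. t * s) f ` {0..1} \<subseteq> {0..1}"
              using I by (auto simp: pathin_def)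
            show "continuous_on {0..1} (\<lambda>s. t' * s)" by (intro continuous_intros)
            show "(\<lambda>s. t' * s) ` {0..1} \<subseteq> {0..1}" using t'(1) by (auto simp: mult_le_one)
          qed (simp_all add: f_def)
          moreover have "(\<lambda>s. g (join_paths (\<lambda>s. t * s) f s)) = join_paths (\<lambda>s. g (t * s)) (\<lambda>s. g (f s))"
            by (simp add: join_paths_def fun_eq_iff)
          ultimately show "p1 (gcomp H (L t) b) = p1 (L t')"
            unfolding Lb(4) L(2)[OF t'(1)] by (simp add: path_class_eqI)
        qed
        then have "d t' = d1 H b" using Lb(2) by (simp add: d_def)
        moreover have "d1 H b \<in> sheet U (d t)" by (rule sheetI[OF b(1) gf gfU b(2)])
        ultimately show ?thesis using U(3)[of U] by auto
      qed
      then show ?thesis using e(1) by blast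
    qed
    then show "openin (top_of_set {0..1}) {t \<in> topspace (top_of_set {0..1}). d t \<in> W}"
      unfolding openin_euclidean_subtopology_iff by auto
  qed
  then show ?thesis using that d0 d1 d by auto
qed

end

section \<open>The equivalence\<close>

lemma Cov_TCD:
  assumes "(Y, p) \<in> Ob (Cov_TC \<Sigma> X)"
  shows "TC_object \<Sigma> Y" "p \<in> TC_mor \<Sigma> Y X" "covering_map (topo Y) (topo X) p"
  using assms by (auto simp: Cov_TC_def)

lemma Cov_TC_Hom:
  "f \<in> Hom (Cov_TC \<Sigma> X) (Y, p) (Z, q) \<longleftrightarrow> f \<in> TC_mor \<Sigma> Y Z \<and> (\<forall>y\<in>carrier Y. q (f y) = p y)"
  by (simp add: Cov_TC_def)

lemma Cov_Cat_Hom: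
  "(f0, f1) \<in> Hom (Cov_Cat \<Sigma> G) (H, (p0, p1)) (K, (q0, q1)) \<longleftrightarrow> (f0, f1) \<in> covering_mor \<Sigma> H K \<and>
     (\<forall>x\<in>carrier (objs H). q0 (f0 x) = p0 x) \<and> (\<forall>a\<in>carrier (elts H). q1 (f1 a) = p1 a)"
  by (simp add: Cov_Cat_def)

lemma Cov_Cat_Hom_eqI:
  assumes A: "A \<in> Ob (Cov_Cat \<Sigma> G)" and B: "B \<in> Ob (Cov_Cat \<Sigma> G)"
    and f: "f \<in> Hom (Cov_Cat \<Sigma> G) A B" and g: "g \<in> Hom (Cov_Cat \<Sigma> G) A B" and eq: "fst f = fst g"
  shows "f = g"
proof -
  obtain H p0 p1 where A': "A = (H, (p0, p1))" by (metis surj_pair)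
  obtain K q0 q1 where B': "B = (K, (q0, q1))" by (metis surj_pair)
  obtain f0 f1 where f': "f = (f0, f1)" by (cases f)
  obtain g1 where g': "g = (f0, g1)" using eq f' by (cases g) simp
  have "f1 = g1"
    using Cov_CatD[OF A[unfolded A']] Cov_CatD[OF B[unfolded B']]
      f[unfolded A' B' f' Cov_Cat_Hom] g[unfolded A' B' g' Cov_Cat_Hom]
    by (intro covering_mor_eqI[of \<Sigma> H K q0 q1 G f0 f1 g1]) auto
  then show ?thesis by (simp add: f' g')
qed

definition pi_cover :: "('a, 'w, 'b) tgwo \<Rightarrow> ('u, 'w, 'b) tgwo \<times> ('u \<Rightarrow> 'a) \<Rightarrow>
    ((real \<Rightarrow> 'u) set, 'u, 'w, 'b) igpd \<times> (('u \<Rightarrow> 'a) \<times> ((real \<Rightarrow> 'u) set \<Rightarrow> (real \<Rightarrow> 'a) set))" where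
  "pi_cover X A = (fundamental_groupoid (fst A), (snd A, path_class_map (fst A) X (snd A)))"

lemma pi_cover_Ob:
  assumes gw: "groups_with_operations \<Sigma>" and X: "TC_object \<Sigma> X" and A: "A \<in> Ob (Cov_TC \<Sigma> X)"
  shows "pi_cover X A \<in> Ob (Cov_Cat \<Sigma> (fundamental_groupoid X))"
proof -
  obtain Y p where A': "A = (Y, p)" by (cases A)
  note AD = Cov_TCD[OF A[unfolded A']]
  show ?thesis
    using internal_groupoid_fundamental_groupoid[OF gw AD(1)] internal_groupoid_fundamental_groupoid[OF gw X]
      covering_mor_path_class_map[OF X AD]
    by (simp add: A' pi_cover_def Cov_Cat_def)
qed

text \<open>A morphism of groupoid coverings is continuous on objects by naturality of the
  transport topology; a continuous map over the base respects ends of lifts of path classes, as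
  it sends lifts of paths to lifts.\<close>

lemma bij_betw_fst_pi_cover:
  assumes gw: "groups_with_operations \<Sigma>" and X: "TC_object \<Sigma> X"
    and lpc: "locally_path_connected_space (topo X)"
    and A: "A \<in> Ob (Cov_TC \<Sigma> X)" and B: "B \<in> Ob (Cov_TC \<Sigma> X)"
  shows "bij_betw fst (Hom (Cov_Cat \<Sigma> (fundamental_groupoid X)) (pi_cover X A) (pi_cover X B)) (Hom (Cov_TC \<Sigma> X) A B)"
proof -
  let ?D = "Cov_Cat \<Sigma> (fundamental_groupoid X)"
  obtain Y p where A': "A = (Y, p)" by (cases A)
  obtain Z q where B': "B = (Z, q)" by (cases B)
  note AD = Cov_TCD[OF A[unfolded A']] and BD = Cov_TCD[OF B[unfolded B']]
  note piA = pi_cover_Ob[OF gw X A] and piB = pi_cover_Ob[OF gw X B]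
  note tA = topo_eq_transport_topology[OF gw X AD lpc] and tB = topo_eq_transport_topology[OF gw X BD lpc]
  have "fst f \<in> Hom (Cov_TC \<Sigma> X) A B" if "f \<in> Hom ?D (pi_cover X A) (pi_cover X B)" for f
  proof -
    obtain f0 f1 where f': "f = (f0, f1)" by (cases f)
    have f: "(f0, f1) \<in> covering_mor \<Sigma> (fundamental_groupoid Y) (fundamental_groupoid Z)"
      "\<And>y. y \<in> carrier Y \<Longrightarrow> q (f0 y) = p y"
      "\<And>a. a \<in> carrier (path_algebra Y) \<Longrightarrow> path_class_map Z X q (f1 a) = path_class_map Y X p a"
      using that by (simp_all add: f' A' B' pi_cover_def Cov_Cat_Hom)
    have "continuous_map (topo Y) (topo Z) f0"
      unfolding tA(2) tB(2) by (rule continuous_map_transport[OF tA(1) tB(1) f(1)]) (simp_all add: f)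
    then show ?thesis
      using covering_morD(1,2)[OF f(1)] f(2)
      by (simp add: f' A' B' Cov_TC_Hom TC_mor_def C_hom_def hom_def)
  qed
  moreover have "f0 \<in> fst ` Hom ?D (pi_cover X A) (pi_cover X B)" if f0: "f0 \<in> Hom (Cov_TC \<Sigma> X) A B" for f0
  proof -
    have f: "f0 \<in> TC_mor \<Sigma> Y Z" and qf: "\<And>y. y \<in> carrier Y \<Longrightarrow> q (f0 y) = p y"
      using f0 by (simp_all add: A' B' Cov_TC_Hom)
    note cont = TC_morD(2)[OF f]
    have f0C: "f0 \<in> C_hom \<Sigma> (objs (fundamental_groupoid Y)) (objs (fundamental_groupoid Z))"
      "f0 \<in> extensional (carrier (objs (fundamental_groupoid Y)))"
      using TC_morD(1,3)[OF f] by (simp_all add: C_hom_def hom_def)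
    have lifts: "\<exists>b\<in>carrier (elts (fundamental_groupoid Z)). d0 (fundamental_groupoid Z) b = f0 (d0 (fundamental_groupoid Y) a) \<and>
        d1 (fundamental_groupoid Z) b = f0 (d1 (fundamental_groupoid Y) a) \<and>
        path_class_map Z X q b = path_class_map Y X p a" if a: "a \<in> carrier (elts (fundamental_groupoid Y))" for a
    proof -
      obtain g where g: "pathin (topo Y) g" "a = path_class (topo Y) g"
        using a by (auto elim: path_algebra_carrierE)
      have fg: "pathin (topo Z) (\<lambda>t. f0 (g t))" by (rule pathin_compose'[OF cont g(1)])
      have "path_class (topo X) (\<lambda>t. p (g t)) = path_class (topo X) (\<lambda>t. q (f0 (g t)))"
        by (rule path_class_cong)
           (use pathin_compose'[OF TC_morD(2)[OF AD(2)] g(1)] pathin_carrier[OF AD(1) g(1)] qf in simp_all)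
      then show ?thesis
        using g fg path_class_map[OF TC_morD(2)[OF AD(2)] g(1)] path_class_map[OF TC_morD(2)[OF BD(2)] fg]
        by (intro bexI[of _ "path_class (topo Z) (\<lambda>t. f0 (g t))"])
           (simp_all add: path_class_ends path_algebra_carrierI)
    qed
    obtain f1 where "(f0, f1) \<in> covering_mor \<Sigma> (fundamental_groupoid Y) (fundamental_groupoid Z)"
      "\<And>a. a \<in> carrier (elts (fundamental_groupoid Y)) \<Longrightarrow> path_class_map Z X q (f1 a) = path_class_map Y X p a"
      by (rule covering_mor_extend[OF
            internal_groupoid_fundamental_groupoid[OF gw AD(1)] internal_groupoid_fundamental_groupoid[OF gw BD(1)]
            covering_mor_path_class_map[OF X AD] covering_mor_path_class_map[OF X BD] f0C _ lifts])
         (simp_all add: qf)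
    then have "(f0, f1) \<in> Hom ?D (pi_cover X A) (pi_cover X B)"
      using qf by (simp add: A' B' pi_cover_def Cov_Cat_Hom)
    then show ?thesis by force
  qed
  moreover have "inj_on fst (Hom ?D (pi_cover X A) (pi_cover X B))"
    using Cov_Cat_Hom_eqI[OF piA piB] by (auto simp: inj_on_def)
  ultimately show ?thesis by (auto simp: bij_betw_def)
qed

text \<open>The objects of a covering groupoid, with the transport topology, are a
  covering whose paths are the paths of ends of lifts, so its groupoid is the given one.\<close>

lemma pi_cover_essentially_surjective:
  fixes X :: "('a, 'w, 'b) tgwo"
  assumes gw: "groups_with_operations \<Sigma>" and X: "TC_object \<Sigma> X"
    and lpc: "locally_path_connected_space (topo X)"
    and cov: "covering_map S (topo X) r" and sc: "simply_connected_space S"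
    and B: "B \<in> Ob (Cov_Cat \<Sigma> (fundamental_groupoid X) ::
       (((real \<Rightarrow> 'u) set, 'u, 'w, 'b) igpd \<times> (('u \<Rightarrow> 'a) \<times> ((real \<Rightarrow> 'u) set \<Rightarrow> (real \<Rightarrow> 'a) set)),
        ('u \<Rightarrow> 'u) \<times> ((real \<Rightarrow> 'u) set \<Rightarrow> (real \<Rightarrow> 'u) set)) cat)"
  shows "\<exists>A\<in>Ob (Cov_TC \<Sigma> X). \<exists>f. is_iso (Cov_Cat \<Sigma> (fundamental_groupoid X)) (pi_cover X A) B f"
proof -
  let ?D = "Cov_Cat \<Sigma> (fundamental_groupoid X) ::
       (((real \<Rightarrow> 'u) set, 'u, 'w, 'b) igpd \<times> (('u \<Rightarrow> 'a) \<times> ((real \<Rightarrow> 'u) set \<Rightarrow> (real \<Rightarrow> 'a) set)),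
        ('u \<Rightarrow> 'u) \<times> ((real \<Rightarrow> 'u) set \<Rightarrow> (real \<Rightarrow> 'u) set)) cat"
  obtain H p0 p1 where B': "B = (H, (p0, p1))" by (metis surj_pair)
  note BD = Cov_CatD[OF B[unfolded B']]
  interpret path_class_covering \<Sigma> X H p0 p1 using X BD by unfold_locales
  have covp: "covering_map transport_topology (topo X) p0"
  proof (rule covering_map_p0[OF lpc])
    show "path_connected_space (topo X)"
      using path_connected_space_covering_image[OF cov] sc by (simp add: simply_connected_space_def)
    fix x assume x: "x \<in> topspace (topo X)"
    obtain T where T: "openin (topo X) T" "x \<in> T" "\<And>g h. pathin (subtopology (topo X) T) g \<Longrightarrow>
        pathin (subtopology (topo X) T) h \<Longrightarrow> g 0 = h 0 \<Longrightarrow> g 1 = h 1 \<Longrightarrow> homotopic_paths_in (topo X) g h"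
      by (auto intro: semilocally_simply_connected[OF cov sc x])
    then show "\<exists>T. openin (topo X) T \<and> x \<in> T \<and> (\<forall>g h. pathin (subtopology (topo X) T) g \<longrightarrow>
        pathin (subtopology (topo X) T) h \<longrightarrow> g 0 = h 0 \<longrightarrow> g 1 = h 1 \<longrightarrow> homotopic_paths_in (topo X) g h)"
      by (intro exI[of _ T]) auto
  qed
  define A where "A = (total_space, p0)"
  have A: "A \<in> Ob (Cov_TC \<Sigma> X)"
    using TC_object_total_space p0_TC_mor covp by (simp add: A_def Cov_TC_def)
  note AD = Cov_TCD[OF A[unfolded A_def]]
  let ?Y = "total_space" and ?G = "fundamental_groupoid total_space" and ?q = "path_class_map total_space X p0"
  note GD = internal_groupoid_fundamental_groupoid[OF gw AD(1)] covering_mor_path_class_map[OF X AD]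
  have objs_G: "objs ?G = objs H" by (simp add: truncate_total_space)
  define i where "i = (\<lambda>x\<in>carrier (objs H). x)"
  have i: "i x = x" if "x \<in> carrier (objs H)" for x using that by (simp add: i_def)
  have iC: "i \<in> C_hom \<Sigma> (objs H) (objs H)" "i \<in> extensional (carrier (objs H))"
    using C_hom_id[OF internal_groupoidD(2)[OF BD(1)]] by (simp_all add: i_def)
  have cont: "continuous_map (topo ?Y) (topo X) p0" using TC_morD(2)[OF AD(2)] .
  have "\<exists>b\<in>carrier (elts H). d0 H b = i (d0 ?G a) \<and> d1 H b = i (d1 ?G a) \<and> p1 b = ?q a"
    if a: "a \<in> carrier (elts ?G)" for a
  proof -
    obtain g where g: "pathin transport_topology g" "a = path_class transport_topology g"
      using a by (auto elim: path_algebra_carrierE)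
    have g01: "g 0 \<in> carrier (objs H)" "g 1 \<in> carrier (objs H)" using pathin_topspace[OF g(1)] by auto
    have pg: "pathin (topo X) (\<lambda>t. p0 (g t))" by (rule pathin_compose'[OF continuous_map_p0 g(1)])
    obtain b where b: "b \<in> gstar H (g 0)" "p1 b = path_class (topo X) (\<lambda>t. p0 (g t))"
      by (rule lift_exists[OF g01(1) pg refl])
    obtain d where d: "pathin transport_topology d" "d 0 = g 0" "d 1 = d1 H b"
      "\<And>t. 0 \<le> t \<Longrightarrow> t \<le> 1 \<Longrightarrow> p0 (d t) = p0 (g t)"
      by (auto intro: path_lift_transport[OF g01(1) pg refl b])
    have "d 1 = g 1" by (rule unique_path_lift[OF covp d(1) g(1) d(2)]) (simp_all add: d(4))
    then show ?thesis
      using b d g g01 path_class_ends[of ?Y g] path_class_map[OF cont, of g]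
      by (intro bexI[of _ b]) (simp_all add: gstar_def i)
  qed
  then obtain f1 where f: "(i, f1) \<in> covering_mor \<Sigma> ?G H" "\<And>a. a \<in> carrier (elts ?G) \<Longrightarrow> p1 (f1 a) = ?q a"
    using iC by (auto intro: covering_mor_extend[OF GD(1) BD(1) GD(2) BD(3), of i] simp: truncate_total_space i)
  have "\<exists>b\<in>carrier (elts ?G). d0 ?G b = i (d0 H a) \<and> d1 ?G b = i (d1 H a) \<and> ?q b = p1 a"
    if a: "a \<in> carrier (elts H)" for a
  proof -
    note a01 = internal_groupoidD(8,9)[OF BD(1) a]
    have "p1 a \<in> carrier (path_algebra X)" using C_homD(1)[OF covering_morD(3)[OF BD(3)] a] by simp
    then obtain g where g: "pathin (topo X) g" "p1 a = path_class (topo X) g" by (rule path_algebra_carrierE)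
    have as: "a \<in> gstar H (d0 H a)" using a by (simp add: gstar_def)
    have g0: "g 0 = p0 (d0 H a)" using lift_end(2)[OF as g] by simp
    obtain d where d: "pathin transport_topology d" "d 0 = d0 H a" "d 1 = d1 H a"
      "\<And>t. 0 \<le> t \<Longrightarrow> t \<le> 1 \<Longrightarrow> p0 (d t) = g t"
      by (auto intro: path_lift_transport[OF a01(1) g(1) g0 as g(2)])
    have "path_class (topo X) (\<lambda>t. p0 (d t)) = path_class (topo X) g"
      by (rule path_class_cong[OF pathin_compose'[OF continuous_map_p0 d(1)] d(4)])
    then show ?thesis
      using d g a01 path_class_ends[of ?Y d] path_class_map[OF cont, of d] path_algebra_carrierI[of ?Y d]
      by (intro bexI[of _ "path_class transport_topology d"]) (simp_all add: i)
  qed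
  then obtain g1 where g: "(i, g1) \<in> covering_mor \<Sigma> H ?G" "\<And>a. a \<in> carrier (elts H) \<Longrightarrow> ?q (g1 a) = p1 a"
    using iC by (auto intro: covering_mor_extend[OF BD(1) GD(1) BD(3) GD(2), of i] simp: truncate_total_space i)
  have FA: "pi_cover X A = (?G, (p0, ?q))" by (simp add: A_def pi_cover_def)
  note piA = pi_cover_Ob[OF gw X A]
  have D: "is_category ?D" by (rule is_category_Cov_Cat)
  have id: "Idn ?D E \<in> Hom ?D E E" if "E \<in> Ob ?D" for E
    using D that unfolding is_category_def by blast
  have cmp: "Cmp ?D E E' E h' h \<in> Hom ?D E E"
    if "E \<in> Ob ?D" "E' \<in> Ob ?D" "h \<in> Hom ?D E E'" "h' \<in> Hom ?D E' E" for E E' h h'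
    using D that unfolding is_category_def by blast
  have fH: "(i, f1) \<in> Hom ?D (pi_cover X A) B" and gH: "(i, g1) \<in> Hom ?D B (pi_cover X A)"
    using f g by (simp_all add: FA B' Cov_Cat_Hom i)
  have ii: "compose (carrier (objs H)) i i = i" by (auto simp: i_def fun_eq_iff compose_def)
  have "Cmp ?D (pi_cover X A) B (pi_cover X A) (i, g1) (i, f1) = Idn ?D (pi_cover X A)"
    by (rule Cov_Cat_Hom_eqI[OF piA piA cmp[OF piA B fH gH] id[OF piA]])
       (simp add: Cov_Cat_def FA ii, simp add: i_def)
  moreover have "Cmp ?D B (pi_cover X A) B (i, f1) (i, g1) = Idn ?D B"
    by (rule Cov_Cat_Hom_eqI[OF B B cmp[OF B piA gH fH] id[OF B]])
       (simp add: Cov_Cat_def B' ii, simp add: i_def)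
  ultimately have "is_iso ?D (pi_cover X A) B (i, f1)"
    unfolding is_iso_def using fH gH by blast
  then show ?thesis using A by blast
qed

theorem theorem4p1:
  fixes \<Sigma> :: "('w, 'b) op_presentation"
    and X :: "('a, 'w, 'b) tgwo"
  assumes "groups_with_operations \<Sigma>"
    and "TC_object \<Sigma> X"
    and "locally_path_connected_space (topo X)"
    and "\<exists>(S :: 's topology) r. covering_map S (topo X) r \<and> simply_connected_space S"
  shows "equivalent_categories
    (Cov_TC \<Sigma> X :: (('u, 'w, 'b) tgwo \<times> ('u \<Rightarrow> 'a), 'u \<Rightarrow> 'u) cat)
    (Cov_Cat \<Sigma> (fundamental_groupoid X) ::
       (((real \<Rightarrow> 'u) set, 'u, 'w, 'b) igpd \<times> (('u \<Rightarrow> 'a) \<times> ((real \<Rightarrow> 'u) set \<Rightarrow> (real \<Rightarrow> 'a) set)),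
        ('u \<Rightarrow> 'u) \<times> ((real \<Rightarrow> 'u) set \<Rightarrow> (real \<Rightarrow> 'u) set)) cat)"
proof (rule equivalent_categories_if_bijective_on_homs[where Fo = "pi_cover X" and U = "\<lambda>A B. fst"])
  obtain S :: "'s topology" and r where cov: "covering_map S (topo X) r" and sc: "simply_connected_space S"
    using assms(4) by blast
  let ?C = "Cov_TC \<Sigma> X :: (('u, 'w, 'b) tgwo \<times> ('u \<Rightarrow> 'a), 'u \<Rightarrow> 'u) cat"
  let ?D = "Cov_Cat \<Sigma> (fundamental_groupoid X) ::
       (((real \<Rightarrow> 'u) set, 'u, 'w, 'b) igpd \<times> (('u \<Rightarrow> 'a) \<times> ((real \<Rightarrow> 'u) set \<Rightarrow> (real \<Rightarrow> 'a) set)),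
        ('u \<Rightarrow> 'u) \<times> ((real \<Rightarrow> 'u) set \<Rightarrow> (real \<Rightarrow> 'u) set)) cat"
  show "is_category ?C" by (rule is_category_Cov_TC)
  show "is_category ?D" by (rule is_category_Cov_Cat)
  show "pi_cover X A \<in> Ob ?D" if "A \<in> Ob ?C" for A
    by (rule pi_cover_Ob[OF assms(1,2) that])
  show "bij_betw fst (Hom ?D (pi_cover X A) (pi_cover X B)) (Hom ?C A B)" if "A \<in> Ob ?C" "B \<in> Ob ?C" for A B
    by (rule bij_betw_fst_pi_cover[OF assms(1-3) that])
  show "fst (Idn ?D (pi_cover X A)) = Idn ?C A" if "A \<in> Ob ?C" for A
    by (cases A) (simp add: Cov_Cat_def Cov_TC_def pi_cover_def)
  show "fst (Cmp ?D (pi_cover X A) (pi_cover X B) (pi_cover X E) g f) = Cmp ?C A B E (fst g) (fst f)" for A B E f g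
    by (cases A, cases f, cases g) (simp add: Cov_Cat_def Cov_TC_def pi_cover_def)
  show "\<exists>A\<in>Ob ?C. \<exists>f. is_iso ?D (pi_cover X A) B f" if "B \<in> Ob ?D" for B
    by (rule pi_cover_essentially_surjective[OF assms(1-3) cov sc that])
qed

end
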